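(* Suppose that a hereditary graph class $\mathcal{G}$ is polynomial-time recognizable. For every $0 < \varepsilon < 1$, CVC($\mathcal{G}$-Deletion) admits a PSAKS with $k^{\mathcal{O}(1/\varepsilon)}$ vertices if Connected Vertex Cover has a PTAS on the graph class $\mathcal{G} + 1\cdot \mathsf{v}$. Moreover, if this PTAS is an Efficient PTAS, then the PSAKS is a time efficient PSAKS.
   Context: Connected Vertex Cover asks for a minimum set of vertices of a graph that is a vertex cover and induces a connected subgraph. CVC($\mathcal{G}$-Deletion) is the parameterized (optimization) problem whose input is a graph $G$ together with a vertex set $S$ of size $k$ such that $G - S \in \mathcal{G}$ (the parameter is $k$), and the goal is a minimum connected vertex cover of $G$. The class $\mathcal{G} + 1\cdot \mathsf{v}$ is the class of graphs from which deleting at most one vertex yields a graph in $\mathcal{G}$. A PSAKS (polynomial size approximate kernelization scheme) is a family containing, for every $\alpha>1$, an $\alpha$-approximate kernelization whose output size is polynomial in $k$; it is time efficient if both the reduction and solution-lifting algorithms run in time $f(\alpha)\cdot|I|^c$ for a constant $c$ independent of $\alpha$. *)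

theory Defs
  imports Complex_Main "HOL-Library.Extended_Nonnegative_Real"
begin

section \<open>Graphs\<close>

record graph =
  verts :: "nat set"
  edges :: "nat set set"

definition simple_graph :: "graph \<Rightarrow> bool" where
  "simple_graph G \<longleftrightarrow> finite (verts G) \<and> (\<forall>e\<in>edges G. e \<subseteq> verts G \<and> card e = 2)"

definition induced :: "graph \<Rightarrow> nat set \<Rightarrow> graph" where
  "induced G X = \<lparr>verts = verts G \<inter> X, edges = {e \<in> edges G. e \<subseteq> X}\<rparr>"

definition delete_verts :: "graph \<Rightarrow> nat set \<Rightarrow> graph" where
  "delete_verts G X = induced G (verts G - X)"

definition graph_iso :: "graph \<Rightarrow> graph \<Rightarrow> bool" where
  "graph_iso G H \<longleftrightarrow> (\<exists>f. bij_betw f (verts G) (verts H) \<and>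
     (\<forall>u\<in>verts G. \<forall>v\<in>verts G. {u, v} \<in> edges G \<longleftrightarrow> {f u, f v} \<in> edges H))"

text \<open>The graph without vertices counts as connected, so the empty set is a connected vertex
  cover of an edgeless graph.\<close>

definition connected_graph :: "graph \<Rightarrow> bool" where
  "connected_graph G \<longleftrightarrow>
     (\<forall>u\<in>verts G. \<forall>v\<in>verts G. (u, v) \<in> {(x, y). {x, y} \<in> edges G}\<^sup>*)"

definition vertex_cover :: "graph \<Rightarrow> nat set \<Rightarrow> bool" where
  "vertex_cover G X \<longleftrightarrow> X \<subseteq> verts G \<and> (\<forall>e\<in>edges G. e \<inter> X \<noteq> {})"

definition connected_vertex_cover :: "graph \<Rightarrow> nat set \<Rightarrow> bool" where
  "connected_vertex_cover G X \<longleftrightarrow> vertex_cover G X \<and> connected_graph (induced G X)"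

definition graph_class :: "graph set \<Rightarrow> bool" where
  "graph_class \<G> \<longleftrightarrow> (\<forall>G\<in>\<G>. simple_graph G) \<and>
     (\<forall>G\<in>\<G>. \<forall>H. simple_graph H \<and> graph_iso G H \<longrightarrow> H \<in> \<G>)"

definition hereditary :: "graph set \<Rightarrow> bool" where
  "hereditary \<G> \<longleftrightarrow> (\<forall>G\<in>\<G>. \<forall>X. X \<subseteq> verts G \<longrightarrow> induced G X \<in> \<G>)"

definition plus_one_vertex :: "graph set \<Rightarrow> graph set" where
  "plus_one_vertex \<G> =
     {G. simple_graph G \<and> (\<exists>X. X \<subseteq> verts G \<and> card X \<le> 1 \<and> delete_verts G X \<in> \<G>)}"


section \<open>Computation model\<close>

text \<open>Algorithms are programs of a small Lisp-like language: data are binary trees over one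
  atom, as in the WHILE language of N. D. Jones (Computability and Complexity, 1997), and a
  program transforms one tree.  Every construct costs one unit.  Trees are never compared and can
  only be tested for being the atom, so they can be represented with sharing and each unit is a
  constant number of pointer operations; polynomial time is therefore the usual notion for
  functions whose values have polynomial size, and running times agree with those of Turing
  machines up to a fixed polynomial.\<close>

datatype tree = Leaf | Node tree tree

fun tree_size :: "tree \<Rightarrow> nat" where
  "tree_size Leaf = 1"
| "tree_size (Node x y) = tree_size x + tree_size y + 1"

fun left :: "tree \<Rightarrow> tree" where
  "left Leaf = Leaf"
| "left (Node x y) = x"

fun right :: "tree \<Rightarrow> tree" where
  "right Leaf = Leaf"
| "right (Node x y) = y"

datatype prog =
    Id
  | Const_Leaf
  | Left
  | Right
  | Pair prog prog
  | Seq prog prog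
  | Cond prog prog prog
  | While prog prog

text \<open>\<open>runs p x y t\<close>: on input \<open>x\<close>, program \<open>p\<close> halts with output \<open>y\<close> after \<open>t\<close> steps.
  The atom is false and every other tree is true.\<close>

inductive runs :: "prog \<Rightarrow> tree \<Rightarrow> tree \<Rightarrow> nat \<Rightarrow> bool" where
  Id: "runs Id x x 1"
| Const_Leaf: "runs Const_Leaf x Leaf 1"
| Left: "runs Left x (left x) 1"
| Right: "runs Right x (right x) 1"
| Pair: "runs p x y m \<Longrightarrow> runs q x z n \<Longrightarrow> runs (Pair p q) x (Node y z) (m + n + 1)"
| Seq: "runs p x y m \<Longrightarrow> runs q y z n \<Longrightarrow> runs (Seq p q) x z (m + n + 1)"
| Cond_True: "runs b x v l \<Longrightarrow> v \<noteq> Leaf \<Longrightarrow> runs p x y m \<Longrightarrow> runs (Cond b p q) x y (l + m + 1)"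
| Cond_False: "runs b x Leaf l \<Longrightarrow> runs q x y m \<Longrightarrow> runs (Cond b p q) x y (l + m + 1)"
| While_False: "runs b x Leaf l \<Longrightarrow> runs (While b p) x x (l + 1)"
| While_True: "runs b x v l \<Longrightarrow> v \<noteq> Leaf \<Longrightarrow> runs p x y m \<Longrightarrow> runs (While b p) y z n \<Longrightarrow>
    runs (While b p) x z (l + m + n + 1)"

lemma runs_deterministic:
  "runs p x y t \<Longrightarrow> runs p x y' t' \<Longrightarrow> y' = y \<and> t' = t"
proof (induction arbitrary: y' t' rule: runs.induct)
  case (Pair p x y m q z n)
  from Pair.prems show ?case by cases (use Pair.IH in blast)
next
  case (Seq p x y m q z n)
  from Seq.prems show ?case by cases (use Seq.IH in blast)
next
  case (Cond_True b x v l p y m q)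
  from Cond_True.prems show ?case by cases (use Cond_True.IH Cond_True.hyps in blast)+
next
  case (Cond_False b x l q y m p)
  from Cond_False.prems show ?case by cases (use Cond_False.IH in blast)+
next
  case (While_False b x l p)
  from While_False.prems show ?case by cases (use While_False.IH in blast)+
next
  case (While_True b x v l p y m z n)
  from While_True.prems show ?case by cases (use While_True.IH While_True.hyps in blast)+
qed (auto elim: runs.cases)

definition runs_within :: "prog \<Rightarrow> tree \<Rightarrow> tree \<Rightarrow> nat \<Rightarrow> bool" where
  "runs_within p x y T \<longleftrightarrow> (\<exists>t\<le>T. runs p x y t)"


section \<open>Encodings\<close>

fun enc_list :: "tree list \<Rightarrow> tree" where
  "enc_list [] = Leaf"
| "enc_list (x # xs) = Node x (enc_list xs)"

definition enc_bool :: "bool \<Rightarrow> tree" where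
  "enc_bool b = (if b then Node Leaf Leaf else Leaf)"

text \<open>A graph is handed to an algorithm with its vertices numbered \<open>0, \<dots>, n - 1\<close>, as an
  adjacency matrix; a vertex set is given by its characteristic vector.\<close>

definition numbered_graph :: "graph \<Rightarrow> bool" where
  "numbered_graph G \<longleftrightarrow> simple_graph G \<and> verts G = {..<card (verts G)}"

definition enc_vset :: "graph \<Rightarrow> nat set \<Rightarrow> tree" where
  "enc_vset G X = enc_list (map (\<lambda>i. enc_bool (i \<in> X)) [0..<card (verts G)])"

definition enc_graph :: "graph \<Rightarrow> tree" where
  "enc_graph G = enc_list (map (\<lambda>i. enc_vset G {j. {i, j} \<in> edges G}) [0..<card (verts G)])"

definition polytime_recognizable :: "graph set \<Rightarrow> bool" where
  "polytime_recognizable \<G> \<longleftrightarrow> (\<exists>p a c. \<forall>G. numbered_graph G \<longrightarrow>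
     runs_within p (enc_graph G) (enc_bool (G \<in> \<G>)) (a * tree_size (enc_graph G) ^ c))"


section \<open>Minimization problems and approximation schemes\<close>

text \<open>\<open>candidates\<close> are the objects that may be proposed as solutions of an instance; those that
  are not feasible have \<open>cost\<close> infinity.\<close>

record ('i, 's) min_problem =
  instances :: "'i set"
  candidates :: "'i \<Rightarrow> 's set"
  cost :: "'i \<Rightarrow> 's \<Rightarrow> ennreal"
  enc_inst :: "'i \<Rightarrow> tree"
  enc_sol :: "'i \<Rightarrow> 's \<Rightarrow> tree"

definition opt :: "('i, 's, 'm) min_problem_scheme \<Rightarrow> 'i \<Rightarrow> ennreal" where
  "opt Q I = (INF s\<in>candidates Q I. cost Q I s)"

text \<open>An optimal candidate has ratio 1 also when the optimum is 0 or infinity.  Hence, for an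
  instance without feasible solution, all candidates have ratio 1.  Otherwise an infeasible
  candidate has ratio infinity, as has one of positive cost when the optimum is 0.\<close>

definition ratio :: "('i, 's, 'm) min_problem_scheme \<Rightarrow> 'i \<Rightarrow> 's \<Rightarrow> ennreal" where
  "ratio Q I s = (if cost Q I s = opt Q I then 1 else cost Q I s / opt Q I)"

definition inst_size :: "('i, 's, 'm) min_problem_scheme \<Rightarrow> 'i \<Rightarrow> nat" where
  "inst_size Q I = tree_size (enc_inst Q I)"

definition approx_scheme_within ::
    "('i, 's, 'm) min_problem_scheme \<Rightarrow> (real \<Rightarrow> prog) \<Rightarrow> (real \<Rightarrow> nat \<Rightarrow> nat) \<Rightarrow> bool" where
  "approx_scheme_within Q P T \<longleftrightarrow> (\<forall>\<epsilon>>0. \<forall>I\<in>instances Q. \<exists>s\<in>candidates Q I.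
     runs_within (P \<epsilon>) (enc_inst Q I) (enc_sol Q I s) (T \<epsilon> (inst_size Q I)) \<and>
     ratio Q I s \<le> ennreal (1 + \<epsilon>))"

definition is_PTAS :: "('i, 's, 'm) min_problem_scheme \<Rightarrow> (real \<Rightarrow> prog) \<Rightarrow> bool" where
  "is_PTAS Q P \<longleftrightarrow> (\<exists>a c. approx_scheme_within Q P (\<lambda>\<epsilon> n. a \<epsilon> * n ^ c \<epsilon>))"

definition is_EPTAS :: "('i, 's, 'm) min_problem_scheme \<Rightarrow> (real \<Rightarrow> prog) \<Rightarrow> bool" where
  "is_EPTAS Q P \<longleftrightarrow> (\<exists>f c. approx_scheme_within Q P (\<lambda>\<epsilon> n. f \<epsilon> * n ^ c))"


section \<open>Approximate kernelization\<close>

record ('i, 's) param_problem = "('i, 's) min_problem" +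
  param :: "'i \<Rightarrow> nat"

text \<open>\<open>R\<close> is the reduction algorithm, \<open>L\<close> the solution-lifting algorithm, \<open>T\<close> bounds both
  running times and \<open>g\<close> bounds the output size.  The solution \<open>s'\<close> to be lifted is an arbitrary
  candidate of the reduced instance, so an infeasible reduced instance does not make the
  requirement on \<open>L\<close> vacuous.\<close>

definition approx_kernelization ::
    "('i, 's, 'm) param_problem_scheme \<Rightarrow> real \<Rightarrow> prog \<Rightarrow> prog \<Rightarrow> (nat \<Rightarrow> nat) \<Rightarrow> (nat \<Rightarrow> nat) \<Rightarrow> bool"
  where
  "approx_kernelization Q \<alpha> R L T g \<longleftrightarrow> (\<forall>I\<in>instances Q. \<exists>I'\<in>instances Q.
     runs_within R (enc_inst Q I) (enc_inst Q I') (T (inst_size Q I)) \<and>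
     inst_size Q I' + param Q I' \<le> g (param Q I) \<and>
     (\<forall>s'\<in>candidates Q I'. \<exists>s\<in>candidates Q I.
        runs_within L (Node (enc_inst Q I) (Node (enc_inst Q I') (enc_sol Q I' s')))
          (enc_sol Q I s) (T (inst_size Q I)) \<and>
        ratio Q I s \<le> ennreal \<alpha> * ratio Q I' s'))"

definition PSAKS_within ::
    "('i, 's, 'm) param_problem_scheme \<Rightarrow> (real \<Rightarrow> prog) \<Rightarrow> (real \<Rightarrow> prog) \<Rightarrow>
      (real \<Rightarrow> nat \<Rightarrow> nat) \<Rightarrow> bool" where
  "PSAKS_within Q R L T \<longleftrightarrow> (\<forall>\<alpha>>1. \<exists>b d.
     approx_kernelization Q \<alpha> (R \<alpha>) (L \<alpha>) (T \<alpha>) (\<lambda>k. b * (k + 1) ^ d))"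

definition is_PSAKS ::
    "('i, 's, 'm) param_problem_scheme \<Rightarrow> (real \<Rightarrow> prog) \<Rightarrow> (real \<Rightarrow> prog) \<Rightarrow> bool" where
  "is_PSAKS Q R L \<longleftrightarrow> (\<exists>a c. PSAKS_within Q R L (\<lambda>\<alpha> n. a \<alpha> * n ^ c \<alpha>))"

definition is_time_efficient_PSAKS ::
    "('i, 's, 'm) param_problem_scheme \<Rightarrow> (real \<Rightarrow> prog) \<Rightarrow> (real \<Rightarrow> prog) \<Rightarrow> bool" where
  "is_time_efficient_PSAKS Q R L \<longleftrightarrow> (\<exists>f c. PSAKS_within Q R L (\<lambda>\<alpha> n. f \<alpha> * n ^ c))"


section \<open>Connected Vertex Cover\<close>

definition cvc_cost :: "graph \<Rightarrow> nat set \<Rightarrow> ennreal" where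
  "cvc_cost G X = (if connected_vertex_cover G X then of_nat (card X) else \<infinity>)"

definition CVC_on :: "graph set \<Rightarrow> (graph, nat set) min_problem" where
  "CVC_on \<H> = \<lparr>
     instances = {G \<in> \<H>. numbered_graph G},
     candidates = (\<lambda>G. Pow (verts G)),
     cost = cvc_cost,
     enc_inst = enc_graph,
     enc_sol = enc_vset\<rparr>"

definition CVC_deletion :: "graph set \<Rightarrow> (graph \<times> nat set, nat set) param_problem" where
  "CVC_deletion \<G> = \<lparr>
     instances = {(G, S). numbered_graph G \<and> S \<subseteq> verts G \<and> delete_verts G S \<in> \<G>},
     candidates = (\<lambda>(G, S). Pow (verts G)),
     cost = (\<lambda>(G, S). cvc_cost G),
     enc_inst = (\<lambda>(G, S). Node (enc_graph G) (enc_vset G S)),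
     enc_sol = (\<lambda>(G, S). enc_vset G),
     param = (\<lambda>(G, S). card S)\<rparr>"

definition kernel_vertices_le :: "graph set \<Rightarrow> prog \<Rightarrow> (nat \<Rightarrow> real) \<Rightarrow> bool" where
  "kernel_vertices_le \<G> R h \<longleftrightarrow>
     (\<forall>G S G' S' t. (G, S) \<in> instances (CVC_deletion \<G>) \<longrightarrow> (G', S') \<in> instances (CVC_deletion \<G>) \<longrightarrow>
        runs R (enc_inst (CVC_deletion \<G>) (G, S)) (enc_inst (CVC_deletion \<G>) (G', S')) t \<longrightarrow>
        real (card (verts G')) \<le> h (card S))"

end

theory Submission
  imports Defs
begin

text \<open>Let \<open>k\<close> be the size of the modulator \<open>S\<close>.  Contracting \<open>S\<close> to one vertex gives a graph in
  \<open>\<G> + 1\<cdot>v\<close> whose optimum is at most that of \<open>G\<close>.  An approximate solution of it, together with \<open>S\<close>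
  and at most \<open>k + 1\<close> connecting vertices, is a connected vertex cover \<open>X\<close> of \<open>G\<close> with
  \<open>|X| \<le> (1 + \<delta>) OPT + 5 (k - 1)\<close>; for \<open>k \<le> 1\<close> no contraction is needed.  If
  \<open>|X| \<ge> d (k - 1)\<close> with \<open>d\<close> of order \<open>1/\<epsilon>\<close>, the additive term is negligible, so the kernel is
  empty and \<open>X\<close> itself is the lifted solution.

  Otherwise \<open>N = |X| < d (k - 1)\<close> is small and \<open>G - X\<close> is edgeless.  Keep \<open>X\<close> and up to \<open>N + 1\<close>
  neighbours of each of its vertices.  A vertex of \<open>X\<close> with a neighbour that was dropped has more than \<open>N\<close>
  kept neighbours and hence lies in every solution of size at most \<open>N\<close>, so dropped vertices matter only for
  connectivity.  Greedily add every dropped vertex that joins at least \<open>d\<close> of the current blobs; this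
  costs at most \<open>OPT / (d - 1)\<close>.  Every other dropped vertex sees fewer than \<open>d\<close> blobs, and one
  representative for each set of blobs suffices: at most \<open>\<Sum>j<d. N choose j\<close>, which is
  \<open>k\<close> to the power \<open>O(d)\<close> (bounding it by a power of \<open>N\<close> would lose a factor \<open>d\<close> to the power
  \<open>d\<close>).  If the solution of the kernel is larger than \<open>X\<close>, the lifting algorithm returns \<open>X\<close>.\<close>

section \<open>Polynomial-time functions\<close>

text \<open>The vertex bound k powr (C / \<epsilon>) leaves no room for an additive constant: it is
  0 for k = 0 and 1 for k = 1. Error terms are therefore written with k - 1, and instances with k
  \<le> 1, which lie in \<G> + 1\<cdot>v themselves, get the empty kernel. For k \<ge> 2 the
  expansion costs k for the modulator and k + 1 for connectors, and 2k + 1 \<le> 5 (k - 1). A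
  connected vertex cover need not exist. Then every candidate has ratio 1, but the kernel must still
  be small; its size bound rests only on the test |X| < d (k - 1), never on feasibility. The
  accuracy enters in two places only: the call of the scheme and the threshold d, which is handed as
  data to programs that are otherwise fixed. So the degree of the running time depends on the
  exponent of the scheme alone, which gives time efficiency. The lifting program recomputes X and
  the set of kept vertices from the instance by calling the scheme again.\<close>

text \<open>Programs are derived from HOL functions on encodable types by closure rules.  The size of the
  output is bounded explicitly because trees with sharing can grow exponentially in polynomial time.\<close>

class encodable =
  fixes encode :: "'a \<Rightarrow> tree"

instantiation tree :: encodable begin
definition encode_tree :: "tree \<Rightarrow> tree" where "encode_tree t = t"
instance ..
end

instantiation bool :: encodable begin
definition encode_bool :: "bool \<Rightarrow> tree" where "encode_bool = enc_bool"
instance ..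
end

instantiation prod :: (encodable, encodable) encodable begin
definition encode_prod :: "'a \<times> 'b \<Rightarrow> tree" where
  "encode_prod p = Node (encode (fst p)) (encode (snd p))"
instance ..
end

instantiation list :: (encodable) encodable begin
definition encode_list :: "'a list \<Rightarrow> tree" where "encode_list xs = enc_list (map encode xs)"
instance ..
end

lemma encode_simps [simp]:
  "encode (x, y) = Node (encode x) (encode y)"
  "encode [] = Leaf"
  "encode (z # zs) = Node (encode z) (encode zs)"
  "encode True = Node Leaf Leaf"
  "encode False = Leaf"
  by (simp_all add: encode_prod_def encode_list_def encode_bool_def enc_bool_def)

lemma encode_pair: "encode p = Node (encode (fst p)) (encode (snd p))"
  by (simp add: encode_prod_def)

definition enc_size :: "'a::encodable \<Rightarrow> nat" where
  "enc_size x = tree_size (encode x)"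

lemma enc_size_simps [simp]:
  "enc_size (x, y) = enc_size x + enc_size y + 1"
  "enc_size [] = 1"
  "enc_size (z # zs) = enc_size z + enc_size zs + 1"
  by (simp_all add: enc_size_def)

lemma tree_size_pos: "1 \<le> tree_size t"
  by (cases t) auto

lemma enc_size_pos: "1 \<le> enc_size x"
  using tree_size_pos[of "encode x"] by (simp add: enc_size_def)

lemma enc_size_bool: "enc_size (b::bool) \<le> 3"
  by (cases b) (auto simp: enc_size_def)

lemma enc_size_fst: "enc_size (fst p) \<le> enc_size p"
  by (cases p) auto

lemma enc_size_snd: "enc_size (snd p) \<le> enc_size p"
  by (cases p) auto

lemma enc_size_append: "enc_size (xs @ ys) + 1 = enc_size xs + enc_size ys"
  by (induction xs) auto

lemma enc_size_mem: "y \<in> set ys \<Longrightarrow> enc_size y \<le> enc_size ys"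
  by (induction ys) auto

lemma length_le_enc_size: "length ys \<le> enc_size ys"
  by (induction ys) auto

lemma enc_size_filter: "enc_size (filter P xs) \<le> enc_size xs"
  by (induction xs) auto

lemma enc_size_list_le:
  assumes "\<And>y. y \<in> set ys \<Longrightarrow> enc_size y \<le> b"
  shows "enc_size ys \<le> 1 + length ys * (b + 1)"
  using assms
proof (induction ys)
  case (Cons y ys)
  have "enc_size y \<le> b" "enc_size ys \<le> 1 + length ys * (b + 1)" using Cons by auto
  then show ?case by simp
qed simp

lemma enc_size_bool_list: "enc_size (xs :: bool list) \<le> 1 + 4 * length xs"
  using enc_size_list_le[of xs 3] enc_size_bool by (simp add: mult.commute)

section \<open>Bounds that are monomials in the encoding size\<close>

definition poly_bounded :: "('a::encodable \<Rightarrow> nat) \<Rightarrow> bool" where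
  "poly_bounded g \<longleftrightarrow> (\<exists>a c. \<forall>x. g x \<le> a * enc_size x ^ c)"

lemma poly_bounded_mono: "poly_bounded h \<Longrightarrow> (\<And>x. g x \<le> h x) \<Longrightarrow> poly_bounded g"
  unfolding poly_bounded_def by (meson le_trans)

lemma poly_bounded_const: "poly_bounded (\<lambda>x. k)"
  unfolding poly_bounded_def by (rule exI[of _ k], rule exI[of _ 0]) simp

lemma poly_bounded_size: "poly_bounded enc_size"
  unfolding poly_bounded_def by (rule exI[of _ 1], rule exI[of _ 1]) simp

lemma poly_bounded_mult:
  assumes "poly_bounded f" "poly_bounded g"
  shows "poly_bounded (\<lambda>x. f x * g x)"
proof -
  obtain a c b d where "\<And>x. f x \<le> a * enc_size x ^ c" "\<And>x. g x \<le> b * enc_size x ^ d"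
    using assms unfolding poly_bounded_def by metis
  then have "f x * g x \<le> (a * b) * enc_size x ^ (c + d)" for x
    using mult_le_mono[of "f x" "a * enc_size x ^ c" "g x" "b * enc_size x ^ d"]
    by (simp add: power_add ac_simps)
  then show ?thesis unfolding poly_bounded_def by blast
qed

text \<open>Encodings have size at least 1, so raising both exponents to their sum only weakens the
  bounds. This is why single monomials suffice.\<close>

lemma poly_bounded_add:
  assumes "poly_bounded f" "poly_bounded g"
  shows "poly_bounded (\<lambda>x. f x + g x)"
proof -
  obtain a c b d where *: "\<And>x. f x \<le> a * enc_size x ^ c" "\<And>x. g x \<le> b * enc_size x ^ d"
    using assms unfolding poly_bounded_def by metis
  have "f x + g x \<le> (a + b) * enc_size x ^ (c + d)" for x
  proof -
    have "enc_size x ^ c \<le> enc_size x ^ (c + d)" "enc_size x ^ d \<le> enc_size x ^ (c + d)"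
      using enc_size_pos[of x] by (auto intro: power_increasing)
    then have "a * enc_size x ^ c + b * enc_size x ^ d \<le> (a + b) * enc_size x ^ (c + d)"
      by (simp add: add_mult_distrib add_mono)
    then show ?thesis using *[of x] by linarith
  qed
  then show ?thesis unfolding poly_bounded_def by blast
qed

text \<open>A bound in the size of \<open>f x\<close> becomes one in the size of \<open>x\<close>
  only because the outputs of \<open>f\<close> are polynomially small.\<close>

lemma poly_bounded_comp:
  assumes "poly_bounded t" "poly_bounded (\<lambda>x. enc_size (f x))"
  shows "poly_bounded (\<lambda>x. t (f x))"
proof -
  obtain a c b d where *: "\<And>x. t x \<le> a * enc_size x ^ c" "\<And>x. enc_size (f x) \<le> b * enc_size x ^ d"
    using assms unfolding poly_bounded_def by metis
  have "t (f x) \<le> (a * b ^ c) * enc_size x ^ (d * c)" for x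
  proof -
    have "enc_size (f x) ^ c \<le> (b * enc_size x ^ d) ^ c"
      using *(2) by (intro power_mono) auto
    then have "a * enc_size (f x) ^ c \<le> a * (b * enc_size x ^ d) ^ c" by simp
    also have "\<dots> = (a * b ^ c) * enc_size x ^ (d * c)"
      by (simp add: power_mult_distrib power_mult)
    finally show ?thesis using *(1)[of "f x"] by linarith
  qed
  then show ?thesis unfolding poly_bounded_def by blast
qed

lemmas poly_bounded_intros =
  poly_bounded_const poly_bounded_size poly_bounded_mult poly_bounded_add

section \<open>Time bounds for the program constructs\<close>

lemma runs_within_mono: "runs_within p x y m \<Longrightarrow> m \<le> n \<Longrightarrow> runs_within p x y n"
  unfolding runs_within_def by (meson le_trans)

lemma runs_within_Pair:
  "runs_within p x y m \<Longrightarrow> runs_within q x z n \<Longrightarrow> runs_within (Pair p q) x (Node y z) (m + n + 1)"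
  unfolding runs_within_def by (metis add_le_mono add_mono1 runs.Pair le_refl)

lemma runs_within_Seq:
  "runs_within p x y m \<Longrightarrow> runs_within q y z n \<Longrightarrow> runs_within (Seq p q) x z (m + n + 1)"
  unfolding runs_within_def by (metis add_le_mono runs.Seq le_refl)

lemma runs_within_Cond_True:
  "runs_within b x v l \<Longrightarrow> v \<noteq> Leaf \<Longrightarrow> runs_within p x y m \<Longrightarrow>
    runs_within (Cond b p q) x y (l + m + 1)"
  unfolding runs_within_def by (metis add_le_mono runs.Cond_True le_refl)

lemma runs_within_Cond_False:
  "runs_within b x Leaf l \<Longrightarrow> runs_within q x y m \<Longrightarrow> runs_within (Cond b p q) x y (l + m + 1)"
  unfolding runs_within_def by (metis add_le_mono runs.Cond_False le_refl)

lemma runs_within_While_False: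
  "runs_within b x Leaf l \<Longrightarrow> runs_within (While b p) x x (l + 1)"
  unfolding runs_within_def by (metis add_le_mono runs.While_False le_refl)

lemma runs_within_While_True:
  "runs_within b x v l \<Longrightarrow> v \<noteq> Leaf \<Longrightarrow> runs_within p x y m \<Longrightarrow> runs_within (While b p) y z n \<Longrightarrow>
    runs_within (While b p) x z (l + m + n + 1)"
  unfolding runs_within_def by (metis add_le_mono runs.While_True le_refl)

lemma runs_within_atomic:
  "runs_within Id x x 1" "runs_within Const_Leaf x Leaf 1"
  "runs_within Left x (left x) 1" "runs_within Right x (right x) 1"
  unfolding runs_within_def using runs.Id runs.Const_Leaf runs.Left runs.Right by blast+

definition polyt :: "('a::encodable \<Rightarrow> 'b::encodable) \<Rightarrow> bool" where
  "polyt f \<longleftrightarrow> poly_bounded (\<lambda>x. enc_size (f x)) \<and>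
     (\<exists>p t. poly_bounded t \<and> (\<forall>x. runs_within p (encode x) (encode (f x)) (t x)))"

lemma polytI:
  assumes "poly_bounded (\<lambda>x. enc_size (f x))" "poly_bounded t"
    and "\<And>x. runs_within p (encode x) (encode (f x)) (t x)"
  shows "polyt f"
  using assms unfolding polyt_def by blast

lemma polyt_size: "polyt f \<Longrightarrow> poly_bounded (\<lambda>x. enc_size (f x))"
  unfolding polyt_def by blast

lemma polyt_comp:
  assumes "polyt f" "polyt g"
  shows "polyt (\<lambda>x. f (g x))"
proof -
  obtain p t q s where *: "poly_bounded t" "\<And>x. runs_within p (encode x) (encode (f x)) (t x)"
    "poly_bounded s" "\<And>x. runs_within q (encode x) (encode (g x)) (s x)"
    using assms unfolding polyt_def by metis
  show ?thesis
  proof (rule polytI[where p = "Seq q p" and t = "\<lambda>x. s x + t (g x) + 1"])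
    show "poly_bounded (\<lambda>x. enc_size (f (g x)))"
      using poly_bounded_comp[OF polyt_size[OF assms(1)] polyt_size[OF assms(2)]] .
    show "poly_bounded (\<lambda>x. s x + t (g x) + 1)"
      by (intro poly_bounded_add poly_bounded_const *(3) poly_bounded_comp[OF *(1) polyt_size[OF assms(2)]])
    show "runs_within (Seq q p) (encode x) (encode (f (g x))) (s x + t (g x) + 1)" for x
      by (rule runs_within_Seq[OF *(4) *(2)])
  qed
qed

named_theorems polyt_intros

lemma polyt_id [polyt_intros]: "polyt (\<lambda>x. x)"
  by (rule polytI[where p = Id and t = "\<lambda>_. 1"])
    (intro poly_bounded_intros runs_within_atomic)+

lemma polyt_Pair [polyt_intros]:
  assumes "polyt f" "polyt g"
  shows "polyt (\<lambda>x. (f x, g x))"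
proof -
  obtain p t q s where *: "poly_bounded t" "\<And>x. runs_within p (encode x) (encode (f x)) (t x)"
    "poly_bounded s" "\<And>x. runs_within q (encode x) (encode (g x)) (s x)"
    using assms unfolding polyt_def by metis
  show ?thesis
  proof (rule polytI[where p = "Pair p q" and t = "\<lambda>x. t x + s x + 1"])
    show "poly_bounded (\<lambda>x. enc_size (f x, g x))"
      unfolding enc_size_simps by (intro poly_bounded_intros polyt_size assms)
    show "poly_bounded (\<lambda>x. t x + s x + 1)" using * by (intro poly_bounded_intros)
    show "runs_within (Pair p q) (encode x) (encode (f x, g x)) (t x + s x + 1)" for x
      using runs_within_Pair[OF *(2)[of x] *(4)[of x]] by simp
  qed
qed

lemma polyt_fst0: "polyt fst"
  by (rule polytI[where p = Left and t = "\<lambda>_. 1"])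
    (auto intro: poly_bounded_mono[OF poly_bounded_size] poly_bounded_const enc_size_fst
      runs_within_mono runs_within_atomic(3)[of "Node _ _", simplified] simp: encode_pair)

lemma polyt_snd0: "polyt snd"
  by (rule polytI[where p = Right and t = "\<lambda>_. 1"])
    (auto intro: poly_bounded_mono[OF poly_bounded_size] poly_bounded_const enc_size_snd
      runs_within_mono runs_within_atomic(4)[of "Node _ _", simplified] simp: encode_pair)

lemmas polyt_fst [polyt_intros] = polyt_comp[OF polyt_fst0]
lemmas polyt_snd [polyt_intros] = polyt_comp[OF polyt_snd0]

fun const_prog :: "tree \<Rightarrow> prog" where
  "const_prog Leaf = Const_Leaf"
| "const_prog (Node x y) = Pair (const_prog x) (const_prog y)"

lemma runs_const_prog: "runs_within (const_prog c) x c (tree_size c)"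
proof (induction c)
  case (Node y z)
  from runs_within_Pair[OF this] show ?case by simp
qed (use runs_within_atomic in simp)

lemma polyt_const [polyt_intros]: "polyt (\<lambda>x. c)"
  by (rule polytI[where p = "const_prog (encode c)" and t = "\<lambda>_. enc_size c"])
    (auto intro: poly_bounded_intros runs_const_prog simp: enc_size_def)

lemma polyt_if [polyt_intros]:
  assumes b: "polyt b" and "polyt f" "polyt g"
  shows "polyt (\<lambda>x. if b x then f x else g x)"
proof -
  obtain p t q s r u where *: "poly_bounded t" "\<And>x. runs_within p (encode x) (encode (f x)) (t x)"
    "poly_bounded s" "\<And>x. runs_within q (encode x) (encode (g x)) (s x)"
    "poly_bounded u" "\<And>x. runs_within r (encode x) (encode (b x)) (u x)"
    using assms unfolding polyt_def by metis
  show ?thesis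
  proof (rule polytI[where p = "Cond r p q" and t = "\<lambda>x. u x + (t x + s x) + 1"])
    show "poly_bounded (\<lambda>x. enc_size (if b x then f x else g x))"
      by (rule poly_bounded_mono[OF poly_bounded_add[OF assms(2,3)[THEN polyt_size]]]) auto
    show "poly_bounded (\<lambda>x. u x + (t x + s x) + 1)" using * by (intro poly_bounded_intros)
    fix x
    show "runs_within (Cond r p q) (encode x) (encode (if b x then f x else g x))
        (u x + (t x + s x) + 1)"
    proof (cases "b x")
      case True
      have "runs_within (Cond r p q) (encode x) (encode (f x)) (u x + t x + 1)"
        using *(6)[of x] True by (intro runs_within_Cond_True[OF _ _ *(2)]) auto
      then show ?thesis using True by (auto intro: runs_within_mono)
    next
      case False
      have "runs_within (Cond r p q) (encode x) (encode (g x)) (u x + s x + 1)"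
        using *(6)[of x] False by (intro runs_within_Cond_False[OF _ *(4)]) auto
      then show ?thesis using False by (auto intro: runs_within_mono)
    qed
  qed
qed

text \<open>The cost of the second branch is known as a function of the triple
  \<open>(x, y, ys)\<close>, whereas the bound may mention \<open>x\<close> alone. The gap is closed
  because \<open>y # ys\<close> is the output of \<open>l\<close> and hence of polynomial
  size.\<close>

lemma polyt_case_list [polyt_intros]:
  fixes l :: "'a::encodable \<Rightarrow> 'b::encodable list" and f :: "'a \<Rightarrow> 'c::encodable"
  assumes l: "polyt l" and f: "polyt f" and g: "polyt (\<lambda>p. g (fst p) (fst (snd p)) (snd (snd p)))"
  shows "polyt (\<lambda>x. case l x of [] \<Rightarrow> f x | y # ys \<Rightarrow> g x y ys)"
proof -
  obtain p t where p: "poly_bounded t" "\<And>x. runs_within p (encode x) (encode (f x)) (t x)"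
    using f unfolding polyt_def by blast
  obtain q s where q: "poly_bounded s"
    "\<And>z. runs_within q (encode z) (encode (g (fst z) (fst (snd z)) (snd (snd z)))) (s z)"
    using g unfolding polyt_def by blast
  obtain r u where r: "poly_bounded u" "\<And>x. runs_within r (encode x) (encode (l x)) (u x)"
    using l unfolding polyt_def by blast
  define s' where "s' x = (case l x of [] \<Rightarrow> 0 | y # ys \<Rightarrow> s (x, y, ys))" for x
  define z' where "z' x = (case l x of [] \<Rightarrow> 0 | y # ys \<Rightarrow> enc_size (g x y ys))" for x
  have aux: "\<exists>a c. \<forall>x y ys. h (x, y, ys) \<le> a * (enc_size x + enc_size (y # ys)) ^ c"
    if h: "poly_bounded h" for h :: "'a \<times> 'b \<times> 'b list \<Rightarrow> nat"
  proof -
    obtain a c where ac: "\<And>z. h z \<le> a * enc_size z ^ c" using h unfolding poly_bounded_def by blast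
    \<comment> \<open>The triple is one node larger than the sizes of \<open>x\<close> and
      \<open>y # ys\<close> together, which the factor 2 absorbs.\<close>
    have "h (x, y, ys) \<le> (a * 2 ^ c) * (enc_size x + enc_size (y # ys)) ^ c" for x y ys
    proof -
      have "enc_size (x, y, ys) ^ c \<le> (2 * (enc_size x + enc_size (y # ys))) ^ c"
        by (intro power_mono) auto
      then have "a * enc_size (x, y, ys) ^ c \<le> a * (2 * (enc_size x + enc_size (y # ys))) ^ c" by simp
      then show ?thesis using ac[of "(x, y, ys)"]
        by (metis (no_types, lifting) le_trans mult.assoc power_mult_distrib)
    qed
    then show ?thesis by blast
  qed
  have ul: "poly_bounded (\<lambda>x. enc_size x + enc_size (l x))"
    by (intro poly_bounded_intros polyt_size[OF l])
  have lift: "poly_bounded (\<lambda>x. case l x of [] \<Rightarrow> 0 | y # ys \<Rightarrow> h (x, y, ys))"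
    if h: "poly_bounded h" for h :: "'a \<times> 'b \<times> 'b list \<Rightarrow> nat"
  proof -
    obtain a c where ac: "\<And>x y ys. h (x, y, ys) \<le> a * (enc_size x + enc_size (y # ys)) ^ c"
      using aux[OF h] by blast
    have "poly_bounded (\<lambda>x. a * (enc_size x + enc_size (l x)) ^ c)"
    proof (intro poly_bounded_intros)
      show "poly_bounded (\<lambda>x. (enc_size x + enc_size (l x)) ^ c)"
      proof (induction c)
        case 0 show ?case by (simp add: poly_bounded_const del: One_nat_def)
      next
        case (Suc c) then show ?case using poly_bounded_mult[OF ul Suc] by simp
      qed
    qed
    then show ?thesis
    proof (rule poly_bounded_mono)
      fix x show "(case l x of [] \<Rightarrow> 0 | y # ys \<Rightarrow> h (x, y, ys)) \<le> a * (enc_size x + enc_size (l x)) ^ c"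
        using ac by (cases "l x") auto
    qed
  qed
  show ?thesis
  \<comment> \<open>The list is its own test, since only the empty list is encoded by the atom. A
    cons cell is encoded like the pair of head and tail, so \<open>Pair Id r\<close> already yields
    the triple that \<open>q\<close> expects.\<close>
  proof (rule polytI[where p = "Cond r (Seq (Pair Id r) q) p"
        and t = "\<lambda>x. u x + (t x + (u x + s' x + 5)) + 1"])
    have "poly_bounded z'"
      unfolding z'_def using lift[OF polyt_size[OF g]] by (simp only: fst_conv snd_conv)
    then show "poly_bounded (\<lambda>x. enc_size (case l x of [] \<Rightarrow> f x | y # ys \<Rightarrow> g x y ys))"
      by (rule poly_bounded_mono[OF poly_bounded_add[OF polyt_size[OF f]]])
        (auto simp: z'_def split: list.split)
    show "poly_bounded (\<lambda>x. u x + (t x + (u x + s' x + 5)) + 1)"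
      using lift[OF q(1)] unfolding s'_def by (intro poly_bounded_intros r p)
    fix x
    show "runs_within (Cond r (Seq (Pair Id r) q) p) (encode x)
       (encode (case l x of [] \<Rightarrow> f x | y # ys \<Rightarrow> g x y ys)) (u x + (t x + (u x + s' x + 5)) + 1)"
    proof (cases "l x")
      case Nil
      have "runs_within (Cond r (Seq (Pair Id r) q) p) (encode x) (encode (f x)) (u x + t x + 1)"
        using r(2)[of x] p(2)[of x] Nil by (intro runs_within_Cond_False) auto
      then show ?thesis by (auto simp: Nil intro: runs_within_mono)
    next
      case (Cons y ys)
      have "runs_within (Pair Id r) (encode x) (encode (x, y, ys)) (1 + u x + 1)"
        using runs_within_Pair[OF runs_within_atomic(1) r(2)[of x]] Cons by simp
      from runs_within_Seq[OF this q(2)[of "(x, y, ys)"]]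
      have "runs_within (Cond r (Seq (Pair Id r) q) p) (encode x) (encode (g x y ys))
          (u x + (1 + u x + 1 + s (x, y, ys) + 1) + 1)"
        using r(2)[of x] Cons by (intro runs_within_Cond_True[where v = "encode (l x)"]) auto
      then show ?thesis by (auto simp: Cons s'_def intro: runs_within_mono)
    qed
  qed
qed

text \<open>The loop state is \<open>(x, accumulator, remaining list)\<close>, where the parameter \<open>x\<close> stays fixed.\<close>

definition foldl_prog :: "prog \<Rightarrow> prog" where
  "foldl_prog p = While (Seq Right Right)
     (Pair Left (Pair
       (Seq (Pair Left (Pair (Seq Right Left) (Seq (Seq Right Right) Left))) p)
       (Seq (Seq Right Right) Right)))"

lemma runs_foldl_prog:
  fixes l :: "'b::encodable list"
  assumes "\<And>ys y zs. l = ys @ y # zs \<Longrightarrow>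
    runs_within p (encode (x, foldl f s ys, y)) (encode (foldl f s (ys @ [y]))) \<tau>"
  shows "runs_within (foldl_prog p) (encode (x, s, l)) (encode (x, foldl f s l, [] :: 'b list))
    (length l * (\<tau> + 30) + 10)"
  using assms
proof (induction l arbitrary: s)
  case Nil
  let ?z = "Node (encode x) (Node (encode s) Leaf)"
  have "runs_within (Seq Right Right) ?z Leaf (1 + 1 + 1)"
    using runs_within_Seq[OF runs_within_atomic(4) runs_within_atomic(4)] by (metis right.simps(2))
  then have "runs_within (foldl_prog p) ?z ?z (1 + 1 + 1 + 1)"
    unfolding foldl_prog_def by (rule runs_within_While_False)
  from runs_within_mono[OF this] show ?case by simp
next
  case (Cons y l)
  let ?z = "Node (encode x) (Node (encode s) (Node (encode y) (encode l)))"
  have R: "runs_within Right ?z (Node (encode s) (Node (encode y) (encode l))) 1"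
    using runs_within_atomic(4)[of ?z] by simp
  have L: "runs_within Left ?z (encode x) 1"
    using runs_within_atomic(3)[of ?z] by simp
  have RL: "runs_within (Seq Right Left) ?z (encode s) 3"
    using runs_within_Seq[OF R runs_within_atomic(3)] by (simp add: eval_nat_numeral)
  have RR: "runs_within (Seq Right Right) ?z (Node (encode y) (encode l)) 3"
    using runs_within_Seq[OF R runs_within_atomic(4)] by (simp add: eval_nat_numeral)
  have RRL: "runs_within (Seq (Seq Right Right) Left) ?z (encode y) 5"
    using runs_within_Seq[OF RR runs_within_atomic(3)] by (simp add: eval_nat_numeral)
  have RRR: "runs_within (Seq (Seq Right Right) Right) ?z (encode l) 5"
    using runs_within_Seq[OF RR runs_within_atomic(4)] by (simp add: eval_nat_numeral)
  have step: "runs_within p (encode (x, s, y)) (encode (f s y)) \<tau>"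
    using Cons.prems[of "[]" y l] by simp
  have IH: "runs_within (foldl_prog p) (encode (x, f s y, l)) (encode (x, foldl f (f s y) l, [] :: 'b list))
    (length l * (\<tau> + 30) + 10)"
    by (rule Cons.IH) (use Cons.prems[of "y # _"] in simp)
  note body = runs_within_Pair[OF L runs_within_Pair[OF runs_within_Seq[OF
      runs_within_Pair[OF L runs_within_Pair[OF RL RRL]] step[unfolded encode_simps]] RRR]]
  have "runs_within (foldl_prog p) ?z (encode (x, foldl f (f s y) l, [] :: 'b list))
     (3 + (1 + (1 + (3 + 5 + 1) + 1 + \<tau> + 1 + 5 + 1) + 1) + (length l * (\<tau> + 30) + 10) + 1)"
    unfolding foldl_prog_def
    by (rule runs_within_While_True[OF RR _ body]) (use IH in \<open>simp_all add: foldl_prog_def\<close>)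
  then show ?case by (auto intro: runs_within_mono)
qed

text \<open>Polynomial steps alone do not make a polynomial loop, since each could double the
  accumulator. The invariant \<open>Inv\<close>, indexed by the prefix already consumed, keeps every
  accumulator below a bound \<open>B\<close> in the size of \<open>x\<close>.\<close>

lemma polyt_foldl_inv:
  fixes step :: "'a::encodable \<Rightarrow> 's::encodable \<Rightarrow> 'b::encodable \<Rightarrow> 's"
  assumes step: "polyt (\<lambda>p. step (fst p) (fst (snd p)) (snd (snd p)))"
    and init: "polyt init" and l: "polyt l" and B: "poly_bounded B"
    and Inv0: "\<And>x. Inv x [] (init x)"
    and Inv: "\<And>x ys y zs s. l x = ys @ y # zs \<Longrightarrow> Inv x ys s \<Longrightarrow> Inv x (ys @ [y]) (step x s y)"
    and le: "\<And>x ys zs s. l x = ys @ zs \<Longrightarrow> Inv x ys s \<Longrightarrow> enc_size s \<le> B x"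
  shows "polyt (\<lambda>x. foldl (\<lambda>s y. step x s y) (init x) (l x))"
proof -
  obtain p t where p: "poly_bounded t"
    "\<And>z. runs_within p (encode z) (encode (step (fst z) (fst (snd z)) (snd (snd z)))) (t z)"
    using step unfolding polyt_def by blast
  obtain q s where q: "poly_bounded s" "\<And>x. runs_within q (encode x) (encode (init x)) (s x)"
    using init unfolding polyt_def by blast
  obtain r u where r: "poly_bounded u" "\<And>x. runs_within r (encode x) (encode (l x)) (u x)"
    using l unfolding polyt_def by blast
  obtain a c where ac: "\<And>z. t z \<le> a * enc_size z ^ c" using p unfolding poly_bounded_def by blast
  have inv: "Inv x ys (foldl (step x) (init x) ys)" if "l x = ys @ zs" for x ys zs
    using that by (induction ys arbitrary: zs rule: rev_induct) (auto simp: Inv0 Inv)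
  define T where "T x = a * (enc_size x + B x + enc_size (l x) + 2) ^ c" for x
  have pow: "poly_bounded (\<lambda>x. h x ^ c)" if "poly_bounded h" for h :: "'a \<Rightarrow> nat"
  proof (induction c)
    case 0 show ?case by (simp add: poly_bounded_const del: One_nat_def)
  next
    case (Suc c) then show ?case using poly_bounded_mult[OF that Suc] by simp
  qed
  have T: "poly_bounded T"
    unfolding T_def by (intro poly_bounded_intros pow B polyt_size[OF l])
  have run: "runs_within (foldl_prog p) (encode (x, init x, l x))
      (encode (x, foldl (step x) (init x) (l x), [] :: 'b list)) (length (l x) * (T x + 30) + 10)" for x
  proof (rule runs_foldl_prog)
    fix ys y zs assume eq: "l x = ys @ y # zs"
    let ?z = "(x, foldl (step x) (init x) ys, y)"
    have "enc_size (foldl (step x) (init x) ys) \<le> B x"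
      by (rule le[OF eq inv[OF eq]])
    moreover have "enc_size y \<le> enc_size (l x)" by (rule enc_size_mem) (auto simp: eq)
    ultimately have "enc_size ?z ^ c \<le> (enc_size x + B x + enc_size (l x) + 2) ^ c"
      by (intro power_mono) auto
    then have "t ?z \<le> T x"
      using ac[of ?z] unfolding T_def by (meson le_trans mult_le_mono2)
    then show "runs_within p (encode ?z) (encode (foldl (step x) (init x) (ys @ [y]))) (T x)"
      using p(2)[of ?z] by (auto intro: runs_within_mono)
  qed
  show ?thesis
  proof (rule polytI[where p = "Seq (Pair Id (Pair q r)) (Seq (foldl_prog p) (Seq Right Left))"
        and t = "\<lambda>x. (1 + (s x + u x + 1) + 1) + (enc_size (l x) * (T x + 30) + 10 + 3 + 1) + 1"])
    show "poly_bounded (\<lambda>x. enc_size (foldl (\<lambda>s y. step x s y) (init x) (l x)))"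
      by (rule poly_bounded_mono[OF B]) (rule le[OF append_Nil2[symmetric] inv[OF append_Nil2[symmetric]]])
    show "poly_bounded (\<lambda>x. (1 + (s x + u x + 1) + 1) + (enc_size (l x) * (T x + 30) + 10 + 3 + 1) + 1)"
      by (intro poly_bounded_intros q r T polyt_size[OF l])
    fix x
    have 1: "runs_within (Pair Id (Pair q r)) (encode x) (encode (x, init x, l x)) (1 + (s x + u x + 1) + 1)"
      using runs_within_Pair[OF runs_within_atomic(1) runs_within_Pair[OF q(2)[of x] r(2)[of x]]] by simp
    have 2: "runs_within (Seq Right Left) (encode (x, foldl (step x) (init x) (l x), [] :: 'b list))
        (encode (foldl (step x) (init x) (l x))) 3"
      using runs_within_Seq[OF runs_within_atomic(4)[of "encode (x, foldl (step x) (init x) (l x), [] :: 'b list)"]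
          runs_within_atomic(3)] by (simp add: eval_nat_numeral)
    have 3: "runs_within (foldl_prog p) (encode (x, init x, l x))
      (encode (x, foldl (step x) (init x) (l x), [] :: 'b list)) (enc_size (l x) * (T x + 30) + 10)"
      by (rule runs_within_mono[OF run]) (use length_le_enc_size in simp)
    show "runs_within (Seq (Pair Id (Pair q r)) (Seq (foldl_prog p) (Seq Right Left))) (encode x)
       (encode (foldl (\<lambda>s y. step x s y) (init x) (l x)))
       ((1 + (s x + u x + 1) + 1) + (enc_size (l x) * (T x + 30) + 10 + 3 + 1) + 1)"
      by (rule runs_within_Seq[OF 1 runs_within_Seq[OF 3 2]])
  qed
qed

text \<open>Growth by an amount that ignores the accumulator stays polynomial over the whole list.
  Most folds below are of this kind; the others need an invariant on lengths.\<close>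

lemma polyt_foldl_add:
  fixes step :: "'a::encodable \<Rightarrow> 's::encodable \<Rightarrow> 'b::encodable \<Rightarrow> 's"
  assumes step: "polyt (\<lambda>p. step (fst p) (fst (snd p)) (snd (snd p)))"
    and init: "polyt init" and l: "polyt l" and G: "poly_bounded G"
    and le: "\<And>x s y. y \<in> set (l x) \<Longrightarrow> enc_size (step x s y) \<le> enc_size s + G x"
  shows "polyt (\<lambda>x. foldl (\<lambda>s y. step x s y) (init x) (l x))"
proof (rule polyt_foldl_inv[OF step init l,
      where Inv = "\<lambda>x ys s. enc_size s \<le> enc_size (init x) + length ys * G x"
      and B = "\<lambda>x. enc_size (init x) + enc_size (l x) * G x"])
  show "poly_bounded (\<lambda>x. enc_size (init x) + enc_size (l x) * G x)"
    by (intro poly_bounded_intros polyt_size init l G)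
next
  fix x ys y zs and s :: 's assume "l x = ys @ y # zs" "enc_size s \<le> enc_size (init x) + length ys * G x"
  then show "enc_size (step x s y) \<le> enc_size (init x) + length (ys @ [y]) * G x"
    using le[of y x s] by auto
next
  fix x ys zs and s :: 's assume *: "l x = ys @ zs" "enc_size s \<le> enc_size (init x) + length ys * G x"
  have "length ys \<le> enc_size (l x)" using length_le_enc_size[of "l x"] * by simp
  then show "enc_size s \<le> enc_size (init x) + enc_size (l x) * G x"
    using * by (meson add_left_mono le_trans mult_le_mono1)
qed simp

text \<open>An element is no larger than its list, so the list can stand in for it in the
  bound.\<close>

lemma poly_bounded_mem:
  assumes "polyt (\<lambda>p. h (fst p) (snd p))" "polyt l"
  shows "\<exists>G. poly_bounded G \<and> (\<forall>x. \<forall>y\<in>set (l x). enc_size (h x y) \<le> G x)"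
proof -
  obtain a c where ac: "\<And>z. enc_size (h (fst z) (snd z)) \<le> a * enc_size z ^ c"
    using polyt_size[OF assms(1)] unfolding poly_bounded_def by blast
  let ?G = "\<lambda>x. a * (enc_size x + enc_size (l x) + 1) ^ c"
  have "poly_bounded (\<lambda>z :: 'a \<times> 'b list. a * enc_size z ^ c)"
    unfolding poly_bounded_def by blast
  from poly_bounded_comp[OF this, of "\<lambda>x. (x, l x)"]
  have "poly_bounded ?G"
    by (simp del: One_nat_def add: polyt_size[OF assms(2)] poly_bounded_intros)
  moreover have "enc_size (h x y) \<le> ?G x" if "y \<in> set (l x)" for x y
  proof -
    have "enc_size (x, y) ^ c \<le> (enc_size x + enc_size (l x) + 1) ^ c"
      using enc_size_mem[OF that] by (intro power_mono) auto
    then show ?thesis using ac[of "(x, y)"] by (metis fst_conv snd_conv le_trans mult_le_mono2)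
  qed
  ultimately show ?thesis by blast
qed

section \<open>List operations\<close>

lemma polyt_Cons0: "polyt (\<lambda>p. fst p # snd p)"
proof (rule polytI[where p = Id and t = "\<lambda>_. 1"])
  show "poly_bounded (\<lambda>p. enc_size (fst p # snd p))"
    by (rule poly_bounded_mono[OF poly_bounded_size]) (metis enc_size_simps(1,3) order_refl prod.collapse)
  show "runs_within Id (encode x) (encode (fst x # snd x)) 1" for x :: "'a \<times> 'a list"
    using runs_within_atomic(1)[of "encode x"] by (simp add: encode_pair)
qed (rule poly_bounded_const)

lemma polyt_Cons [polyt_intros]: "polyt f \<Longrightarrow> polyt g \<Longrightarrow> polyt (\<lambda>x. f x # g x)"
  using polyt_comp[OF polyt_Cons0 polyt_Pair, of f g] by simp

lemma polyt_tl [polyt_intros]: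
  assumes "polyt f" shows "polyt (\<lambda>x. tl (f x))"
proof -
  have "polyt (\<lambda>x. case f x of [] \<Rightarrow> [] | y # ys \<Rightarrow> ys)"
    by (intro polyt_intros assms)
  then show ?thesis unfolding tl_def .
qed

lemma polyt_Nil_eq [polyt_intros]:
  assumes "polyt f" shows "polyt (\<lambda>x. f x = [])"
proof -
  have "polyt (\<lambda>x. case f x of [] \<Rightarrow> True | y # ys \<Rightarrow> False)"
    by (intro polyt_intros assms)
  moreover have "(case f x of [] \<Rightarrow> True | y # ys \<Rightarrow> False) = (f x = [])" for x
    by (cases "f x") auto
  ultimately show ?thesis by simp
qed

lemma polyt_Not [polyt_intros]:
  assumes "polyt f" shows "polyt (\<lambda>x. \<not> f x)"
proof -
  have eq: "(\<lambda>x. \<not> f x) = (\<lambda>x. if f x then False else True)" by auto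
  show ?thesis unfolding eq by (intro polyt_intros assms)
qed

lemma polyt_conj [polyt_intros]:
  assumes "polyt f" "polyt g" shows "polyt (\<lambda>x. f x \<and> g x)"
proof -
  have eq: "(\<lambda>x. f x \<and> g x) = (\<lambda>x. if f x then g x else False)" by auto
  show ?thesis unfolding eq by (intro polyt_intros assms)
qed

lemma polyt_disj [polyt_intros]:
  assumes "polyt f" "polyt g" shows "polyt (\<lambda>x. f x \<or> g x)"
  using polyt_Not[OF polyt_conj[OF assms[THEN polyt_Not]]] by simp

lemma polyt_let [polyt_intros]:
  assumes "polyt f" "polyt (\<lambda>p. g (fst p) (snd p))"
  shows "polyt (\<lambda>x. let y = f x in g x y)"
  using polyt_comp[OF assms(2) polyt_Pair[OF polyt_id assms(1)]] by simp

text \<open>At this stage a list can only be extended at its head, so folds deliver results back to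
  front; append, map, filter and zip all rely on reversal.\<close>

lemma polyt_rev [polyt_intros]:
  assumes "polyt l" shows "polyt (\<lambda>x. rev (l x))"
proof -
  have "polyt (\<lambda>x. foldl (\<lambda>s y. y # s) [] (l x))"
    by (rule polyt_foldl_add[where G = "\<lambda>x. enc_size (l x) + 1"])
      (auto intro: enc_size_mem simp del: One_nat_def intro!: polyt_intros assms poly_bounded_intros polyt_size)
  moreover have "foldl (\<lambda>s y. y # s) acc ys = rev ys @ acc" for acc ys :: "'b list"
    by (induction ys arbitrary: acc) auto
  ultimately show ?thesis by simp
qed

lemma polyt_append [polyt_intros]:
  assumes "polyt f" "polyt g" shows "polyt (\<lambda>x. f x @ g x)"
proof -
  have "polyt (\<lambda>x. foldl (\<lambda>s y. y # s) (g x) (rev (f x)))"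
    by (rule polyt_foldl_add[where G = "\<lambda>x. enc_size (f x) + 1"])
      (auto intro: enc_size_mem simp del: One_nat_def intro!: polyt_intros assms poly_bounded_intros polyt_size)
  moreover have "foldl (\<lambda>s y. y # s) acc ys = rev ys @ acc" for acc ys :: "'b list"
    by (induction ys arbitrary: acc) auto
  ultimately show ?thesis by simp
qed

lemma polyt_map [polyt_intros]:
  assumes "polyt (\<lambda>p. h (fst p) (snd p))" "polyt l"
  shows "polyt (\<lambda>x. map (\<lambda>y. h x y) (l x))"
proof -
  obtain G where G: "poly_bounded G" "\<And>x y. y \<in> set (l x) \<Longrightarrow> enc_size (h x y) \<le> G x"
    using poly_bounded_mem[OF assms] by blast
  have "polyt (\<lambda>x. foldl (\<lambda>s y. h x y # s) [] (l x))"
  proof (rule polyt_foldl_add[where G = "\<lambda>x. G x + 1"])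
    have "polyt (\<lambda>p. h (fst p) (snd (snd p)))"
      using polyt_comp[OF assms(1), of "\<lambda>p. (fst p, snd (snd p))"] by (simp add: polyt_intros)
    then show "polyt (\<lambda>p. h (fst p) (snd (snd p)) # fst (snd p))" by (intro polyt_intros)
  qed (auto simp del: One_nat_def intro!: G polyt_intros assms poly_bounded_intros)
  then have "polyt (\<lambda>x. rev (foldl (\<lambda>s y. h x y # s) [] (l x)))" by (intro polyt_intros)
  moreover have "foldl (\<lambda>s y. h x y # s) acc ys = rev (map (h x) ys) @ acc" for x acc ys
    by (induction ys arbitrary: acc) auto
  ultimately show ?thesis by simp
qed

lemma polyt_filter [polyt_intros]:
  assumes "polyt (\<lambda>p. h (fst p) (snd p))" "polyt l"
  shows "polyt (\<lambda>x. filter (\<lambda>y. h x y) (l x))"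
proof -
  have "polyt (\<lambda>x. foldl (\<lambda>s y. if h x y then y # s else s) [] (l x))"
  proof (rule polyt_foldl_add[where G = "\<lambda>x. enc_size (l x) + 1"])
    have "polyt (\<lambda>p. h (fst p) (snd (snd p)))"
      using polyt_comp[OF assms(1), of "\<lambda>p. (fst p, snd (snd p))"] by (simp add: polyt_intros)
    then show "polyt (\<lambda>p. if h (fst p) (snd (snd p)) then snd (snd p) # fst (snd p) else fst (snd p))"
      by (intro polyt_intros)
  qed (auto simp del: One_nat_def intro!: polyt_intros assms poly_bounded_intros polyt_size enc_size_mem)
  then have "polyt (\<lambda>x. rev (foldl (\<lambda>s y. if h x y then y # s else s) [] (l x)))" by (intro polyt_intros)
  moreover have "foldl (\<lambda>s y. if h x y then y # s else s) acc ys = rev (filter (h x) ys) @ acc" for x acc ys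
    by (induction ys arbitrary: acc) auto
  ultimately show ?thesis by simp
qed

lemma polyt_list_ex [polyt_intros]:
  assumes "polyt (\<lambda>p. h (fst p) (snd p))" "polyt l"
  shows "polyt (\<lambda>x. list_ex (\<lambda>y. h x y) (l x))"
proof -
  have "polyt (\<lambda>x. \<not> filter (\<lambda>y. h x y) (l x) = [])" by (intro polyt_intros assms)
  moreover have "(\<not> filter P ys = []) = list_ex P ys" for P and ys :: "'b list"
    by (induction ys) auto
  ultimately show ?thesis by simp
qed

lemma polyt_zip [polyt_intros]:
  assumes f: "polyt f" and g: "polyt g"
  shows "polyt (\<lambda>x. zip (f x) (g x))"
proof -
  let ?step = "\<lambda>s y. case snd s of [] \<Rightarrow> s | z # zs \<Rightarrow> ((y, z) # fst s, zs)"
  have "polyt (\<lambda>x. foldl (\<lambda>s y. ?step s y) ([], g x) (f x))"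
  proof (rule polyt_foldl_add[where G = "\<lambda>x. enc_size (f x) + 1"])
    fix x s y assume "y \<in> set (f x)"
    then have "enc_size y \<le> enc_size (f x)" by (rule enc_size_mem)
    then show "enc_size (?step s y) \<le> enc_size s + (enc_size (f x) + 1)"
      by (cases s) (auto split: list.split)
  qed (intro polyt_intros poly_bounded_intros polyt_size f g)+
  then have "polyt (\<lambda>x. rev (fst (foldl (\<lambda>s y. ?step s y) ([], g x) (f x))))"
    by (intro polyt_intros)
  moreover have *: "fst (foldl (\<lambda>s y. ?step s y) (acc, zs) ys) = rev (zip ys zs) @ acc" for acc zs ys
    by (induction ys arbitrary: acc zs) (auto simp: zip_Cons1 split: list.split)
  have "(\<lambda>x. rev (fst (foldl (\<lambda>s y. ?step s y) ([], g x) (f x)))) = (\<lambda>x. zip (f x) (g x))"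
    unfolding * by simp
  ultimately show ?thesis by metis
qed

lemma polyt_concat [polyt_intros]:
  assumes "polyt l"
  shows "polyt (\<lambda>x. concat (l x))"
proof -
  have foldl: "foldl (@) acc ys = acc @ concat ys" for acc and ys :: "'b list list"
    by (induction ys arbitrary: acc) auto
  have "polyt (\<lambda>x. foldl (\<lambda>s y. s @ y) [] (l x))"
  proof (rule polyt_foldl_add[where G = "\<lambda>x. enc_size (l x)"])
    fix x s y assume "y \<in> set (l x)"
    then have "enc_size y \<le> enc_size (l x)" by (rule enc_size_mem)
    then show "enc_size (s @ y) \<le> enc_size s + enc_size (l x)"
      using enc_size_append[of s y] by linarith
  qed (intro polyt_intros poly_bounded_intros polyt_size assms)+
  then show ?thesis by (simp add: foldl)
qed

text \<open>Lengths are unary numbers: one element of the first list is removed for each element of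
  the second, and the rest is tested for emptiness.\<close>

lemma polyt_length_le [polyt_intros]:
  assumes "polyt f" "polyt g"
  shows "polyt (\<lambda>x. length (f x) \<le> length (g x))"
proof -
  have "polyt (\<lambda>x. foldl (\<lambda>s y. tl s) (f x) (g x) = [])"
  proof (intro polyt_Nil_eq polyt_foldl_add[where G = "\<lambda>x. 0"] poly_bounded_const assms)
    show "enc_size (tl s) \<le> enc_size s + 0" for s :: "'b list" by (cases s) auto
  qed (intro polyt_intros)
  moreover have "(foldl (\<lambda>s y. tl s) us vs = []) \<longleftrightarrow> length us \<le> length vs" for us :: "'b list" and vs :: "'c list"
  proof (induction vs arbitrary: us)
    case (Cons v vs) then show ?case by (cases us) auto
  qed simp
  ultimately show ?thesis by simp
qed

section \<open>The reduction and lifting functions\<close>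

text \<open>Vertex sets are characteristic vectors, graphs are lists of rows, and a partition into blobs is a
  list of vectors.  Natural numbers such as the threshold \<open>D\<close> are given in unary, as lists.\<close>

definition meets :: "bool list \<Rightarrow> bool list \<Rightarrow> bool" where
  "meets u v = list_ex (\<lambda>p. fst p \<and> snd p) (zip u v)"

definition sub_vec :: "bool list \<Rightarrow> bool list \<Rightarrow> bool" where
  "sub_vec u v = (\<not> list_ex (\<lambda>p. fst p \<and> \<not> snd p) (zip u v))"

definition vor :: "bool list \<Rightarrow> bool list \<Rightarrow> bool list" where
  "vor u v = map (\<lambda>p. fst p \<or> snd p) (zip u v)"

definition union_vec :: "bool list \<Rightarrow> bool list list \<Rightarrow> bool list" where
  "union_vec r vs = foldl (\<lambda>u v. vor u v) (map (\<lambda>_. False) r) vs"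

definition ones :: "bool list \<Rightarrow> bool list" where
  "ones v = filter (\<lambda>b. b) v"

definition compress :: "bool list \<Rightarrow> 'a list \<Rightarrow> 'a list" where
  "compress m xs = map snd (filter fst (zip m xs))"

text \<open>Spreads \<open>ys\<close> over the true positions of a mask, as a section of
  \<open>compress\<close>. Missing entries count as false and surplus ones are ignored; the former
  is used for capping in \<open>marks\<close>.\<close>

fun expand :: "bool list \<Rightarrow> bool list \<Rightarrow> bool list" where
  "expand [] ys = []"
| "expand (b # bs) ys =
    (if b then (case ys of [] \<Rightarrow> False | y # _ \<Rightarrow> y) # expand bs (tl ys) else False # expand bs ys)"

definition submat :: "bool list \<Rightarrow> bool list list \<Rightarrow> bool list list" where
  "submat m A = compress m (map (compress m) A)"

text \<open>The list fixes only the dimension, one new row and column per element. The rows are the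
  singletons; compressed by a mask they form the finest partition of its set.\<close>

definition idmat :: "bool list \<Rightarrow> bool list list" where
  "idmat xs = foldl (\<lambda>M _. (True # map (\<lambda>_. False) M) # map (\<lambda>r. False # r) M) [] xs"

definition merge :: "bool list \<Rightarrow> bool list list \<Rightarrow> bool list list" where
  "merge r bl = union_vec r (filter (meets r) bl) # filter (\<lambda>b. \<not> meets r b) bl"

text \<open>An entry pairs a flag, whether the vertex may be selected, with its neighbourhood. The
  step has three uses: threshold 1 computes components, threshold 2 picks connectors, and threshold
  \<open>D\<close> forms the blobs of the kernel.\<close>

definition pass_step ::
    "bool list \<Rightarrow> bool list list \<times> bool list \<Rightarrow> bool \<times> bool list \<Rightarrow> bool list list \<times> bool list" where
  "pass_step D s p =
    (if fst p \<and> length D \<le> length (filter (meets (snd p)) (fst s))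
     then (merge (snd p) (fst s), snd s @ [True]) else (fst s, snd s @ [False]))"

definition pass ::
    "bool list \<Rightarrow> bool list list \<Rightarrow> (bool \<times> bool list) list \<Rightarrow> bool list list \<times> bool list" where
  "pass D bl L = foldl (\<lambda>s p. pass_step D s p) (bl, []) L"

text \<open>Domination instead of equality of the sets of seen blobs is enough, since a representative that
  sees more blobs connects at least as much.\<close>

definition reps_step ::
    "bool list list \<Rightarrow> bool list list \<times> bool list \<Rightarrow> bool \<times> bool list \<Rightarrow> bool list list \<times> bool list" where
  "reps_step bl s p =
    (let c = map (meets (snd p)) bl in
     if fst p \<and> \<not> list_ex (sub_vec c) (fst s)
     then (c # fst s, snd s @ [True]) else (fst s, snd s @ [False]))"

definition reps :: "bool list list \<Rightarrow> (bool \<times> bool list) list \<Rightarrow> bool list list \<times> bool list" where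
  "reps bl L = foldl (\<lambda>s p. reps_step bl s p) ([], []) L"

text \<open>Each vertex of \<open>X\<close> unites all blobs that meet its closed neighbourhood, as
  in union-find. The identity matrix is added because a vertex must be merged with its neighbours,
  not only these with each other.\<close>

definition comps :: "bool list list \<Rightarrow> bool list \<Rightarrow> bool list list" where
  "comps A X = fst (pass [True] (compress X (idmat X))
     (zip X (map (\<lambda>p. vor (fst p) (snd p)) (zip A (idmat X)))))"

text \<open>One pass is enough: a vertex that is passed over sees at most one blob, and later
  merging cannot increase that number.\<close>

definition connect :: "bool list list \<Rightarrow> bool list \<Rightarrow> bool list" where
  "connect A X = vor X (snd (pass [True, True] (comps A X) (zip (map Not X) A)))"

text \<open>An isolated vertex covers no edge and could never be joined to the rest of a
  cover.\<close>

definition nonisolated :: "bool list list \<Rightarrow> bool list \<Rightarrow> bool list" where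
  "nonisolated A X = map (\<lambda>p. fst p \<and> list_ex (\<lambda>b. b) (snd p)) (zip X A)"

text \<open>The contracted modulator becomes vertex 0 of the new graph.\<close>

definition contract :: "bool list list \<Rightarrow> bool list \<Rightarrow> bool list list" where
  "contract A S = (let m = map Not S; z = compress m (map (\<lambda>r. meets r S) A) in
     (False # z) # map (\<lambda>p. fst p # snd p) (zip z (submat m A)))"

definition query :: "bool list list \<Rightarrow> bool list \<Rightarrow> bool list list" where
  "query A S = (if length (ones S) \<le> length [True] then A else contract A S)"

text \<open>\<open>tl Y\<close> drops the bit of the contracted vertex; all of \<open>S\<close>
  enters the cover, whether that bit was set or not.\<close>

definition approx_cover :: "bool list list \<Rightarrow> bool list \<Rightarrow> bool list \<Rightarrow> bool list" where
  "approx_cover A S Y = (if length (ones S) \<le> length [True] then Y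
     else connect A (nonisolated A (vor S (expand (map Not S) (tl Y)))))"

text \<open>\<open>True # ones X\<close> is an all-true list of length |X| + 1, so expanding it
  along a row keeps the first |X| + 1 neighbours and clears the others.\<close>

definition marks :: "bool list list \<Rightarrow> bool list \<Rightarrow> bool list" where
  "marks A X = vor X (union_vec X (map (\<lambda>r. expand r (True # ones X)) (compress X A)))"

text \<open>The vertices of \<open>X\<close> that lose a neighbour when only \<open>F\<close> is
  kept. For the marked set they have more than |X| kept neighbours and thus belong to every solution
  no larger than \<open>X\<close>; they are the terminals whose connection must be
  preserved.\<close>

definition boundary :: "bool list list \<Rightarrow> bool list \<Rightarrow> bool list \<Rightarrow> bool list" where
  "boundary A X F = map (\<lambda>p. fst p \<and> \<not> sub_vec (snd p) F) (zip X A)"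

definition blobs :: "bool list \<Rightarrow> bool list list \<Rightarrow> bool list \<Rightarrow> bool list \<Rightarrow> bool list list \<times> bool list"
  where
  "blobs D A X F = pass D (compress (boundary A X F) (idmat X)) (zip (map Not F) A)"

definition kernel_mask :: "bool list \<Rightarrow> bool list list \<Rightarrow> bool list \<Rightarrow> bool list" where
  "kernel_mask D A X = (let F = marks A X; P = blobs D A X F in
     vor F (vor (snd P) (snd (reps (fst P) (zip (map Not F) A)))))"

text \<open>The truncated \<open>k - 1\<close> makes the test succeed for \<open>k \<le> 1\<close>.\<close>

definition is_large :: "bool list \<Rightarrow> bool list \<Rightarrow> bool list \<Rightarrow> bool" where
  "is_large D S X \<longleftrightarrow> length (concat (map (\<lambda>_. D) (tl (ones S)))) \<le> length (ones X)"

text \<open>The modulator of the kernel is its whole vertex set: removing it leaves the empty graph, which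
  belongs to every nonempty hereditary class.\<close>

definition reduce ::
    "bool list \<Rightarrow> bool list list \<Rightarrow> bool list \<Rightarrow> bool list \<Rightarrow> bool list list \<times> bool list" where
  "reduce D A S Y = (let X = approx_cover A S Y in
     if is_large D S X then ([], [])
     else let B = submat (kernel_mask D A X) A in (B, map (\<lambda>_. True) B))"

definition lift_sol ::
    "bool list \<Rightarrow> bool list list \<Rightarrow> bool list \<Rightarrow> bool list \<Rightarrow> bool list \<Rightarrow> bool list" where
  "lift_sol D A S Y s = (let X = approx_cover A S Y in
     if is_large D S X \<or> \<not> length (ones s) \<le> length (ones X) then X
     else expand (kernel_mask D A X) s)"

section \<open>Polynomial time of the reduction and lifting functions\<close>

lemma polyt_comp2:
  "polyt (\<lambda>p. F (fst p) (snd p)) \<Longrightarrow> polyt f \<Longrightarrow> polyt g \<Longrightarrow> polyt (\<lambda>x. F (f x) (g x))"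
  using polyt_comp[OF _ polyt_Pair, of "\<lambda>p. F (fst p) (snd p)" f g] by simp

lemma polyt_comp3:
  "polyt (\<lambda>p. F (fst p) (fst (snd p)) (snd (snd p))) \<Longrightarrow> polyt f \<Longrightarrow> polyt g \<Longrightarrow> polyt h \<Longrightarrow>
    polyt (\<lambda>x. F (f x) (g x) (h x))"
  using polyt_comp[OF _ polyt_Pair[OF _ polyt_Pair], of "\<lambda>p. F (fst p) (fst (snd p)) (snd (snd p))" f g h]
  by simp

lemma polyt_meets [polyt_intros]: "polyt f \<Longrightarrow> polyt g \<Longrightarrow> polyt (\<lambda>x. meets (f x) (g x))"
  by (rule polyt_comp2[of meets], unfold meets_def, intro polyt_intros)

lemma polyt_sub_vec [polyt_intros]: "polyt f \<Longrightarrow> polyt g \<Longrightarrow> polyt (\<lambda>x. sub_vec (f x) (g x))"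
  by (rule polyt_comp2[of sub_vec], unfold sub_vec_def, intro polyt_intros)

lemma polyt_vor [polyt_intros]: "polyt f \<Longrightarrow> polyt g \<Longrightarrow> polyt (\<lambda>x. vor (f x) (g x))"
  by (rule polyt_comp2[of vor], unfold vor_def, intro polyt_intros)

lemma polyt_ones [polyt_intros]: "polyt f \<Longrightarrow> polyt (\<lambda>x. ones (f x))"
  unfolding ones_def by (intro polyt_intros)

lemma polyt_compress [polyt_intros]: "polyt f \<Longrightarrow> polyt g \<Longrightarrow> polyt (\<lambda>x. compress (f x) (g x))"
  by (rule polyt_comp2[of compress], unfold compress_def, intro polyt_intros)

lemma polyt_submat [polyt_intros]: "polyt f \<Longrightarrow> polyt g \<Longrightarrow> polyt (\<lambda>x. submat (f x) (g x))"
  by (rule polyt_comp2[of submat], unfold submat_def, intro polyt_intros)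

lemma length_union_vec: "length (union_vec r vs) \<le> length r"
proof -
  have "length (foldl (\<lambda>u v. vor u v) u vs) \<le> length u" for u
  proof (induction vs arbitrary: u)
    case (Cons v vs)
    show ?case using Cons.IH[of "vor u v"] by (simp add: vor_def)
  qed simp
  from this[of "map (\<lambda>_. False) r"] show ?thesis by (simp add: union_vec_def)
qed

text \<open>\<open>vor\<close> has the shorter of the two lengths, so no accumulator outgrows the
  first one.\<close>

lemma polyt_union_vec [polyt_intros]:
  assumes "polyt f" "polyt g"
  shows "polyt (\<lambda>x. union_vec (f x) (g x))"
  unfolding union_vec_def
proof (rule polyt_foldl_inv[where Inv = "\<lambda>x ys u. length u \<le> length (f x)"
      and B = "\<lambda>x. 1 + 4 * enc_size (f x)"])
  fix x and u :: "bool list" assume "length u \<le> length (f x)"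
  then show "enc_size u \<le> 1 + 4 * enc_size (f x)"
    using enc_size_bool_list[of u] length_le_enc_size[of "f x"] by linarith
qed (intro polyt_intros assms poly_bounded_intros polyt_size | simp add: vor_def)+

lemma polyt_expand [polyt_intros]:
  assumes "polyt f" "polyt g"
  shows "polyt (\<lambda>x. expand (f x) (g x))"
proof -
  let ?step = "\<lambda>s b. if b then case snd s of [] \<Rightarrow> (fst s @ [False], []) | y # ys \<Rightarrow> (fst s @ [y], ys)
    else (fst s @ [False], snd s)"
  have "fst (foldl ?step (acc, ys) bs) = acc @ expand bs ys" for acc ys bs
    by (induction bs arbitrary: acc ys) (auto split: list.split)
  then have eq: "(\<lambda>x. expand (f x) (g x)) = (\<lambda>x. fst (foldl (\<lambda>s b. ?step s b) ([], g x) (f x)))"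
    by simp
  have "polyt (\<lambda>x. foldl (\<lambda>s b. ?step s b) ([], g x) (f x))"
  proof (rule polyt_foldl_add[where G = "\<lambda>x. 4"])
    fix s :: "bool list \<times> bool list" and b
    obtain u v where s: "s = (u, v)" by fastforce
    have "enc_size (u @ [c]) \<le> enc_size u + 4" for c
      using enc_size_append[of u "[c]"] enc_size_bool[of c] by simp
    note * = this[of False] this[of "hd v"]
    show "enc_size (?step s b) \<le> enc_size s + 4"
      using * unfolding s by (cases v) auto
  qed (intro polyt_intros assms poly_bounded_intros)+
  then show ?thesis unfolding eq by (intro polyt_intros)
qed

text \<open>Every row grows in each step, so the growth depends on the accumulator; the invariant
  bounds the matrix by its final dimension instead.\<close>

lemma polyt_idmat [polyt_intros]:
  fixes f :: "'a::encodable \<Rightarrow> bool list"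
  assumes "polyt f"
  shows "polyt (\<lambda>x. idmat (f x))"
  unfolding idmat_def
proof (rule polyt_foldl_inv[where Inv = "\<lambda>x ys M. length M = length ys \<and> (\<forall>r\<in>set M. length r = length ys)"
      and B = "\<lambda>x. 1 + enc_size (f x) * (1 + 4 * enc_size (f x) + 1)"])
  fix x ys zs and M :: "bool list list"
  assume *: "f x = ys @ zs" "length M = length ys \<and> (\<forall>r\<in>set M. length r = length ys)"
  have le: "length ys \<le> enc_size (f x)" using length_le_enc_size[of "f x"] * by simp
  have "enc_size M \<le> 1 + length M * (1 + 4 * enc_size (f x) + 1)"
  proof (rule enc_size_list_le)
    fix r assume "r \<in> set M"
    then show "enc_size r \<le> 1 + 4 * enc_size (f x)"
      using enc_size_bool_list[of r] * le by force
  qed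
  also have "\<dots> \<le> 1 + enc_size (f x) * (1 + 4 * enc_size (f x) + 1)"
    using le * by (intro add_left_mono mult_le_mono1) auto
  finally show "enc_size M \<le> \<dots>" .
qed (intro polyt_intros assms poly_bounded_intros polyt_size | auto)+

lemma polyt_merge [polyt_intros]: "polyt f \<Longrightarrow> polyt g \<Longrightarrow> polyt (\<lambda>x. merge (f x) (g x))"
  by (rule polyt_comp2[of merge], unfold merge_def, intro polyt_intros)

lemma enc_size_merge: "enc_size (merge r bl) \<le> enc_size bl + (2 + 4 * length r)"
proof -
  have "enc_size (union_vec r (filter (meets r) bl)) \<le> 1 + 4 * length r"
    using enc_size_bool_list[of "union_vec r (filter (meets r) bl)"]
      length_union_vec[of r "filter (meets r) bl"] by linarith
  then show ?thesis
    using enc_size_filter[of "\<lambda>b. \<not> meets r b" bl] by (simp add: merge_def)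
qed

lemma enc_size_snoc: "enc_size (v @ [b :: bool]) \<le> enc_size v + 4"
  using enc_size_append[of v "[b]"] enc_size_bool[of b] by simp

lemma length_snd_le_enc_size:
  assumes "p \<in> set L" shows "length (snd p :: 'b::encodable list) \<le> enc_size L"
  using enc_size_mem[OF assms] enc_size_snd[of p] length_le_enc_size[of "snd p"] by linarith

lemma polyt_pass [polyt_intros]:
  assumes "polyt f" "polyt g" "polyt h"
  shows "polyt (\<lambda>x. pass (f x) (g x) (h x))"
proof (rule polyt_comp3[of pass, OF _ assms], unfold pass_def pass_step_def,
    rule polyt_foldl_add[where G = "\<lambda>x. 4 * enc_size (snd (snd x)) + 6"])
  fix x :: "bool list \<times> bool list list \<times> (bool \<times> bool list) list"
    and s :: "bool list list \<times> bool list" and p assume p: "p \<in> set (snd (snd x))"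
  obtain bl v where s: "s = (bl, v)" by fastforce
  show "enc_size (if fst p \<and> length (fst x) \<le> length (filter (meets (snd p)) (fst s))
     then (merge (snd p) (fst s), snd s @ [True]) else (fst s, snd s @ [False]))
     \<le> enc_size s + (4 * enc_size (snd (snd x)) + 6)"
    using length_snd_le_enc_size[OF p] enc_size_merge[of "snd p" bl] enc_size_snoc[of v True]
      enc_size_snoc[of v False] unfolding s by simp
qed (intro polyt_intros assms poly_bounded_intros polyt_size)+

lemma polyt_reps [polyt_intros]:
  assumes "polyt f" "polyt g"
  shows "polyt (\<lambda>x. reps (f x) (g x))"
proof (rule polyt_comp2[of reps, OF _ assms], unfold reps_def reps_step_def,
    rule polyt_foldl_add[where G = "\<lambda>x. 4 * enc_size (fst x) + 6"])
  fix x :: "bool list list \<times> (bool \<times> bool list) list" and s :: "bool list list \<times> bool list" and p :: "bool \<times> bool list"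
  obtain bl v where s: "s = (bl, v)" by fastforce
  have "enc_size (map (meets (snd p)) (fst x)) \<le> 1 + 4 * enc_size (fst x)"
    using enc_size_bool_list[of "map (meets (snd p)) (fst x)"] length_le_enc_size[of "fst x"] by simp
  then show "enc_size (let c = map (meets (snd p)) (fst x) in
     if fst p \<and> \<not> list_ex (sub_vec c) (fst s)
     then (c # fst s, snd s @ [True]) else (fst s, snd s @ [False])) \<le> enc_size s + (4 * enc_size (fst x) + 6)"
    using enc_size_snoc[of v True] enc_size_snoc[of v False] unfolding s by (simp add: Let_def)
qed (intro polyt_intros assms poly_bounded_intros polyt_size)+

lemma polyt_connect [polyt_intros]: "polyt f \<Longrightarrow> polyt g \<Longrightarrow> polyt (\<lambda>x. connect (f x) (g x))"
  by (rule polyt_comp2[of connect], unfold connect_def comps_def, intro polyt_intros)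

lemma polyt_query [polyt_intros]: "polyt f \<Longrightarrow> polyt g \<Longrightarrow> polyt (\<lambda>x. query (f x) (g x))"
  by (rule polyt_comp2[of query], unfold query_def contract_def, intro polyt_intros)

lemma polyt_approx_cover [polyt_intros]:
  "polyt f \<Longrightarrow> polyt g \<Longrightarrow> polyt h \<Longrightarrow> polyt (\<lambda>x. approx_cover (f x) (g x) (h x))"
  by (rule polyt_comp3[of approx_cover], unfold approx_cover_def nonisolated_def, intro polyt_intros)

lemma polyt_kernel_mask [polyt_intros]:
  "polyt f \<Longrightarrow> polyt g \<Longrightarrow> polyt h \<Longrightarrow> polyt (\<lambda>x. kernel_mask (f x) (g x) (h x))"
  by (rule polyt_comp3[of kernel_mask], unfold kernel_mask_def marks_def boundary_def blobs_def, intro polyt_intros)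

lemma polyt_is_large [polyt_intros]:
  "polyt f \<Longrightarrow> polyt g \<Longrightarrow> polyt h \<Longrightarrow> polyt (\<lambda>x. is_large (f x) (g x) (h x))"
  by (rule polyt_comp3[of is_large], unfold is_large_def, intro polyt_intros)

lemma polyt_reduce:
  "polyt (\<lambda>x. reduce (fst x) (fst (fst (snd x))) (snd (fst (snd x))) (snd (snd x)))"
  unfolding reduce_def by (intro polyt_intros)

lemma polyt_lift_sol:
  "polyt (\<lambda>x. lift_sol (fst x) (fst (fst (fst (snd x)))) (snd (fst (fst (snd x))))
     (snd (snd x)) (snd (fst (snd x))))"
  unfolding lift_sol_def by (intro polyt_intros)

section \<open>Connected vertex covers of relations\<close>

definition reach :: "('a \<Rightarrow> 'a \<Rightarrow> bool) \<Rightarrow> 'a set \<Rightarrow> ('a \<times> 'a) set" where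
  "reach E U = {(x, y). x \<in> U \<and> y \<in> U \<and> E x y}\<^sup>*"

definition cvc :: "'a set \<Rightarrow> ('a \<Rightarrow> 'a \<Rightarrow> bool) \<Rightarrow> 'a set \<Rightarrow> bool" where
  "cvc V E T \<longleftrightarrow> T \<subseteq> V \<and> (\<forall>u\<in>V. \<forall>v\<in>V. E u v \<longrightarrow> u \<in> T \<or> v \<in> T) \<and>
     (\<forall>u\<in>T. \<forall>v\<in>T. (u, v) \<in> reach E T)"

lemma cvcI:
  assumes "T \<subseteq> V" "\<And>u v. u \<in> V \<Longrightarrow> v \<in> V \<Longrightarrow> E u v \<Longrightarrow> u \<in> T \<or> v \<in> T"
    "\<And>u v. u \<in> T \<Longrightarrow> v \<in> T \<Longrightarrow> (u, v) \<in> reach E T"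
  shows "cvc V E T"
  using assms unfolding cvc_def by blast

lemma reach_refl [simp]: "(x, x) \<in> reach E U"
  by (simp add: reach_def)

lemma reach_edge: "x \<in> U \<Longrightarrow> y \<in> U \<Longrightarrow> E x y \<Longrightarrow> (x, y) \<in> reach E U"
  unfolding reach_def by (rule r_into_rtrancl) simp

lemma reach_trans: "(x, y) \<in> reach E U \<Longrightarrow> (y, z) \<in> reach E U \<Longrightarrow> (x, z) \<in> reach E U"
  unfolding reach_def by (rule rtrancl_trans)

lemma reach_mono: "U \<subseteq> U' \<Longrightarrow> (x, y) \<in> reach E U \<Longrightarrow> (x, y) \<in> reach E U'"
  unfolding reach_def by (rule subsetD[OF rtrancl_mono]) auto

lemma reach_sym: "symp E \<Longrightarrow> (x, y) \<in> reach E U \<Longrightarrow> (y, x) \<in> reach E U"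
  unfolding reach_def by (rule symD[OF sym_rtrancl]) (auto simp: sym_def symp_def)

text \<open>Edges need only go to paths, so \<open>f\<close> may collapse or stretch them. This
  covers renaming, contraction, and the replacement of dropped vertices by representatives.\<close>

lemma reach_map:
  assumes "(x, y) \<in> reach E U"
    and "\<And>u v. u \<in> U \<Longrightarrow> v \<in> U \<Longrightarrow> E u v \<Longrightarrow> (f u, f v) \<in> reach E' U'"
  shows "(f x, f y) \<in> reach E' U'"
  using assms(1) unfolding reach_def
proof (induction rule: rtrancl_induct)
  case (step y z)
  then have "(f y, f z) \<in> reach E' U'" using assms(2) by blast
  then show ?case using step by (auto simp: reach_def)
qed simp

lemma cvc_image:
  assumes "inj_on f V" "\<And>u v. u \<in> V \<Longrightarrow> v \<in> V \<Longrightarrow> E' (f u) (f v) \<longleftrightarrow> E u v" "T \<subseteq> V"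
  shows "cvc (f ` V) E' (f ` T) \<longleftrightarrow> cvc V E T"
proof -
  have mem: "f u \<in> f ` T \<longleftrightarrow> u \<in> T" if "u \<in> V" for u
    using assms(1,3) that by (auto simp: inj_on_def)
  let ?g = "inv_into V f"
  have g: "?g (f u) = u" if "u \<in> V" for u using assms(1) that by simp
  have reach: "(f u, f v) \<in> reach E' (f ` T) \<longleftrightarrow> (u, v) \<in> reach E T" if "u \<in> T" "v \<in> T" for u v
  proof
    assume "(f u, f v) \<in> reach E' (f ` T)"
    then have "(?g (f u), ?g (f v)) \<in> reach E T"
    proof (rule reach_map)
      fix a b assume "a \<in> f ` T" "b \<in> f ` T" "E' a b"
      then obtain a' b' where "a = f a'" "b = f b'" "a' \<in> T" "b' \<in> T" by blast
      then show "(?g a, ?g b) \<in> reach E T"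
        using \<open>E' a b\<close> assms g by (metis reach_edge subsetD)
    qed
    then show "(u, v) \<in> reach E T" using that assms(3) g by (metis subsetD)
  next
    assume "(u, v) \<in> reach E T"
    then show "(f u, f v) \<in> reach E' (f ` T)"
      by (rule reach_map) (use assms in \<open>auto intro!: reach_edge\<close>)
  qed
  have "f ` T \<subseteq> f ` V" using assms(3) by blast
  moreover have "(\<forall>u\<in>f ` V. \<forall>v\<in>f ` V. E' u v \<longrightarrow> u \<in> f ` T \<or> v \<in> f ` T) \<longleftrightarrow>
      (\<forall>u\<in>V. \<forall>v\<in>V. E u v \<longrightarrow> u \<in> T \<or> v \<in> T)"
    using mem assms(2) by simp
  moreover have "(\<forall>u\<in>f ` T. \<forall>v\<in>f ` T. (u, v) \<in> reach E' (f ` T)) \<longleftrightarrow>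
      (\<forall>u\<in>T. \<forall>v\<in>T. (u, v) \<in> reach E T)"
    using reach by simp
  ultimately show ?thesis using assms(3) unfolding cvc_def by simp
qed

text \<open>A vertex outside \<open>T\<close> has all its kept neighbours in \<open>T\<close>, so a
  vertex of \<open>X\<close> with more than \<open>N\<close> of them lies in \<open>T\<close>. Hence
  an edge with a dropped end is covered by its end in \<open>X\<close>. Connectivity is a property
  of \<open>T\<close> alone.\<close>

lemma cvc_of_induced:
  assumes "finite V" "symp E" and XW: "X \<subseteq> W" "W \<subseteq> V"
    and X: "\<And>u v. u \<in> V \<Longrightarrow> v \<in> V \<Longrightarrow> E u v \<Longrightarrow> u \<in> X \<or> v \<in> X"
    and deg: "\<And>x. x \<in> X \<Longrightarrow> {v \<in> V. E x v} \<subseteq> W \<or> N < card {v \<in> W. E x v}"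
    and T: "cvc W E T" "card T \<le> N"
  shows "cvc V E T"
proof -
  have key: "x \<in> T" if "x \<in> X" "v \<in> V" "v \<notin> W" "E x v" for x v
  proof (rule ccontr)
    assume "x \<notin> T"
    then have "{v \<in> W. E x v} \<subseteq> T" using T(1) that(1) XW unfolding cvc_def by blast
    moreover have "finite T" using T(1) XW \<open>finite V\<close> unfolding cvc_def by (meson finite_subset)
    ultimately have "card {v \<in> W. E x v} \<le> N" using T(2) by (meson card_mono le_trans)
    then show False using deg[OF that(1)] that by auto
  qed
  show ?thesis
  proof (rule cvcI)
    show "T \<subseteq> V" using T XW unfolding cvc_def by blast
  next
    fix u v assume uv: "u \<in> V" "v \<in> V" "E u v"
    then have vu: "E v u" using \<open>symp E\<close> by (auto simp: symp_def)
    show "u \<in> T \<or> v \<in> T"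
    proof (cases "u \<in> W \<and> v \<in> W")
      case True then show ?thesis using T uv unfolding cvc_def by blast
    next
      case False
      then show ?thesis using X[OF uv] key[of u v] key[of v u] uv vu XW by blast
    qed
  next
    show "(u, v) \<in> reach E T" if "u \<in> T" "v \<in> T" for u v using T that unfolding cvc_def by blast
  qed
qed

lemma high_degree_subset_cvc:
  assumes "finite V" and deg: "\<And>x. x \<in> B \<Longrightarrow> N < card {v \<in> V. E x v}" and B: "B \<subseteq> V"
    and T: "cvc V E T" "card T \<le> N"
  shows "B \<subseteq> T"
proof
  fix x assume x: "x \<in> B"
  show "x \<in> T"
  proof (rule ccontr)
    assume "x \<notin> T"
    then have "{v \<in> V. E x v} \<subseteq> T" using T(1) x B unfolding cvc_def by blast
    moreover have "finite T" using T(1) \<open>finite V\<close> unfolding cvc_def by (meson finite_subset)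
    ultimately show False using T(2) deg[OF x] by (meson card_mono le_trans not_le)
  qed
qed

text \<open>Here \<open>F\<close> is the marked set, \<open>B\<close> the boundary, \<B> the blobs,
  and \<open>M\<close> the vertices that hold the blobs together. Each dropped vertex of
  \<open>T\<close> is replaced by its representative and \<open>M\<close> is added. An edge from
  \<open>u\<close> in \<open>B\<close> to a dropped vertex becomes a path: the representative sees
  the blob of \<open>u\<close> too, and that blob is connected within
  \<open>B \<union> M\<close>.\<close>

lemma induced_cvc_exists:
  assumes "finite V" and sym: "symp E" and sets: "X \<subseteq> F" "F \<subseteq> W" "W \<subseteq> V" "M \<subseteq> W" "B \<subseteq> X"
    and X: "\<And>u v. u \<in> V \<Longrightarrow> v \<in> V \<Longrightarrow> E u v \<Longrightarrow> u \<in> X \<or> v \<in> X"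
    and B: "\<And>x v. x \<in> X \<Longrightarrow> v \<in> V \<Longrightarrow> E x v \<Longrightarrow> v \<notin> F \<Longrightarrow> x \<in> B"
    and cover: "\<And>x. x \<in> B \<Longrightarrow> \<exists>b\<in>\<B>. x \<in> b" and sub: "\<And>b. b \<in> \<B> \<Longrightarrow> b \<subseteq> B"
    and conn: "\<And>b x y. b \<in> \<B> \<Longrightarrow> x \<in> b \<Longrightarrow> y \<in> b \<Longrightarrow> (x, y) \<in> reach E (B \<union> M)"
    and M: "\<And>m. m \<in> M \<Longrightarrow> \<exists>x\<in>B. E m x"
    and rep: "\<And>v. v \<in> V \<Longrightarrow> v \<notin> W \<Longrightarrow> \<exists>w\<in>W. \<forall>b\<in>\<B>. (\<exists>x\<in>b. E v x) \<longrightarrow> (\<exists>x\<in>b. E w x)"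
    and T: "cvc V E T" "B \<subseteq> T"
  shows "\<exists>T'. cvc W E T' \<and> card T' \<le> card T + card M"
proof -
  have E_sym: "E u v \<Longrightarrow> E v u" for u v using sym by (auto simp: symp_def)
  have TV: "T \<subseteq> V" using T unfolding cvc_def by blast
  obtain \<rho>0 where \<rho>0: "\<And>v. v \<in> V \<Longrightarrow> v \<notin> W \<Longrightarrow> \<rho>0 v \<in> W"
    "\<And>v b. v \<in> V \<Longrightarrow> v \<notin> W \<Longrightarrow> b \<in> \<B> \<Longrightarrow> \<exists>x\<in>b. E v x \<Longrightarrow> \<exists>x\<in>b. E (\<rho>0 v) x"
    using rep by metis
  \<comment> \<open>Vertices of \<open>W\<close>, in particular all of \<open>B\<close>, stay fixed,
    so edges inside \<open>W\<close> remain covered.\<close>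
  define \<rho> where "\<rho> v = (if v \<in> W then v else \<rho>0 v)" for v
  define T' where "T' = \<rho> ` T \<union> M"
  have BW: "B \<subseteq> W" using sets by blast
  have BT': "B \<union> M \<subseteq> T'"
    using T(2) BW by (auto simp: T'_def \<rho>_def image_iff intro!: bexI)
  have \<rho>T: "\<rho> v \<in> T'" if "v \<in> T" for v using that by (simp add: T'_def)
  \<comment> \<open>By symmetry \<open>u\<close> may be taken from the vertex cover
    \<open>X\<close>. If \<open>v\<close> is dropped, then \<open>u\<close> is a boundary vertex and
    the path runs through its blob.\<close>
  have adj: "(\<rho> u, \<rho> v) \<in> reach E T'" if "u \<in> T" "v \<in> T" "E u v" "u \<in> X" for u v
  proof (cases "v \<in> W")
    case True
    then show ?thesis using that sets \<rho>T by (auto simp: \<rho>_def intro!: reach_edge; metis)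
  next
    case False
    then have "v \<notin> F" using sets by blast
    then have uB: "u \<in> B" using B that TV by blast
    then obtain b where b: "b \<in> \<B>" "u \<in> b" using cover by blast
    have "v \<in> V" "\<exists>x\<in>b. E v x" using that TV E_sym b by blast+
    then obtain x where x: "x \<in> b" "E (\<rho> v) x"
      using \<rho>0(2)[of v b] False b by (auto simp: \<rho>_def)
    have "(u, x) \<in> reach E T'" using conn[OF b x(1)] BT' reach_mono by fast
    moreover have "(x, \<rho> v) \<in> reach E T'"
      using x sub[OF b(1)] BT' \<rho>T that E_sym by (intro reach_edge) auto
    moreover have "\<rho> u = u" using uB BW by (auto simp: \<rho>_def)
    ultimately show ?thesis using reach_trans by metis
  qed
  have adj': "(\<rho> u, \<rho> v) \<in> reach E T'" if "u \<in> T" "v \<in> T" "E u v" for u v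
    using adj[of u v] adj[of v u] that X[of u v] TV E_sym reach_sym[OF sym] by blast
  have \<rho>conn: "(\<rho> u, \<rho> v) \<in> reach E T'" if "u \<in> T" "v \<in> T" for u v
    by (rule reach_map[OF _ adj']) (use T that in \<open>auto simp: cvc_def\<close>)
  \<comment> \<open>The vertices of \<open>M\<close> are attached to \<open>B\<close>, which \<rho>
    fixes, so connectivity has to be checked only between images.\<close>
  have hook: "\<exists>v\<in>T. (u, \<rho> v) \<in> reach E T'" if u: "u \<in> T'" for u
  proof (cases "u \<in> M")
    case True
    then obtain x where x: "x \<in> B" "E u x" using M by blast
    then have "(u, x) \<in> reach E T'" using True BT' by (intro reach_edge) auto
    moreover have "\<rho> x = x" using x BW by (auto simp: \<rho>_def)
    ultimately show ?thesis using x T(2) by (metis subsetD)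
  next
    case False
    then obtain x where "x \<in> T" "u = \<rho> x" using u by (auto simp: T'_def)
    then show ?thesis using reach_refl by metis
  qed
  have "cvc W E T'"
  proof (rule cvcI)
    show "T' \<subseteq> W" using sets TV \<rho>0(1) by (auto simp: T'_def \<rho>_def)
  next
    fix u v assume *: "u \<in> W" "v \<in> W" "E u v"
    then have "u \<in> T \<or> v \<in> T" using T(1) sets(3) unfolding cvc_def by blast
    then show "u \<in> T' \<or> v \<in> T'" using \<rho>T[of u] \<rho>T[of v] * by (auto simp: \<rho>_def)
  next
    fix u v assume "u \<in> T'" "v \<in> T'"
    then obtain u' v' where "u' \<in> T" "(u, \<rho> u') \<in> reach E T'" "v' \<in> T" "(v, \<rho> v') \<in> reach E T'"
      using hook by metis
    then show "(u, v) \<in> reach E T'" using \<rho>conn reach_sym[OF sym] reach_trans by metis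
  qed
  moreover have "card T' \<le> card T + card M"
  proof -
    have "finite T" using TV \<open>finite V\<close> finite_subset by blast
    then show ?thesis
      unfolding T'_def using card_image_le[of T \<rho>] card_Un_le[of "\<rho> ` T" M] by linarith
  qed
  ultimately show ?thesis by blast
qed

text \<open>Every non-isolated vertex is in \<open>T\<close> or adjacent to it. A connected vertex
  cover of any size thus witnesses that all edges lie in one component.\<close>

lemma cvc_connects_edges:
  assumes sym: "symp E" and T: "cvc V E T" and V: "u \<in> V" "u' \<in> V" "v \<in> V" "v' \<in> V"
    and E: "E u u'" "E v v'"
  shows "(u, v) \<in> reach E V"
proof -
  have *: "\<exists>t\<in>T. (a, t) \<in> reach E V" if "a \<in> V" "b \<in> V" "E a b" for a b
    using T that reach_edge[of a V b E] reach_refl unfolding cvc_def by metis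
  obtain s t where st: "s \<in> T" "(u, s) \<in> reach E V" "t \<in> T" "(v, t) \<in> reach E V"
    using *[of u u'] *[of v v'] V E by blast
  moreover have "(s, t) \<in> reach E V"
    using T st reach_mono[of T V] unfolding cvc_def by blast
  ultimately show ?thesis using reach_sym[OF sym] reach_trans by metis
qed

text \<open>A path that leaves a blob through an outside vertex must return to the same blob if
  outside vertices see at most one. All non-isolated vertices lie in one component, as
  \<open>T\<close> shows, so there is at most one blob.\<close>

lemma cvc_of_connected_blobs:
  assumes sym: "symp E" and T: "cvc V E T" and sets: "X \<subseteq> V" "C \<subseteq> V"
    and X: "\<And>u v. u \<in> V \<Longrightarrow> v \<in> V \<Longrightarrow> E u v \<Longrightarrow> u \<in> X \<or> v \<in> X"
    and nonisol: "\<And>x. x \<in> X \<Longrightarrow> \<exists>v\<in>V. E x v"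
    and cover: "\<And>x. x \<in> X \<Longrightarrow> \<exists>b\<in>\<B>. x \<in> b" and sub: "\<And>b. b \<in> \<B> \<Longrightarrow> b \<subseteq> X"
    and conn: "\<And>b x y. b \<in> \<B> \<Longrightarrow> x \<in> b \<Longrightarrow> y \<in> b \<Longrightarrow> (x, y) \<in> reach E (X \<union> C)"
    and closed: "\<And>b x y. b \<in> \<B> \<Longrightarrow> x \<in> b \<Longrightarrow> y \<in> X \<Longrightarrow> E x y \<Longrightarrow> y \<in> b"
    and one: "\<And>v b b' x y. v \<in> V \<Longrightarrow> v \<notin> X \<Longrightarrow> b \<in> \<B> \<Longrightarrow> b' \<in> \<B> \<Longrightarrow> x \<in> b \<Longrightarrow> y \<in> b' \<Longrightarrow>
      E v x \<Longrightarrow> E v y \<Longrightarrow> b = b'"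
    and C: "\<And>c. c \<in> C \<Longrightarrow> \<exists>x\<in>X. E c x"
  shows "cvc V E (X \<union> C)"
proof -
  have E_sym: "E u v \<Longrightarrow> E v u" for u v using sym by (auto simp: symp_def)
  have same: "y \<in> b" if "b \<in> \<B>" "x \<in> b" "y \<in> X" for b x y
  proof -
    have x: "x \<in> X" using that sub by blast
    then have "(x, y) \<in> reach E V"
      using nonisol[OF x] nonisol[OF that(3)] cvc_connects_edges[OF sym T] that sets by blast
    \<comment> \<open>The path runs in the whole graph, so the induction also needs a claim for
      vertices outside \<open>X\<close>: their neighbours in \<open>X\<close> all lie in
      \<open>b\<close>. Two outside vertices are never consecutive, since \<open>X\<close> is a
      vertex cover.\<close>
    then have "if y \<in> X then y \<in> b else \<forall>w\<in>X. E y w \<longrightarrow> w \<in> b"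
      unfolding reach_def
    proof (induction rule: rtrancl_induct)
      case base
      then show ?case using that x by simp
    next
      case (step y z)
      then have yz: "y \<in> V" "z \<in> V" "E y z" by auto
      show ?case
      proof (cases "y \<in> X")
        case True
        then have yb: "y \<in> b" using step by simp
        show ?thesis
        proof (cases "z \<in> X")
          case True then show ?thesis using closed[OF \<open>b \<in> \<B>\<close> yb True] yz by simp
        next
          case False
          have "w \<in> b" if w: "w \<in> X" "E z w" for w
          proof -
            obtain b' where "b' \<in> \<B>" "w \<in> b'" using cover w by blast
            then show ?thesis using one[of z b b' y w] \<open>b \<in> \<B>\<close> yb w yz False E_sym by blast
          qed
          then show ?thesis using False by simp
        qed
      next
        case False
        then have "z \<in> X" using X[OF yz] by simp
        then show ?thesis using step False yz by simp
      qed
    qed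
    then show ?thesis using that by simp
  qed
  have XX: "(x, y) \<in> reach E (X \<union> C)" if "x \<in> X" "y \<in> X" for x y
    using that same conn cover by metis
  have hook: "\<exists>x\<in>X. (u, x) \<in> reach E (X \<union> C)" if "u \<in> X \<union> C" for u
    using that C[of u] reach_edge[of u "X \<union> C" _ E] reach_refl by (metis Un_iff)
  show ?thesis
  proof (rule cvcI)
    fix u v assume "u \<in> X \<union> C" "v \<in> X \<union> C"
    then obtain x y where "x \<in> X" "(u, x) \<in> reach E (X \<union> C)" "y \<in> X" "(v, y) \<in> reach E (X \<union> C)"
      using hook by metis
    then show "(u, v) \<in> reach E (X \<union> C)" using XX reach_sym[OF sym] reach_trans by metis
  qed (use sets X in auto)
qed


section \<open>Contracting a vertex set to one vertex\<close>

locale contraction =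
  fixes V S :: "'a set" and E :: "'a \<Rightarrow> 'a \<Rightarrow> bool"
    and E' :: "'b \<Rightarrow> 'b \<Rightarrow> bool" and z :: 'b and \<phi> :: "'a \<Rightarrow> 'b"
  assumes fin: "finite V" and S: "S \<subseteq> V" and sym: "symp E"
    and inj: "inj_on \<phi> (V - S)" and z: "z \<notin> \<phi> ` (V - S)"
    and E'_inner: "\<And>u v. u \<in> V - S \<Longrightarrow> v \<in> V - S \<Longrightarrow> E' (\<phi> u) (\<phi> v) \<longleftrightarrow> E u v"
    and E'_z: "\<And>v. v \<in> V - S \<Longrightarrow> E' z (\<phi> v) \<longleftrightarrow> (\<exists>s\<in>S. E v s)"
      "\<And>v. v \<in> V - S \<Longrightarrow> E' (\<phi> v) z \<longleftrightarrow> (\<exists>s\<in>S. E v s)"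
    and E'_zz: "\<not> E' z z"
begin

lemma E_sym: "E u v \<Longrightarrow> E v u"
  using sym by (auto simp: symp_def)

text \<open>Edges within \<open>S\<close> collapse to the point \<open>z\<close> and all others are
  kept, so the image of a solution is still covering and connected, and it is no larger.\<close>

lemma contracted_cvc:
  assumes T: "cvc V E T"
  shows "\<exists>T'. cvc (insert z (\<phi> ` (V - S))) E' T' \<and> card T' \<le> card T"
proof -
  define f where "f v = (if v \<in> S then z else \<phi> v)" for v
  have TV: "T \<subseteq> V" and cover: "\<And>u v. u \<in> V \<Longrightarrow> v \<in> V \<Longrightarrow> E u v \<Longrightarrow> u \<in> T \<or> v \<in> T"
    using T unfolding cvc_def by blast+
  have z_cover: "z \<in> f ` T \<or> \<phi> v \<in> f ` T" if v: "v \<in> V - S" "\<exists>s\<in>S. E v s" for v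
  proof -
    obtain s where s: "s \<in> S" "E v s" using v by blast
    then have "v \<in> T \<or> s \<in> T" using cover[of v s] v S by blast
    then show ?thesis using s v by (auto simp: f_def image_iff)
  qed
  have "cvc (insert z (\<phi> ` (V - S))) E' (f ` T)"
  proof (rule cvcI)
    show "f ` T \<subseteq> insert z (\<phi> ` (V - S))" using TV by (auto simp: f_def)
  next
    fix a b assume ab: "a \<in> insert z (\<phi> ` (V - S))" "b \<in> insert z (\<phi> ` (V - S))" "E' a b"
    consider "a = z" "b = z" | v where "a = z" "v \<in> V - S" "b = \<phi> v"
      | v where "b = z" "v \<in> V - S" "a = \<phi> v"
      | u v where "a = \<phi> u" "u \<in> V - S" "v \<in> V - S" "b = \<phi> v"
      using ab by blast
    then show "a \<in> f ` T \<or> b \<in> f ` T"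
    proof cases
      case 1 then show ?thesis using ab E'_zz by simp
    next
      case 2 then show ?thesis using ab E'_z z_cover by blast
    next
      case 3 then show ?thesis using ab E'_z z_cover by blast
    next
      case 4
      then have "u \<in> T \<or> v \<in> T" using ab E'_inner cover[of u v] by auto
      then show ?thesis using 4 by (auto simp: f_def image_iff)
    qed
  next
    fix a b assume "a \<in> f ` T" "b \<in> f ` T"
    then obtain u v where uv: "a = f u" "b = f v" "u \<in> T" "v \<in> T" by blast
    then have "(u, v) \<in> reach E T" using T unfolding cvc_def by blast
    then have "(f u, f v) \<in> reach E' (f ` T)"
    proof (rule reach_map)
      fix u v assume *: "u \<in> T" "v \<in> T" "E u v"
      then have V: "u \<in> V" "v \<in> V" using TV by auto
      have "E' (f u) (f v) \<or> f u = f v"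
        using E'_inner[of u v] E'_z(1)[of v] E'_z(2)[of u] * V E_sym[OF *(3)] by (auto simp: f_def)
      then show "(f u, f v) \<in> reach E' (f ` T)" using * reach_edge reach_refl by (metis imageI)
    qed
    then show "(a, b) \<in> reach E' (f ` T)" using uv by simp
  qed
  moreover have "card (f ` T) \<le> card T"
    using TV fin by (meson card_image_le finite_subset)
  ultimately show ?thesis by blast
qed

context
  fixes Y X assumes Y: "cvc (insert z (\<phi> ` (V - S))) E' Y"
  defines "X \<equiv> {x \<in> S \<union> {v \<in> V - S. \<phi> v \<in> Y}. \<exists>v\<in>V. E x v}"
begin

lemma expanded_vertex_cover:
  assumes "u \<in> V" "v \<in> V" "E u v"
  shows "u \<in> X \<or> v \<in> X"
proof (cases "u \<in> S \<or> v \<in> S")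
  case True
  then show ?thesis using assms E_sym unfolding X_def by blast
next
  case False
  then have "E' (\<phi> u) (\<phi> v)" using E'_inner assms by blast
  then have "\<phi> u \<in> Y \<or> \<phi> v \<in> Y" using Y False assms unfolding cvc_def by blast
  then show ?thesis using False assms E_sym unfolding X_def by blast
qed

lemma card_expanded: "card X \<le> card Y + card S"
proof -
  have finY: "finite Y" using Y fin unfolding cvc_def by (meson finite_Diff finite_imageI finite_insert finite_subset)
  let ?Y = "{v \<in> V - S. \<phi> v \<in> Y}"
  have "card ?Y = card (\<phi> ` ?Y)"
    by (rule card_image[symmetric]) (rule inj_on_subset[OF inj], blast)
  also have "\<dots> \<le> card Y" by (rule card_mono[OF finY]) blast
  finally have "card (S \<union> ?Y) \<le> card Y + card S"
    using card_Un_le[of S ?Y] by linarith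
  moreover have "card X \<le> card (S \<union> ?Y)"
    unfolding X_def by (rule card_mono) (use fin S in \<open>auto intro: finite_subset\<close>)
  ultimately show ?thesis by linarith
qed

text \<open>The blobs are disjoint, so at most |S| of them meet \<open>S\<close>. A blob that avoids
  \<open>S\<close> contains all of the expanded \<open>Y\<close>: a path in the connected set
  \<open>Y\<close> cannot leave it through \<open>z\<close>, since this would put a neighbour from
  \<open>S\<close> into the blob. So there is at most one such blob.\<close>

lemma card_closed_blobs:
  assumes sub: "\<And>b. b \<in> \<B> \<Longrightarrow> b \<subseteq> X" and ne: "\<And>b. b \<in> \<B> \<Longrightarrow> b \<noteq> {}"
    and disj: "\<And>b b'. b \<in> \<B> \<Longrightarrow> b' \<in> \<B> \<Longrightarrow> b \<inter> b' \<noteq> {} \<Longrightarrow> b = b'"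
    and closed: "\<And>b x y. b \<in> \<B> \<Longrightarrow> x \<in> b \<Longrightarrow> y \<in> X \<Longrightarrow> E x y \<Longrightarrow> y \<in> b"
  shows "card \<B> \<le> card S + 1"
proof -
  have one: "b = b'" if b: "b \<in> \<B>" "b \<inter> S = {}" and b': "b' \<in> \<B>" "b' \<inter> S = {}" for b b'
  proof -
    obtain y y' where y: "y \<in> b" "y' \<in> b'" using ne[OF b(1)] ne[OF b'(1)] by auto
    then have yX: "y \<in> X" "y' \<in> X" using sub b b' by blast+
    have yS: "y \<notin> S" "y' \<notin> S" using y b b' by blast+
    have yY: "y \<in> V - S" "\<phi> y \<in> Y" "y' \<in> V - S" "\<phi> y' \<in> Y" using yX yS unfolding X_def by auto
    then have "(\<phi> y, \<phi> y') \<in> reach E' Y" using Y unfolding cvc_def by blast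
    then have "\<exists>v\<in>b. \<phi> y' = \<phi> v"
      unfolding reach_def
    proof (induction rule: rtrancl_induct)
      case base then show ?case using y by blast
    next
      case (step w w')
      then obtain v where v: "v \<in> b" "w = \<phi> v" by blast
      have vV: "v \<in> V - S" using v b sub[OF b(1)] unfolding X_def by auto
      have w': "w' \<in> insert z (\<phi> ` (V - S))" "E' (\<phi> v) w'" "w' \<in> Y"
        using step Y v unfolding cvc_def by auto
      show ?case
      proof (cases "w' = z")
        case True
        then obtain s where s: "s \<in> S" "E v s" using E'_z(2)[OF vV] w' by blast
        then have "s \<in> X" using vV E_sym unfolding X_def by blast
        then have "s \<in> b" using closed[OF b(1) v(1)] s by blast
        then show ?thesis using b s by blast
      next
        case False
        then obtain v' where v': "v' \<in> V - S" "w' = \<phi> v'" using w' by blast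
        then have E: "E v v'" using E'_inner[OF vV] w' by blast
        then have "v' \<in> X" using v' w' vV E_sym unfolding X_def by blast
        then show ?thesis using closed[OF b(1) v(1)] E v' by blast
      qed
    qed
    then obtain v where v: "v \<in> b" "\<phi> y' = \<phi> v" by blast
    then have "v \<in> X" "v \<notin> S" using b sub[OF b(1)] by auto
    then have "v \<in> V - S" unfolding X_def by auto
    then have "y' = v" using inj yY v by (metis inj_onD)
    then show ?thesis using disj[OF b(1) b'(1)] v y by auto
  qed
  let ?\<B>S = "{b \<in> \<B>. b \<inter> S \<noteq> {}}" and ?\<B>0 = "{b \<in> \<B>. b \<inter> S = {}}"
  have finS: "finite S" using fin S finite_subset by blast
  define g where "g b = (SOME x. x \<in> b \<inter> S)" for b
  have g: "g b \<in> b \<inter> S" if "b \<in> ?\<B>S" for b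
    unfolding g_def by (rule someI_ex) (use that in auto)
  have g_inj: "inj_on g ?\<B>S"
  proof (rule inj_onI)
    fix b b' assume *: "b \<in> ?\<B>S" "b' \<in> ?\<B>S" "g b = g b'"
    then have "g b \<in> b \<inter> b'" using g[OF *(1)] g[OF *(2)] by auto
    then show "b = b'" using disj[of b b'] * by auto
  qed
  have "card ?\<B>S \<le> card S"
    by (rule card_inj_on_le[OF g_inj _ finS]) (use g in blast)
  moreover have "card ?\<B>0 \<le> 1"
  proof (cases "?\<B>0 = {}")
    case False
    then obtain b where "b \<in> ?\<B>0" by blast
    then have "?\<B>0 \<subseteq> {b}" using one by blast
    then show ?thesis using card_mono[of "{b}" ?\<B>0] by simp
  qed (simp only: card.empty)
  moreover have "card \<B> \<le> card ?\<B>S + card ?\<B>0"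
  proof -
    have "\<B> = ?\<B>S \<union> ?\<B>0" by blast
    then show ?thesis using card_Un_le[of ?\<B>S ?\<B>0] by simp
  qed
  ultimately show ?thesis by linarith
qed

end

end

section \<open>Characteristic vectors\<close>

definition vset :: "bool list \<Rightarrow> nat set" where
  "vset v = {i. i < length v \<and> v ! i}"

definition idxs :: "bool list \<Rightarrow> nat list" where
  "idxs m = filter (\<lambda>i. m ! i) [0..<length m]"

lemma finite_vset [simp]: "finite (vset v)"
  by (simp add: vset_def)

lemma vset_Nil [simp]: "vset [] = {}"
  by (simp add: vset_def)

lemma vset_Cons [simp]: "vset (b # bs) = (if b then insert 0 (Suc ` vset bs) else Suc ` vset bs)"
proof -
  have "i \<in> vset (b # bs) \<longleftrightarrow> (i = 0 \<and> b) \<or> i \<in> Suc ` vset bs" for i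
    by (cases i) (auto simp: vset_def image_iff)
  then show ?thesis by auto
qed

lemma vset_less: "i \<in> vset v \<Longrightarrow> i < length v"
  by (simp add: vset_def)

lemma card_vset: "card (vset v) = length (ones v)"
  by (induction v) (auto simp: ones_def card_image image_iff)

lemma meets_iff: "meets u v \<longleftrightarrow> vset u \<inter> vset v \<noteq> {}"
  by (auto simp: meets_def vset_def list_ex_iff set_zip)

lemma sub_vec_iff: "length u = length v \<Longrightarrow> sub_vec u v \<longleftrightarrow> vset u \<subseteq> vset v"
  by (auto simp: sub_vec_def vset_def list_ex_iff set_zip)

lemma length_vor [simp]: "length (vor u v) = min (length u) (length v)"
  by (simp add: vor_def)

lemma vset_vor: "length u = length v \<Longrightarrow> vset (vor u v) = vset u \<union> vset v"
  by (auto simp: vor_def vset_def)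

lemma union_vec:
  assumes "\<forall>v\<in>set vs. length v = length r"
  shows "length (union_vec r vs) = length r" "vset (union_vec r vs) = \<Union> (vset ` set vs)"
proof -
  have "length (foldl (\<lambda>u v. vor u v) u vs) = length u \<and>
      vset (foldl (\<lambda>u v. vor u v) u vs) = vset u \<union> \<Union> (vset ` set vs)"
    if "length u = length r" for u
    using assms that
  proof (induction vs arbitrary: u)
    case (Cons v vs)
    then show ?case using Cons.IH[of "vor u v"] by (auto simp: vset_vor)
  qed simp
  moreover have "vset (map (\<lambda>_. False) r) = {}" by (simp add: vset_def)
  ultimately show "length (union_vec r vs) = length r" "vset (union_vec r vs) = \<Union> (vset ` set vs)"
    by (auto simp: union_vec_def)
qed

lemma idmat:
  "length (idmat xs) = length xs \<and>
    (\<forall>i<length xs. length (idmat xs ! i) = length xs \<and> vset (idmat xs ! i) = {i})"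
proof (induction xs rule: rev_induct)
  case Nil
  then show ?case by (simp add: idmat_def)
next
  case (snoc x xs)
  have eq: "idmat (xs @ [x]) =
      (True # map (\<lambda>_. False) (idmat xs)) # map (\<lambda>r. False # r) (idmat xs)"
    by (simp add: idmat_def)
  have "vset (map (\<lambda>_. False) ys) = {}" for ys :: "'b list" by (simp add: vset_def)
  then show ?case using snoc unfolding eq by (auto simp: nth_Cons split: nat.split)
qed

section \<open>Restriction to a mask and back\<close>

lemma idxs_Cons: "idxs (b # m) = (if b then [0] else []) @ map Suc (idxs m)"
proof -
  have "[0..<length (b # m)] = 0 # map Suc [0..<length m]"
    using upt_conv_Cons[of 0 "length (b # m)"] map_Suc_upt[of 0 "length m"] by simp
  then show ?thesis by (simp add: idxs_def filter_map comp_def)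
qed

lemma set_idxs [simp]: "set (idxs m) = vset m"
  by (auto simp: idxs_def vset_def)

lemma distinct_idxs [simp]: "distinct (idxs m)"
  by (simp add: idxs_def)

lemma length_idxs: "length (idxs m) = card (vset m)"
  using distinct_card[OF distinct_idxs, of m] by simp

lemma compress_conv: "length m = length xs \<Longrightarrow> compress m xs = map ((!) xs) (idxs m)"
proof (induction m xs rule: list_induct2)
  case Nil
  then show ?case by (simp add: compress_def idxs_def)
next
  case (Cons b m x xs)
  then show ?case by (auto simp: compress_def idxs_Cons)
qed

lemma length_compress: "length m = length xs \<Longrightarrow> length (compress m xs) = card (vset m)"
  by (simp add: compress_conv length_idxs)

lemma length_expand [simp]: "length (expand m ys) = length m"
  by (induction m ys rule: expand.induct) auto

lemma vset_expand_subset: "vset (expand m ys) \<subseteq> vset m"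
  by (induction m ys rule: expand.induct) (auto split: list.splits)

lemma compress_expand: "length ys = card (vset m) \<Longrightarrow> compress m (expand m ys) = ys"
proof (induction m ys rule: expand.induct)
  case (2 b bs ys)
  then show ?case
    by (cases ys) (auto simp: compress_def card_image card_insert_if image_iff)
qed (simp add: compress_def)

text \<open>The expansion of a set is its image under the indexing that also embeds the submatrix
  into the matrix, so covers can be transported by renaming.\<close>

lemma vset_expand:
  assumes "length ys = card (vset m)"
  shows "vset (expand m ys) = (!) (idxs m) ` vset ys"
proof -
  have eq: "map ((!) (expand m ys)) (idxs m) = ys"
    using compress_expand[OF assms] by (simp add: compress_conv)
  have nth: "expand m ys ! (idxs m ! j) = ys ! j" if "j < length ys" for j
    using arg_cong[OF eq, of "\<lambda>l. l ! j"] that assms by (simp add: length_idxs)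
  have mem: "idxs m ! j \<in> vset m" if "j < length ys" for j
    using that assms by (metis length_idxs nth_mem set_idxs)
  show ?thesis
  proof (intro subset_antisym subsetI)
    fix i assume i: "i \<in> vset (expand m ys)"
    then have "i \<in> set (idxs m)" using vset_expand_subset by fastforce
    then obtain j where "j < length ys" "i = idxs m ! j"
      using assms by (metis in_set_conv_nth length_idxs)
    then show "i \<in> (!) (idxs m) ` vset ys" using nth i by (auto simp: vset_def)
  next
    fix i assume "i \<in> (!) (idxs m) ` vset ys"
    then obtain j where "j < length ys" "ys ! j" "i = idxs m ! j" by (auto simp: vset_def)
    then show "i \<in> vset (expand m ys)" using nth mem by (auto simp: vset_def)
  qed
qed

text \<open>The all-true list runs out after as many true positions as it has entries; this is the
  cap on marked neighbours.\<close>

lemma card_vset_expand_ones: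
  "list_all (\<lambda>b. b) ys \<Longrightarrow> card (vset (expand m ys)) = min (length ys) (card (vset m))"
  by (induction m ys rule: expand.induct)
    (auto simp: card_image card_insert_if image_iff split: list.splits)

lemma compress_idmat:
  "map vset (compress X (idmat X)) = map (\<lambda>i. {i}) (idxs X)"
  "\<forall>b\<in>set (compress X (idmat X)). length b = length X"
  using idmat[of X] set_idxs[of X] vset_less[of _ X] by (auto simp: compress_conv simp del: set_idxs)

lemma card_few_ones:
  assumes "m \<le> N"
  shows "card {c :: bool list. length c = m \<and> card (vset c) \<le> q} \<le> (\<Sum>j\<le>q. N choose j)"
proof -
  have "card {c :: bool list. length c = m \<and> card (vset c) \<le> q} \<le> card (\<Union>j\<le>q. {B. B \<subseteq> {..<N} \<and> card B = j})"
  proof (rule card_inj_on_le[where f = vset])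
    show "inj_on vset {c. length c = m \<and> card (vset c) \<le> q}"
      by (rule inj_onI) (auto simp: vset_def set_eq_iff list_eq_iff_nth_eq)
    show "vset ` {c. length c = m \<and> card (vset c) \<le> q} \<subseteq> (\<Union>j\<le>q. {B. B \<subseteq> {..<N} \<and> card B = j})"
      using assms by (auto simp: vset_def)
    show "finite (\<Union>j\<le>q. {B. B \<subseteq> {..<N} \<and> card B = j})"
      by (rule finite_subset[of _ "Pow {..<N}"]) auto
  qed
  also have "\<dots> \<le> (\<Sum>j\<le>q. card {B. B \<subseteq> {..<N} \<and> card B = j})"
    by (rule card_UN_le) simp
  also have "\<dots> = (\<Sum>j\<le>q. N choose j)"
    by (simp add: n_subsets)
  finally show ?thesis .
qed

section \<open>Merging blobs\<close>

lemma pass_Nil [simp]: "pass D bl [] = (bl, [])"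
  by (simp add: pass_def)

text \<open>Turns the fold into a recursion: selection bits are only appended, so those already
  emitted factor out.\<close>

lemma pass_Cons:
  "pass D bl (p # L) =
    (if fst p \<and> length D \<le> length (filter (meets (snd p)) bl)
     then let P = pass D (merge (snd p) bl) L in (fst P, True # snd P)
     else let P = pass D bl L in (fst P, False # snd P))"
proof -
  have state: "foldl (\<lambda>s p. pass_step D s p) (bl, sel) L = (fst (pass D bl L), sel @ snd (pass D bl L))"
    for bl sel L
  proof (induction L arbitrary: bl sel)
    case (Cons p L)
    have pass: "pass D bl (p # L) = foldl (\<lambda>s p. pass_step D s p) (pass_step D (bl, []) p) L"
      by (simp add: pass_def)
    show ?case
    proof (cases "fst p \<and> length D \<le> length (filter (meets (snd p)) bl)")
      case True
      then have "pass_step D (bl, []) p = (merge (snd p) bl, [True])"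
        "pass_step D (bl, sel) p = (merge (snd p) bl, sel @ [True])"
        by (auto simp: pass_step_def)
      then show ?thesis
        using Cons.IH[of "merge (snd p) bl" "[True]"] Cons.IH[of "merge (snd p) bl" "sel @ [True]"]
        unfolding pass by simp
    next
      case False
      then have "pass_step D (bl, []) p = (bl, [False])" "pass_step D (bl, sel) p = (bl, sel @ [False])"
        by (auto simp: pass_step_def)
      then show ?thesis
        using Cons.IH[of bl "[False]"] Cons.IH[of bl "sel @ [False]"] unfolding pass by simp
    qed
  qed (simp add: pass_def)
  have "pass D bl (p # L) = foldl (\<lambda>s p. pass_step D s p) (pass_step D (bl, []) p) L"
    by (simp add: pass_def)
  also have "\<dots> = (let Q = pass D (fst (pass_step D (bl, []) p)) L
      in (fst Q, snd (pass_step D (bl, []) p) @ snd Q))"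
    using state[of "fst (pass_step D (bl, []) p)" "snd (pass_step D (bl, []) p)"] by (simp add: Let_def)
  finally show ?thesis by (simp add: pass_step_def Let_def)
qed

lemma length_merge: "length (merge r bl) + length (filter (meets r) bl) = length bl + 1"
  using sum_length_filter_compl[of "meets r" bl] by (simp add: merge_def)

text \<open>The number of blobs is a potential: a selected vertex merges at least
  \<open>length D\<close> of them into one.\<close>

lemma pass_count:
  "1 \<le> length D \<Longrightarrow>
    length (fst (pass D bl L)) + (length D - 1) * length (ones (snd (pass D bl L))) \<le> length bl"
proof (induction L arbitrary: bl)
  case (Cons p L)
  show ?case
    using Cons.IH[OF Cons.prems, of bl] Cons.IH[OF Cons.prems, of "merge (snd p) bl"]
      length_merge[of "snd p" bl] Cons.prems
    by (auto simp: pass_Cons Let_def ones_def)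
qed (simp add: ones_def)

lemma length_snd_pass [simp]: "length (snd (pass D bl L)) = length L"
  by (induction L arbitrary: bl) (auto simp: pass_Cons Let_def)

text \<open>Partial because the blobs need not cover all \<open>n\<close> indices. Disjointness by
  position, together with nonemptiness, makes the blobs distinct.\<close>

definition partial_partition :: "nat \<Rightarrow> bool list list \<Rightarrow> bool" where
  "partial_partition n bl \<longleftrightarrow> (\<forall>b\<in>set bl. length b = n \<and> vset b \<noteq> {}) \<and>
     sorted_wrt (\<lambda>a b. vset a \<inter> vset b = {}) bl"

lemma partial_partition_disjoint:
  assumes "partial_partition n bl" "b \<in> set bl" "b' \<in> set bl" "x \<in> vset b" "x \<in> vset b'"
  shows "b = b'"
proof -
  obtain i j where ij: "i < length bl" "j < length bl" "b = bl ! i" "b' = bl ! j"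
    using assms by (metis in_set_conv_nth)
  then have "i = j"
    using assms unfolding partial_partition_def sorted_wrt_iff_nth_less
    by (metis disjoint_iff nat_neq_iff)
  then show ?thesis using ij by simp
qed

lemma partial_partition_distinct:
  "partial_partition n bl \<Longrightarrow> distinct (map vset bl)"
proof (induction bl)
  case (Cons b bl)
  then have "vset b \<inter> vset a = {}" if "a \<in> set bl" for a
    using that by (auto simp: partial_partition_def)
  then have "vset b \<notin> vset ` set bl" using Cons.prems by (auto simp: partial_partition_def)
  then show ?case using Cons by (auto simp: partial_partition_def)
qed simp

lemma partial_partition_singletons: "partial_partition (length X) (compress X (idmat X))"
proof -
  let ?bl = "compress X (idmat X)"
  have "vset (?bl ! i) = {idxs X ! i}" if "i < length ?bl" for i
    using that compress_idmat(1)[of X] by (metis length_map nth_map)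
  moreover have len: "length ?bl = length (idxs X)" using compress_idmat(1)[of X] by (metis length_map)
  ultimately have "sorted_wrt (\<lambda>a b. vset a \<inter> vset b = {}) ?bl"
    using nth_eq_iff_index_eq[OF distinct_idxs[of X]] by (auto simp: sorted_wrt_iff_nth_less)
  moreover have "vset b \<noteq> {}" if "b \<in> set ?bl" for b
  proof -
    have "vset b \<in> set (map vset ?bl)" using that by simp
    then show ?thesis unfolding compress_idmat(1) by auto
  qed
  ultimately show ?thesis using compress_idmat(2)[of X] by (simp add: partial_partition_def)
qed

lemma vset_merge_hd:
  assumes "partial_partition n bl" "length r = n"
  shows "length (union_vec r (filter (meets r) bl)) = n"
    "vset (union_vec r (filter (meets r) bl)) = \<Union> (vset ` {b \<in> set bl. meets r b})"
  using assms union_vec[of "filter (meets r) bl" r] by (auto simp: partial_partition_def)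

lemma partial_partition_merge:
  assumes bl: "partial_partition n bl" and r: "length r = n" and "filter (meets r) bl \<noteq> []"
  shows "partial_partition n (merge r bl)"
proof -
  obtain b where b: "b \<in> set bl" "meets r b" using assms(3) by (auto simp: filter_empty_conv)
  have "vset b \<noteq> {}" using b bl by (auto simp: partial_partition_def)
  then have "vset (union_vec r (filter (meets r) bl)) \<noteq> {}"
    unfolding vset_merge_hd(2)[OF bl r] using b by blast
  moreover have "vset (union_vec r (filter (meets r) bl)) \<inter> vset a = {}"
    if "a \<in> set bl" "\<not> meets r a" for a
    unfolding vset_merge_hd(2)[OF bl r] using that partial_partition_disjoint[OF bl that(1)] by blast
  moreover have "sorted_wrt (\<lambda>a b. vset a \<inter> vset b = {}) (filter (\<lambda>b. \<not> meets r b) bl)"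
    using bl by (simp add: partial_partition_def sorted_wrt_filter)
  ultimately show ?thesis
    using bl vset_merge_hd(1)[OF bl r] by (auto simp: partial_partition_def merge_def)
qed

lemma Union_merge:
  assumes "partial_partition n bl" "length r = n"
  shows "\<Union> (vset ` set (merge r bl)) = \<Union> (vset ` set bl)"
  using vset_merge_hd[OF assms] by (auto simp: merge_def)

text \<open>Whoever sees the merged blob already saw one of its parts.\<close>

lemma merge_few:
  assumes bl: "partial_partition n bl" and r: "length r = n"
  shows "length (filter (meets q) (merge r bl)) \<le> length (filter (meets q) bl)"
proof -
  have split: "length (filter (meets q) (filter (meets r) bl)) +
      length (filter (meets q) (filter (\<lambda>b. \<not> meets r b) bl)) = length (filter (meets q) bl)"
    using sum_length_filter_compl[of "meets r" "filter (meets q) bl"]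
    by (simp add: conj_commute)
  have "filter (meets q) (filter (meets r) bl) \<noteq> []" if "meets q (union_vec r (filter (meets r) bl))"
    using that vset_merge_hd(2)[OF bl r] by (auto simp: meets_iff filter_empty_conv)
  then have "meets q (union_vec r (filter (meets r) bl)) \<Longrightarrow>
      1 \<le> length (filter (meets q) (filter (meets r) bl))"
    by (metis One_nat_def Suc_leI length_greater_0_conv)
  then show ?thesis using split by (auto simp: merge_def)
qed

lemma merge_self: "length (filter (meets r) (merge r bl)) \<le> 1"
proof -
  have "filter (meets r) (filter (\<lambda>b. \<not> meets r b) bl) = []" by (simp add: filter_empty_conv)
  then show ?thesis by (simp add: merge_def)
qed

section \<open>Invariants of a pass over the vertices\<close>

locale pass_ctx =
  fixes n :: nat and D :: "bool list"
  assumes D: "1 \<le> length D"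
begin

lemma pass_partition:
  assumes "partial_partition n bl" "\<forall>p\<in>set L. length (snd p) = n"
  shows "partial_partition n (fst (pass D bl L)) \<and>
    \<Union> (vset ` set (fst (pass D bl L))) = \<Union> (vset ` set bl)"
  using assms
proof (induction L arbitrary: bl)
  case (Cons p L)
  show ?case
  proof (cases "fst p \<and> length D \<le> length (filter (meets (snd p)) bl)")
    case True
    then have "filter (meets (snd p)) bl \<noteq> []" using D by auto
    then show ?thesis
      using True Cons.IH[of "merge (snd p) bl"] Cons.prems partial_partition_merge[of n bl "snd p"]
        Union_merge[of n bl "snd p"] by (simp add: pass_Cons Let_def)
  next
    case False
    then show ?thesis using Cons by (auto simp: pass_Cons Let_def)
  qed
qed simp

lemma pass_few_mono:
  assumes "partial_partition n bl" "\<forall>p\<in>set L. length (snd p) = n"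
  shows "length (filter (meets q) (fst (pass D bl L))) \<le> length (filter (meets q) bl)"
  using assms
proof (induction L arbitrary: bl)
  case (Cons p L)
  show ?case
  proof (cases "fst p \<and> length D \<le> length (filter (meets (snd p)) bl)")
    case True
    then have "filter (meets (snd p)) bl \<noteq> []" using D by auto
    then show ?thesis
      using True Cons.IH[of "merge (snd p) bl"] Cons.prems partial_partition_merge[of n bl "snd p"]
        merge_few[of n bl "snd p" q] by (simp add: pass_Cons Let_def)
  next
    case False
    then show ?thesis using Cons by (auto simp: pass_Cons Let_def)
  qed
qed simp

text \<open>At its turn a vertex is either passed over, with fewer than \<open>length D\<close>
  blobs in sight, or selected and then sees at most one; later merges only lower the count. The
  maximum with 1 matters for threshold 1, where \<open>length D - 1\<close> is 0.\<close>

lemma pass_few: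
  assumes "partial_partition n bl" "\<forall>p\<in>set L. length (snd p) = n" "p \<in> set L" "fst p"
  shows "length (filter (meets (snd p)) (fst (pass D bl L))) \<le> max 1 (length D - 1)"
  using assms
proof (induction L arbitrary: bl)
  case (Cons q L)
  show ?case
  proof (cases "fst q \<and> length D \<le> length (filter (meets (snd q)) bl)")
    case True
    then have "filter (meets (snd q)) bl \<noteq> []" using D by auto
    then have pp: "partial_partition n (merge (snd q) bl)"
      using Cons.prems by (intro partial_partition_merge) auto
    have "p = q \<Longrightarrow> ?thesis"
      using True pass_few_mono[OF pp, of L "snd p"] Cons.prems merge_self[of "snd q" bl]
      by (simp add: pass_Cons Let_def)
    moreover have "p \<in> set L \<Longrightarrow> ?thesis"
      using True Cons.IH[OF pp] Cons.prems by (simp add: pass_Cons Let_def)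
    ultimately show ?thesis using Cons.prems by auto
  next
    case False
    have "p = q \<Longrightarrow> ?thesis"
      using False pass_few_mono[of bl L "snd p"] Cons.prems
      by (auto simp: pass_Cons Let_def)
    moreover have "p \<in> set L \<Longrightarrow> ?thesis"
      using False Cons.IH[of bl] Cons.prems by (auto simp: pass_Cons Let_def)
    ultimately show ?thesis using Cons.prems by auto
  qed
qed simp

lemma pass_coarsens:
  assumes "partial_partition n bl" "\<forall>p\<in>set L. length (snd p) = n" "b \<in> set bl"
  shows "\<exists>b'\<in>set (fst (pass D bl L)). vset b \<subseteq> vset b'"
  using assms
proof (induction L arbitrary: bl b)
  case (Cons q L)
  show ?case
  proof (cases "fst q \<and> length D \<le> length (filter (meets (snd q)) bl)")
    case True
    then have "filter (meets (snd q)) bl \<noteq> []" using D by auto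
    then have pp: "partial_partition n (merge (snd q) bl)"
      using Cons.prems by (intro partial_partition_merge) auto
    have "\<exists>c\<in>set (merge (snd q) bl). vset b \<subseteq> vset c"
      using Cons.prems vset_merge_hd(2)[of n bl "snd q"] by (auto simp: merge_def)
    then show ?thesis using Cons.IH[OF pp] True Cons.prems by (simp add: pass_Cons Let_def) (meson subset_trans)
  next
    case False
    then show ?thesis using Cons by (auto simp: pass_Cons Let_def)
  qed
qed auto

lemma pass_selected:
  assumes "partial_partition n bl" "\<forall>p\<in>set L. length (snd p) = n" "i < length L" "snd (pass D bl L) ! i"
  shows "fst (L ! i) \<and> vset (snd (L ! i)) \<inter> \<Union> (vset ` set bl) \<noteq> {}"
  using assms
proof (induction L arbitrary: bl i)
  case (Cons q L)
  show ?case
  proof (cases "fst q \<and> length D \<le> length (filter (meets (snd q)) bl)")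
    case True
    then have ne: "filter (meets (snd q)) bl \<noteq> []" using D by auto
    then have pp: "partial_partition n (merge (snd q) bl)"
      using Cons.prems by (intro partial_partition_merge) auto
    show ?thesis
    proof (cases i)
      case 0
      obtain b where "b \<in> set bl" "meets (snd q) b" using ne by (auto simp: filter_empty_conv)
      then show ?thesis using 0 True by (auto simp: meets_iff)
    next
      case (Suc j)
      then show ?thesis
        using Cons.IH[OF pp, of j] True Cons.prems Union_merge[of n bl "snd q"]
        by (simp add: pass_Cons Let_def)
    qed
  next
    case False
    then show ?thesis using Cons by (cases i) (auto simp: pass_Cons Let_def)
  qed
qed simp

text \<open>It suffices that a selected vertex joins within \<open>U\<close> everything it sees.
  \<open>U\<close> is left open: for components it is \<open>X\<close>, which contains the selected
  vertices, and otherwise they are added to the initial blobs.\<close>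

lemma pass_connected:
  assumes "partial_partition n bl" "\<forall>p\<in>set L. length (snd p) = n"
    and "\<And>b x y. b \<in> set bl \<Longrightarrow> x \<in> vset b \<Longrightarrow> y \<in> vset b \<Longrightarrow> (x, y) \<in> reach E U"
    and "\<And>i x y. i < length L \<Longrightarrow> snd (pass D bl L) ! i \<Longrightarrow>
      x \<in> vset (snd (L ! i)) \<inter> \<Union> (vset ` set bl) \<Longrightarrow>
      y \<in> vset (snd (L ! i)) \<inter> \<Union> (vset ` set bl) \<Longrightarrow> (x, y) \<in> reach E U"
    and "b \<in> set (fst (pass D bl L))" "x \<in> vset b" "y \<in> vset b"
  shows "(x, y) \<in> reach E U"
  using assms
proof (induction L arbitrary: bl)
  case (Cons q L)
  show ?case
  proof (cases "fst q \<and> length D \<le> length (filter (meets (snd q)) bl)")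
    case True
    then have ne: "filter (meets (snd q)) bl \<noteq> []" using D by auto
    then have pp: "partial_partition n (merge (snd q) bl)"
      using Cons.prems by (intro partial_partition_merge) auto
    have U: "\<Union> (vset ` set (merge (snd q) bl)) = \<Union> (vset ` set bl)"
      using Cons.prems by (intro Union_merge[of n]) auto
    have q: "(x, y) \<in> reach E U"
      if "x \<in> vset (snd q) \<inter> \<Union> (vset ` set bl)" "y \<in> vset (snd q) \<inter> \<Union> (vset ` set bl)" for x y
      using Cons.prems(4)[of 0 x y] that True by (simp add: pass_Cons Let_def)
    show ?thesis
    proof (rule Cons.IH[OF pp])
      show "\<forall>p\<in>set L. length (snd p) = n" using Cons.prems by simp
      show "b \<in> set (fst (pass D (merge (snd q) bl) L))"
        using Cons.prems True by (simp add: pass_Cons Let_def)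
      fix c x y assume c: "c \<in> set (merge (snd q) bl)" "x \<in> vset c" "y \<in> vset c"
      consider "c \<in> set bl" | "c = union_vec (snd q) (filter (meets (snd q)) bl)"
        using c by (auto simp: merge_def)
      then show "(x, y) \<in> reach E U"
      proof cases
        case 1 then show ?thesis using Cons.prems(3) c by blast
      next
        case 2
        then have "vset c = \<Union> (vset ` {b \<in> set bl. meets (snd q) b})"
          using vset_merge_hd(2)[of n bl "snd q"] Cons.prems by simp
        then obtain a a' where a: "a \<in> set bl" "meets (snd q) a" "x \<in> vset a"
          "a' \<in> set bl" "meets (snd q) a'" "y \<in> vset a'" using c by auto
        then obtain w w' where w: "w \<in> vset (snd q)" "w \<in> vset a" "w' \<in> vset (snd q)" "w' \<in> vset a'"
          by (auto simp: meets_iff)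
        have "(x, w) \<in> reach E U" "(w', y) \<in> reach E U" using Cons.prems(3) a w by blast+
        moreover have "(w, w') \<in> reach E U" using q[of w w'] a w by blast
        ultimately show ?thesis using reach_trans by metis
      qed
    next
      fix i x y
      assume "i < length L" "snd (pass D (merge (snd q) bl) L) ! i"
        "x \<in> vset (snd (L ! i)) \<inter> \<Union> (vset ` set (merge (snd q) bl))"
        "y \<in> vset (snd (L ! i)) \<inter> \<Union> (vset ` set (merge (snd q) bl))"
      then show "(x, y) \<in> reach E U"
        using Cons.prems(4)[of "Suc i" x y] True unfolding U by (simp add: pass_Cons Let_def)
    qed (use Cons.prems in auto)
  next
    case False
    show ?thesis
    proof (rule Cons.IH)
      fix i x y
      assume "i < length L" "snd (pass D bl L) ! i"
        "x \<in> vset (snd (L ! i)) \<inter> \<Union> (vset ` set bl)"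
        "y \<in> vset (snd (L ! i)) \<inter> \<Union> (vset ` set bl)"
      then show "(x, y) \<in> reach E U"
        using Cons.prems(4)[of "Suc i" x y] False by (simp add: pass_Cons Let_def)
    qed (use Cons.prems False in \<open>auto simp: pass_Cons Let_def\<close>)
  qed
qed auto

end

section \<open>Representatives up to domination\<close>

abbreviation seen_vec :: "bool list list \<Rightarrow> bool \<times> bool list \<Rightarrow> bool list" where
  "seen_vec bl p \<equiv> map (meets (snd p)) bl"

text \<open>A vector is recorded only if no recorded one dominates it; in particular it is new, so
  the recorded list is distinct and its length counts the representatives.\<close>

lemma reps_props:
  "length (snd (reps bl L)) = length L \<and> length (ones (snd (reps bl L))) = length (fst (reps bl L)) \<and>
   distinct (fst (reps bl L)) \<and>
   (\<forall>c\<in>set (fst (reps bl L)). \<exists>j<length L. snd (reps bl L) ! j \<and> fst (L ! j) \<and> c = seen_vec bl (L ! j)) \<and>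
   (\<forall>i<length L. fst (L ! i) \<longrightarrow> (\<exists>c\<in>set (fst (reps bl L)). sub_vec (seen_vec bl (L ! i)) c))"
proof (induction L rule: rev_induct)
  case Nil
  then show ?case by (simp add: reps_def ones_def)
next
  case (snoc p L)
  have eq: "reps bl (L @ [p]) = reps_step bl (reps bl L) p" by (simp add: reps_def)
  have refl: "sub_vec c c" for c by (simp add: sub_vec_iff)
  obtain cl sel where R: "reps bl L = (cl, sel)" by fastforce
  have len: "length sel = length L" using snoc R by simp
  have old: "\<exists>j<length (L @ [p]). (sel @ [b]) ! j \<and> fst ((L @ [p]) ! j) \<and> c = seen_vec bl ((L @ [p]) ! j)"
    if c: "c \<in> set cl" for c b
  proof -
    obtain j where "j < length L" "sel ! j" "fst (L ! j)" "c = seen_vec bl (L ! j)"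
      using snoc c R by auto
    then show ?thesis using len by (intro exI[of _ j]) (auto simp: nth_append)
  qed
  show ?case
  proof (cases "fst p \<and> \<not> list_ex (sub_vec (seen_vec bl p)) cl")
    case True
    then have new: "seen_vec bl p \<notin> set cl" using refl by (auto simp: list_ex_iff)
    have "\<exists>j<length (L @ [p]). (sel @ [True]) ! j \<and> fst ((L @ [p]) ! j) \<and>
        seen_vec bl p = seen_vec bl ((L @ [p]) ! j)"
      using len True by (intro exI[of _ "length L"]) (auto simp: nth_append)
    then show ?thesis
      using True snoc new old[of _ True] refl unfolding eq R
      by (auto simp: reps_step_def Let_def nth_append less_Suc_eq ones_def)
  next
    case False
    then show ?thesis
      using snoc old[of _ False] unfolding eq R
      by (auto simp: reps_step_def Let_def nth_append less_Suc_eq ones_def list_ex_iff)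
  qed
qed

section \<open>Adjacency matrices\<close>

definition mat_adj :: "bool list list \<Rightarrow> nat \<Rightarrow> nat \<Rightarrow> bool" where
  "mat_adj A i j \<longleftrightarrow> i < length A \<and> j < length A \<and> A ! i ! j"

definition mat_cvc :: "bool list list \<Rightarrow> nat set \<Rightarrow> bool" where
  "mat_cvc A = cvc {..<length A} (mat_adj A)"

definition adj_mat :: "bool list list \<Rightarrow> bool" where
  "adj_mat A \<longleftrightarrow> (\<forall>i<length A. length (A ! i) = length A) \<and>
     (\<forall>i<length A. \<not> A ! i ! i \<and> (\<forall>j<length A. A ! i ! j \<longrightarrow> A ! j ! i))"

lemma filter_le_1_eq:
  assumes "length (filter P xs) \<le> 1" "a \<in> set xs" "b \<in> set xs" "P a" "P b"
  shows "a = b"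
proof -
  have "a \<in> set (filter P xs)" "b \<in> set (filter P xs)" using assms by auto
  then show ?thesis using assms(1) by (cases "filter P xs") auto
qed

lemma bij_idxs: "bij_betw ((!) (idxs m)) {..<card (vset m)} (vset m)"
  by (rule bij_betw_nth) (auto simp: length_idxs)

lemma submat_props:
  assumes A: "adj_mat A" and W: "length W = length A"
  shows "length (submat W A) = card (vset W)"
    and "adj_mat (submat W A)"
    and "\<And>i j. i < card (vset W) \<Longrightarrow> j < card (vset W) \<Longrightarrow>
      submat W A ! i ! j = A ! (idxs W ! i) ! (idxs W ! j)"
proof -
  have idx: "idxs W ! i < length A" if "i < card (vset W)" for i
    using that W by (metis length_idxs nth_mem set_idxs vset_less)
  show len: "length (submat W A) = card (vset W)"
    using W by (simp add: submat_def length_compress)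
  have row: "submat W A ! i = map ((!) (A ! (idxs W ! i))) (idxs W)" if "i < card (vset W)" for i
    using that idx[OF that] A W by (simp add: submat_def compress_conv length_idxs adj_mat_def)
  show entry: "submat W A ! i ! j = A ! (idxs W ! i) ! (idxs W ! j)"
    if "i < card (vset W)" "j < card (vset W)" for i j
    using that by (simp add: row length_idxs)
  show "adj_mat (submat W A)"
    unfolding adj_mat_def len using A idx by (auto simp: entry row length_idxs adj_mat_def)
qed

lemma submat_cvc:
  assumes A: "adj_mat A" and W: "length W = length A" and T: "T \<subseteq> {..<card (vset W)}"
  shows "mat_cvc (submat W A) T \<longleftrightarrow> cvc (vset W) (mat_adj A) ((!) (idxs W) ` T)"
proof -
  note P = submat_props[OF A W]
  have idx: "idxs W ! i < length A" if "i < card (vset W)" for i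
    using that W by (metis length_idxs nth_mem set_idxs vset_less)
  have im: "(!) (idxs W) ` {..<card (vset W)} = vset W"
    using bij_idxs by (rule bij_betw_imp_surj_on)
  have "cvc ((!) (idxs W) ` {..<card (vset W)}) (mat_adj A) ((!) (idxs W) ` T) \<longleftrightarrow>
      cvc {..<card (vset W)} (mat_adj (submat W A)) T"
    by (rule cvc_image[OF bij_betw_imp_inj_on[OF bij_idxs] _ T])
      (use idx in \<open>auto simp: mat_adj_def P(1) P(3)\<close>)
  then show ?thesis unfolding im mat_cvc_def P(1) by simp
qed

section \<open>Components and connecting vertices\<close>

locale adj_matrix =
  fixes A :: "bool list list"
  assumes A: "adj_mat A"
begin

abbreviation n where "n \<equiv> length A"
abbreviation E where "E \<equiv> mat_adj A"

lemma symp_E: "symp E"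
  using A by (auto simp: symp_def mat_adj_def adj_mat_def)

lemma E_sym: "E i j \<Longrightarrow> E j i"
  using symp_E by (auto simp: symp_def)

lemma E_less: "E i j \<Longrightarrow> i < n" "E i j \<Longrightarrow> j < n"
  by (auto simp: mat_adj_def)

lemma length_row: "i < n \<Longrightarrow> length (A ! i) = n"
  using A by (simp add: adj_mat_def)

lemma vset_row: "i < n \<Longrightarrow> vset (A ! i) = {j. E i j}"
  using A by (auto simp: vset_def mat_adj_def adj_mat_def)

lemma zip_rows: "length X = n \<Longrightarrow> p \<in> set (zip X A) \<Longrightarrow> length (snd p) = n"
  using length_row by (auto simp: set_zip)

context
  fixes X :: "bool list" assumes X: "length X = n"
begin

lemma vset_X_less: "vset X \<subseteq> {..<n}"
  using vset_less[of _ X] X by auto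

lemma singletons_Union: "\<Union> (vset ` set (compress X (idmat X))) = vset X"
proof -
  have "vset ` set (compress X (idmat X)) = set (map vset (compress X (idmat X)))" by simp
  then show ?thesis unfolding compress_idmat by auto
qed

lemma singletons_conn:
  assumes "b \<in> set (compress X (idmat X))" "x \<in> vset b" "y \<in> vset b"
  shows "(x, y) \<in> reach R U"
proof -
  have "vset b \<in> set (map vset (compress X (idmat X)))" using assms by simp
  then show ?thesis unfolding compress_idmat using assms by auto
qed

lemma comps_props:
  shows "partial_partition n (comps A X)" and "\<Union> (vset ` set (comps A X)) = vset X"
    and "\<And>b x y. b \<in> set (comps A X) \<Longrightarrow> x \<in> vset b \<Longrightarrow> y \<in> vset X \<Longrightarrow> E x y \<Longrightarrow> y \<in> vset b"
    and "\<And>b x y. b \<in> set (comps A X) \<Longrightarrow> x \<in> vset b \<Longrightarrow> y \<in> vset b \<Longrightarrow> (x, y) \<in> reach E (vset X)"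
proof -
  define L where "L = zip X (map (\<lambda>p. vor (fst p) (snd p)) (zip A (idmat X)))"
  let ?bl = "compress X (idmat X)"
  interpret pass_ctx n "[True]" by unfold_locales simp
  have comps: "comps A X = fst (pass [True] ?bl L)" by (simp add: comps_def L_def)
  have len: "length L = n" using X idmat[of X] by (simp add: L_def)
  have row: "fst (L ! i) = X ! i" "length (snd (L ! i)) = n" "vset (snd (L ! i)) = insert i {j. E i j}"
    if "i < n" for i
    using that X idmat[of X] length_row[OF that] vset_row[OF that]
    by (auto simp: L_def vset_vor)
  have rows: "\<forall>p\<in>set L. length (snd p) = n" using row(2) len by (metis in_set_conv_nth)
  have pp: "partial_partition n ?bl" using partial_partition_singletons[of X] X by simp
  show P: "partial_partition n (comps A X)" and U: "\<Union> (vset ` set (comps A X)) = vset X"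
    using pass_partition[OF pp rows] singletons_Union by (auto simp: comps)
  show "y \<in> vset b" if b: "b \<in> set (comps A X)" "x \<in> vset b" "y \<in> vset X" "E x y" for b x y
  proof -
    obtain b' where b': "b' \<in> set (comps A X)" "y \<in> vset b'" using U b by blast
    have xX: "x \<in> vset X" using U b by blast
    then have x: "x < n" "X ! x" using vset_X_less by (auto simp: vset_def)
    \<comment> \<open>After a pass with threshold 1 the closed neighbourhood of \<open>x\<close>
      meets at most one blob, yet it meets that of \<open>x\<close> and that of the neighbour
      \<open>y\<close>.\<close>
    then have "L ! x \<in> set L" "fst (L ! x)" using row(1) len by auto
    from pass_few[OF pp rows this] have "length (filter (meets (snd (L ! x))) (comps A X)) \<le> 1"
      by (simp add: comps)
    moreover have "meets (snd (L ! x)) b" "meets (snd (L ! x)) b'"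
      using b b' row(3)[OF x(1)] by (auto simp: meets_iff)
    ultimately have "b = b'" using filter_le_1_eq b b' by metis
    then show ?thesis using b' by simp
  qed
  show "(x, y) \<in> reach E (vset X)" if b: "b \<in> set (comps A X)" "x \<in> vset b" "y \<in> vset b" for b x y
  proof (rule pass_connected[OF pp rows singletons_conn _ b[unfolded comps]])
    fix i x y
    assume i: "i < length L" "snd (pass [True] ?bl L) ! i"
      and xy: "x \<in> vset (snd (L ! i)) \<inter> \<Union> (vset ` set ?bl)" "y \<in> vset (snd (L ! i)) \<inter> \<Union> (vset ` set ?bl)"
    have "X ! i" using pass_selected[OF pp rows i] row(1) i len by simp
    then have iX: "i \<in> vset X" using i len X by (simp add: vset_def)
    \<comment> \<open>Whatever the selected vertex \<open>i\<close> sees is \<open>i\<close> itself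
      or adjacent to it, and \<open>i\<close> belongs to \<open>X\<close>.\<close>
    have "(w, i) \<in> reach E (vset X) \<and> (i, w) \<in> reach E (vset X)"
      if "w \<in> vset (snd (L ! i)) \<inter> \<Union> (vset ` set ?bl)" for w
    proof (cases "w = i")
      case False
      then have "E i w" "w \<in> vset X" using that row(3)[of i] i len singletons_Union by auto
      then show ?thesis using iX E_sym by (auto intro!: reach_edge)
    qed simp
    then show "(x, y) \<in> reach E (vset X)" using xy reach_trans by metis
  qed
qed

text \<open>After the pass with threshold 2, vertices outside \<open>X\<close> see at most one blob,
  so the criterion for connected blobs applies. Each connector lowers the number of blobs by at
  least one.\<close>

lemma connect_props:
  assumes cover: "\<And>u v. E u v \<Longrightarrow> u \<in> vset X \<or> v \<in> vset X"
    and nonisol: "\<And>x. x \<in> vset X \<Longrightarrow> \<exists>v. E x v" and T: "mat_cvc A T"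
  shows "mat_cvc A (vset (connect A X))"
    and "card (vset (connect A X)) \<le> card (vset X) + length (comps A X)"
proof -
  define L where "L = zip (map Not X) A"
  let ?D = "[True, True]" and ?bl = "comps A X"
  interpret pass_ctx n ?D by unfold_locales simp
  define bl where "bl = fst (pass ?D ?bl L)"
  define C where "C = vset (snd (pass ?D ?bl L))"
  have len: "length L = n" using X by (simp add: L_def)
  have row: "fst (L ! i) = (\<not> X ! i)" "snd (L ! i) = A ! i" if "i < n" for i
    using that X by (auto simp: L_def)
  have rows: "\<forall>p\<in>set L. length (snd p) = n"
    using zip_rows[of "map Not X"] X by (simp add: L_def)
  note pp = comps_props(1)
  have P: "partial_partition n bl" and U: "\<Union> (vset ` set bl) = vset X"
    using pass_partition[OF pp rows] comps_props(2) by (auto simp: bl_def)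
  have lenP: "length (snd (pass ?D ?bl L)) = n" using len by simp
  have connect: "vset (connect A X) = vset X \<union> C"
    using X lenP vset_vor[of X "snd (pass ?D ?bl L)"] by (simp add: connect_def C_def L_def)
  have C: "c < n \<and> c \<notin> vset X \<and> (\<exists>x\<in>vset X. E c x)" if "c \<in> C" for c
  proof -
    have c: "c < length L" "snd (pass ?D ?bl L) ! c" "c < n" using that lenP len by (auto simp: C_def vset_def)
    from pass_selected[OF pp rows c(1,2)] show ?thesis
      using row[OF c(3)] vset_row[OF c(3)] comps_props(2) c(3) by (auto simp: vset_def)
  qed
  have "cvc {..<n} E (vset X \<union> C)"
  proof (rule cvc_of_connected_blobs[OF symp_E T[unfolded mat_cvc_def], where \<B> = "vset ` set bl"])
    show "vset X \<subseteq> {..<n}" by (rule vset_X_less)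
    show "C \<subseteq> {..<n}" using C by auto
    show "u \<in> vset X \<or> v \<in> vset X" if "E u v" for u v using cover that .
    show "\<exists>v\<in>{..<n}. E x v" if "x \<in> vset X" for x using nonisol[OF that] E_less by auto
    show "\<exists>b\<in>vset ` set bl. x \<in> b" if "x \<in> vset X" for x using U that by blast
    show "b \<subseteq> vset X" if "b \<in> vset ` set bl" for b using U that by blast
    show "\<exists>x\<in>vset X. E c x" if "c \<in> C" for c using C[OF that] by blast
  next
    fix b x y assume "b \<in> vset ` set bl" "x \<in> b" "y \<in> b"
    then obtain b' where b': "b' \<in> set (fst (pass ?D ?bl L))" "x \<in> vset b'" "y \<in> vset b'"
      by (auto simp: bl_def)
    show "(x, y) \<in> reach E (vset X \<union> C)"
    proof (rule pass_connected[OF pp rows _ _ b'])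
      show "(x, y) \<in> reach E (vset X \<union> C)" if "b \<in> set ?bl" "x \<in> vset b" "y \<in> vset b" for b x y
        by (rule reach_mono[OF _ comps_props(4)[OF that]]) simp
      fix i x y
      assume i: "i < length L" "snd (pass ?D ?bl L) ! i"
        and xy: "x \<in> vset (snd (L ! i)) \<inter> \<Union> (vset ` set ?bl)" "y \<in> vset (snd (L ! i)) \<inter> \<Union> (vset ` set ?bl)"
      have "i \<in> C" using i lenP len by (simp add: C_def vset_def)
      moreover have "E i x" "E i y" "x \<in> vset X" "y \<in> vset X"
        using xy row(2)[of i] vset_row[of i] i len comps_props(2) by auto
      ultimately have "(x, i) \<in> reach E (vset X \<union> C)" "(i, y) \<in> reach E (vset X \<union> C)"
        using E_sym by (auto intro!: reach_edge)
      then show "(x, y) \<in> reach E (vset X \<union> C)" by (rule reach_trans)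
    qed
  next
    fix b x y assume "b \<in> vset ` set bl" "x \<in> b" "y \<in> vset X" "E x y"
    then obtain b' where b': "b' \<in> set bl" "b = vset b'" "x \<in> vset b'" by blast
    have "x \<in> vset X" using b' U by blast
    then obtain c where c: "c \<in> set ?bl" "x \<in> vset c" unfolding comps_props(2)[symmetric] by auto
    then have "y \<in> vset c" using comps_props(3) \<open>y \<in> vset X\<close> \<open>E x y\<close> by blast
    \<comment> \<open>Each component lies inside one blob of the coarser partition, so closedness
      under adjacency within \<open>X\<close> carries over.\<close>
    moreover obtain c' where "c' \<in> set bl" "vset c \<subseteq> vset c'"
      using pass_coarsens[OF pp rows c(1)] by (auto simp: bl_def)
    moreover from this have "c' = b'" using partial_partition_disjoint[OF P] b' c by blast
    ultimately show "y \<in> b" using b' by blast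
  next
    fix v b b' x y
    assume v: "v \<in> {..<n}" "v \<notin> vset X" and "b \<in> vset ` set bl" "b' \<in> vset ` set bl"
      and "x \<in> b" "y \<in> b'" "E v x" "E v y"
    then obtain c c' where c: "c \<in> set bl" "c' \<in> set bl" "b = vset c" "b' = vset c'" by blast
    have "L ! v \<in> set L" "fst (L ! v)" using v row(1) len X by (auto simp: vset_def)
    from pass_few[OF pp rows this] have "length (filter (meets (A ! v)) bl) \<le> 1"
      using v row(2) by (simp add: bl_def)
    moreover have "meets (A ! v) c" "meets (A ! v) c'"
      using c v vset_row[of v] \<open>x \<in> b\<close> \<open>y \<in> b'\<close> \<open>E v x\<close> \<open>E v y\<close> by (auto simp: meets_iff)
    ultimately show "b = b'" using c filter_le_1_eq by metis
  qed
  then show "mat_cvc A (vset (connect A X))" unfolding mat_cvc_def connect .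
  have "card C \<le> length ?bl"
    using pass_count[of ?D ?bl L] by (simp add: C_def card_vset)
  then show "card (vset (connect A X)) \<le> card (vset X) + length ?bl"
    unfolding connect using card_Un_le[of "vset X" C] by linarith
qed

lemma length_connect: "length (connect A X) = n"
  using X by (simp add: connect_def)

end

lemma nonisolated_props:
  assumes "length X = n"
  shows "length (nonisolated A X) = n"
    and "vset (nonisolated A X) = {x \<in> vset X. \<exists>v\<in>{..<n}. E x v}"
proof -
  show len: "length (nonisolated A X) = n" using assms by (simp add: nonisolated_def)
  have "list_ex (\<lambda>b. b) (A ! i) \<longleftrightarrow> (\<exists>v\<in>{..<n}. E i v)" if "i < n" for i
    using that length_row[OF that] by (auto simp: list_ex_length mat_adj_def)
  then show "vset (nonisolated A X) = {x \<in> vset X. \<exists>v\<in>{..<n}. E x v}"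
    using assms by (auto simp: vset_def nonisolated_def)
qed

end

section \<open>The kernel\<close>

lemma vset_inject: "length u = length v \<Longrightarrow> vset u = vset v \<Longrightarrow> u = v"
  by (auto simp: vset_def set_eq_iff list_eq_iff_nth_eq)

text \<open>The blobs start from the rows of \<open>idmat X\<close>, while the facts on singletons
  speak of the identity matrix of the mask itself.\<close>

lemma idmat_cong: "length xs = length ys \<Longrightarrow> idmat xs = idmat ys"
  using idmat[of xs] idmat[of ys] by (auto simp: list_eq_iff_nth_eq[of "idmat xs"] intro!: vset_inject)

context adj_matrix
begin

context
  fixes X :: "bool list" assumes X: "length X = n"
begin

lemma marks_props:
  shows "length (marks A X) = n" and "vset X \<subseteq> vset (marks A X)"
    and "card (vset (marks A X)) \<le> card (vset X) + card (vset X) * (card (vset X) + 1)"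
    and "\<And>x. x \<in> vset X \<Longrightarrow> {v. E x v} \<subseteq> vset (marks A X) \<or>
      card (vset X) < card {v \<in> vset (marks A X). E x v}"
proof -
  let ?N = "card (vset X)"
  define cap where "cap x = expand (A ! x) (True # ones X)" for x
  have cap: "length (cap x) = n" "vset (cap x) \<subseteq> {v. E x v}"
    "card (vset (cap x)) = min (?N + 1) (card {v. E x v})" if "x < n" for x
    using length_row[OF that] vset_row[OF that] vset_expand_subset[of "A ! x" "True # ones X"]
      card_vset_expand_ones[of "True # ones X" "A ! x"]
    by (auto simp: cap_def card_vset ones_def list_all_iff)
  have caps: "map (\<lambda>r. expand r (True # ones X)) (compress X A) = map cap (idxs X)"
    using X by (simp add: compress_conv cap_def comp_def)
  have idx: "x < n" if "x \<in> vset X" for x using vset_less[OF that] X by simp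
  have U: "length (union_vec X (map cap (idxs X))) = n"
    "vset (union_vec X (map cap (idxs X))) = (\<Union>x\<in>vset X. vset (cap x))"
    using union_vec[of "map cap (idxs X)" X] cap idx X by auto
  show "length (marks A X) = n" using U X by (simp add: marks_def caps)
  have F: "vset (marks A X) = vset X \<union> (\<Union>x\<in>vset X. vset (cap x))"
    using U X by (simp add: marks_def caps vset_vor)
  then show "vset X \<subseteq> vset (marks A X)" by blast
  have "card (\<Union>x\<in>vset X. vset (cap x)) \<le> (\<Sum>x\<in>vset X. card (vset (cap x)))"
    by (rule card_UN_le) simp
  also have "\<dots> \<le> (\<Sum>x\<in>vset X. ?N + 1)" by (rule sum_mono) (use cap idx in auto)
  finally have "card (\<Union>x\<in>vset X. vset (cap x)) \<le> ?N * (?N + 1)" by simp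
  then show "card (vset (marks A X)) \<le> ?N + ?N * (?N + 1)"
    unfolding F using card_Un_le[of "vset X" "\<Union>x\<in>vset X. vset (cap x)"] by linarith
  show "{v. E x v} \<subseteq> vset (marks A X) \<or> ?N < card {v \<in> vset (marks A X). E x v}" if x: "x \<in> vset X" for x
  proof (cases "card {v. E x v} \<le> ?N + 1")
    case True
    have "finite {v. E x v}" by (rule finite_subset[of _ "{..<n}"]) (auto simp: mat_adj_def)
    then have "vset (cap x) = {v. E x v}"
      using cap[OF idx[OF x]] True by (intro card_subset_eq) auto
    moreover have "vset (cap x) \<subseteq> vset (marks A X)" unfolding F using x by blast
    ultimately show ?thesis by simp
  next
    case False
    then have "card (vset (cap x)) = ?N + 1" using cap[OF idx[OF x]] by simp
    moreover have "vset (cap x) \<subseteq> {v \<in> vset (marks A X). E x v}"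
      unfolding F using x cap(2)[OF idx[OF x]] by auto
    then have "card (vset (cap x)) \<le> card {v \<in> vset (marks A X). E x v}"
      by (rule card_mono[rotated]) simp
    ultimately show ?thesis by simp
  qed
qed

lemma boundary_props:
  assumes F: "length F = n"
  shows "length (boundary A X F) = n"
    and "vset (boundary A X F) = {x \<in> vset X. \<not> {v. E x v} \<subseteq> vset F}"
proof -
  show "length (boundary A X F) = n" using X by (simp add: boundary_def)
  have "sub_vec (A ! i) F \<longleftrightarrow> {v. E i v} \<subseteq> vset F" if "i < n" for i
    using sub_vec_iff[of "A ! i" F] length_row[OF that] vset_row[OF that] F by simp
  then have "boundary A X F ! i \<longleftrightarrow> X ! i \<and> \<not> {v. E i v} \<subseteq> vset F" if "i < n" for i
    using that X by (simp add: boundary_def)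
  moreover have "length (boundary A X F) = n" using X by (simp add: boundary_def)
  ultimately show "vset (boundary A X F) = {x \<in> vset X. \<not> {v. E x v} \<subseteq> vset F}"
    using X unfolding vset_def[of "boundary A X F"] vset_def[of X] by auto
qed

context
  fixes D :: "bool list" assumes D: "2 \<le> length D"
begin

text \<open>The parts of the kernel mask: marked vertices \<open>F\<close>, boundary
  \<open>B\<close>, rows \<open>L\<close> flagged outside \<open>F\<close>, blobs \<open>bl\<close>,
  merging vertices \<open>M\<close>, representatives \<open>R\<close>.\<close>

definition "F \<equiv> marks A X"
definition "B \<equiv> boundary A X F"
definition "L \<equiv> zip (map Not F) A"
definition "bl \<equiv> fst (blobs D A X F)"
definition "M \<equiv> snd (blobs D A X F)"
definition "R \<equiv> snd (reps bl L)"
definition "W \<equiv> kernel_mask D A X"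

lemma F_props:
  "length F = n" "vset X \<subseteq> vset F" "vset F \<subseteq> {..<n}"
  "card (vset F) \<le> card (vset X) + card (vset X) * (card (vset X) + 1)"
  "x \<in> vset X \<Longrightarrow> {v. E x v} \<subseteq> vset F \<or> card (vset X) < card {v \<in> vset F. E x v}"
  unfolding F_def using marks_props vset_less[of _ "marks A X"] by auto

lemma B_props: "length B = n" "vset B = {x \<in> vset X. \<not> {v. E x v} \<subseteq> vset F}"
  unfolding B_def using boundary_props[OF F_props(1)] by auto

lemma L_props:
  "length L = n" "i < n \<Longrightarrow> L ! i = (\<not> F ! i, A ! i)" "\<forall>p\<in>set L. length (snd p) = n"
  using F_props(1) zip_rows[of "map Not F"] by (auto simp: L_def)

lemma pass_eq: "pass D (compress B (idmat B)) L = (bl, M)"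
proof -
  have "idmat B = idmat X" using B_props X by (intro idmat_cong) simp
  then show ?thesis by (simp add: bl_def M_def blobs_def L_def B_def)
qed

lemma pass_ctx: "pass_ctx D"
  using D by unfold_locales simp

lemma partition_B: "partial_partition n (compress B (idmat B))"
  using partial_partition_singletons[of B] B_props(1) by simp

lemma bl_props: "partial_partition n bl" "\<Union> (vset ` set bl) = vset B"
  using pass_ctx.pass_partition[OF pass_ctx partition_B L_props(3)] singletons_Union[OF B_props(1)]
  by (auto simp: pass_eq)

lemma length_MR: "length M = n" "length R = n"
  using length_snd_pass[of D "compress B (idmat B)" L] reps_props[of bl L] L_props(1)
  by (auto simp: pass_eq R_def)

lemma length_W: "length W = n"
  using length_MR F_props(1) by (simp add: W_def kernel_mask_def Let_def F_def M_def R_def bl_def L_def)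

lemma vset_W: "vset W = vset F \<union> vset M \<union> vset R"
  using length_MR F_props(1)
  by (simp add: W_def kernel_mask_def Let_def F_def[symmetric] M_def[symmetric] R_def[symmetric]
    bl_def[symmetric] L_def[symmetric] vset_vor Un_assoc)

lemma length_singletons: "length (compress B (idmat B)) = card (vset B)"
  using idmat[of B] by (simp add: length_compress)

lemma bl_count: "length bl + (length D - 1) * card (vset M) \<le> card (vset B)"
  using pass_count[of D "compress B (idmat B)" L] D
  by (simp add: pass_eq card_vset[of M] length_singletons)

lemma card_B: "card (vset B) \<le> card (vset X)"
  by (rule card_mono) (auto simp: B_props(2))

lemma seen_vec_few:
  assumes "i < n" "i \<notin> vset F"
  shows "card (vset (seen_vec bl (L ! i))) \<le> length D - 1"
proof -
  have "L ! i \<in> set L" by (rule nth_mem) (use assms L_props in simp)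
  moreover have "fst (L ! i)" using assms L_props F_props(1) by (simp add: vset_def)
  ultimately have "L ! i \<in> set L" "fst (L ! i)" by blast+
  from pass_ctx.pass_few[OF pass_ctx partition_B L_props(3) this]
  have "length (filter (meets (snd (L ! i))) bl) \<le> length D - 1" using D by (simp add: pass_eq)
  moreover have "length (ones (map f xs)) = length (filter f xs)" for f and xs :: "bool list list"
    by (simp add: ones_def filter_map comp_def)
  ultimately show ?thesis by (simp add: card_vset)
qed

text \<open>Representatives have distinct vectors over at most |X| blobs, each with fewer than
  \<open>length D\<close> ones because of the preceding pass; the binomial sum counts such
  vectors.\<close>

lemma card_R: "card (vset R) \<le> (\<Sum>j\<le>length D - 1. card (vset X) choose j)"
proof -
  have props: "length (ones R) = length (fst (reps bl L))" "distinct (fst (reps bl L))"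
    "\<forall>c\<in>set (fst (reps bl L)). \<exists>j<length L. R ! j \<and> fst (L ! j) \<and> c = seen_vec bl (L ! j)"
    using reps_props[of bl L] by (auto simp: R_def)
  have m: "length bl \<le> card (vset X)" using bl_count card_B by linarith
  have "card (vset R) = card (set (fst (reps bl L)))"
    using props distinct_card by (metis card_vset)
  also have "\<dots> \<le> card {c :: bool list. length c = length bl \<and> card (vset c) \<le> length D - 1}"
  proof (rule card_mono)
    show "finite {c :: bool list. length c = length bl \<and> card (vset c) \<le> length D - 1}"
      by (rule finite_subset[OF _ finite_lists_length_eq[of UNIV "length bl"]]) auto
    show "set (fst (reps bl L)) \<subseteq> {c. length c = length bl \<and> card (vset c) \<le> length D - 1}"
    proof
      fix c assume "c \<in> set (fst (reps bl L))"
      then obtain j where j: "j < n" "fst (L ! j)" "c = seen_vec bl (L ! j)"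
        using props(3) L_props(1) by auto
      then have "j \<notin> vset F" using L_props(2) by (auto simp: vset_def)
      then show "c \<in> {c. length c = length bl \<and> card (vset c) \<le> length D - 1}"
        using seen_vec_few[OF j(1)] j(3) by simp
    qed
  qed
  also have "\<dots> \<le> (\<Sum>j\<le>length D - 1. card (vset X) choose j)" by (rule card_few_ones[OF m])
  finally show ?thesis .
qed

lemma card_kernel:
  "card (vset W) \<le> card (vset X) + card (vset X) * (card (vset X) + 1) + card (vset X) +
    (\<Sum>j\<le>length D - 1. card (vset X) choose j)"
proof -
  have "card (vset M) \<le> (length D - 1) * card (vset M)" using D by (cases "length D - 1") auto
  then have "card (vset M) \<le> card (vset X)" using bl_count card_B by linarith
  moreover have "card (vset W) \<le> card (vset F) + card (vset M) + card (vset R)"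
    unfolding vset_W using card_Un_le[of "vset F \<union> vset M" "vset R"] card_Un_le[of "vset F" "vset M"]
    by linarith
  ultimately show ?thesis using F_props(4) card_R by linarith
qed

context
  assumes cover: "\<And>u v. E u v \<Longrightarrow> u \<in> vset X \<or> v \<in> vset X"
begin

lemma deg_W: "x \<in> vset X \<Longrightarrow> {v \<in> {..<n}. E x v} \<subseteq> vset W \<or> card (vset X) < card {v \<in> vset W. E x v}"
proof -
  assume x: "x \<in> vset X"
  have "card {v \<in> vset F. E x v} \<le> card {v \<in> vset W. E x v}"
    by (rule card_mono) (auto simp: vset_W)
  then show ?thesis using F_props(5)[OF x] vset_W by fastforce
qed

lemma W_less: "vset W \<subseteq> {..<n}"
  using vset_less[of _ W] length_W by auto

lemma kernel_sound:
  assumes T: "mat_cvc (submat W A) T" and "card T \<le> card (vset X)"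
  shows "mat_cvc A ((!) (idxs W) ` T) \<and> card ((!) (idxs W) ` T) = card T"
proof -
  have sub: "T \<subseteq> {..<card (vset W)}"
    using T submat_props(1)[OF A length_W] by (simp add: mat_cvc_def cvc_def)
  then have card: "card ((!) (idxs W) ` T) = card T"
    by (intro card_image inj_on_subset[OF bij_betw_imp_inj_on[OF bij_idxs]])
  have T': "cvc (vset W) E ((!) (idxs W) ` T)"
    using submat_cvc[OF A length_W sub] T by simp
  have "cvc {..<n} E ((!) (idxs W) ` T)"
  proof (rule cvc_of_induced[where X = "vset X" and N = "card (vset X)", OF _ symp_E _ W_less])
    show "u \<in> vset X \<or> v \<in> vset X" if "E u v" for u v using cover that .
    show "vset X \<subseteq> vset W" using vset_W F_props(2) by blast
  qed (use assms card deg_W T' in auto)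
  then show ?thesis using card by (simp add: mat_cvc_def)
qed

text \<open>Only \<open>M\<close> costs anything. Each of its vertices uses up
  \<open>length D - 1\<close> of the initial |B| blobs, and \<open>B\<close> lies in
  \<open>T\<close>, so (d - 1) |M| \<le> |T| with d = \<open>length D\<close>.\<close>

lemma kernel_complete:
  assumes T: "mat_cvc A T" and le: "card T \<le> card (vset X)"
  shows "\<exists>T'. mat_cvc (submat W A) T' \<and> (length D - 1) * card T' \<le> length D * card T"
proof -
  have TV: "cvc {..<n} E T" using T by (simp add: mat_cvc_def)
  have BX: "vset B \<subseteq> vset X" using B_props by blast
  have XF: "vset X \<subseteq> {..<n}" using F_props by blast
  have BT: "vset B \<subseteq> T"
  proof (rule high_degree_subset_cvc[OF _ _ _ TV le])
    fix x assume x: "x \<in> vset B"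
    have "card {v \<in> vset F. E x v} \<le> card {v \<in> {..<n}. E x v}"
      by (rule card_mono) (use F_props(3) in auto)
    then show "card (vset X) < card {v \<in> {..<n}. E x v}"
      using x B_props(2) F_props(5)[of x] by fastforce
  qed (use BX XF in auto)
  have M_sel: "i < n \<and> i \<notin> vset F \<and> (\<exists>x\<in>vset B. E i x)" if "i \<in> vset M" for i
  proof -
    have i: "i < length L" "snd (pass D (compress B (idmat B)) L) ! i"
      using that length_MR L_props(1) by (auto simp: vset_def pass_eq)
    from pass_ctx.pass_selected[OF pass_ctx partition_B L_props(3) i] show ?thesis
      using i L_props singletons_Union[OF B_props(1)] vset_row[of i] by (auto simp: vset_def[of F])
  qed
  have "\<exists>T'. cvc (vset W) E T' \<and> card T' \<le> card T + card (vset M)"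
  proof (rule induced_cvc_exists[where \<B> = "vset ` set bl" and F = "vset F", OF _ symp_E F_props(2) _ W_less _ BX _ _ _ _ _ _ _ TV BT])
    show "vset F \<subseteq> vset W" "vset M \<subseteq> vset W" using vset_W by auto
    show "u \<in> vset X \<or> v \<in> vset X" if "E u v" for u v using cover that .
    show "x \<in> vset B" if "x \<in> vset X" "v \<in> {..<n}" "E x v" "v \<notin> vset F" for x v
      using that B_props(2) by blast
    show "\<exists>b\<in>vset ` set bl. x \<in> b" if "x \<in> vset B" for x using bl_props that by blast
    show "b \<subseteq> vset B" if "b \<in> vset ` set bl" for b using bl_props that by blast
    show "\<exists>x\<in>vset B. E m x" if "m \<in> vset M" for m using M_sel[OF that] by blast
  next
    fix b x y assume "b \<in> vset ` set bl" "x \<in> b" "y \<in> b"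
    then obtain b' where b': "b' \<in> set (fst (pass D (compress B (idmat B)) L))" "x \<in> vset b'" "y \<in> vset b'"
      by (auto simp: pass_eq)
    show "(x, y) \<in> reach E (vset B \<union> vset M)"
    proof (rule pass_ctx.pass_connected[OF pass_ctx partition_B L_props(3) singletons_conn[OF B_props(1)] _ b'])
      fix i x y
      assume i: "i < length L" "snd (pass D (compress B (idmat B)) L) ! i"
        and xy: "x \<in> vset (snd (L ! i)) \<inter> \<Union> (vset ` set (compress B (idmat B)))"
          "y \<in> vset (snd (L ! i)) \<inter> \<Union> (vset ` set (compress B (idmat B)))"
      have "i \<in> vset M" using i length_MR L_props(1) by (simp add: pass_eq vset_def)
      moreover have "E i x" "E i y" "x \<in> vset B" "y \<in> vset B"
        using xy L_props vset_row[of i] i singletons_Union[OF B_props(1)] by auto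
      ultimately have "(x, i) \<in> reach E (vset B \<union> vset M)" "(i, y) \<in> reach E (vset B \<union> vset M)"
        using E_sym by (auto intro!: reach_edge)
      then show "(x, y) \<in> reach E (vset B \<union> vset M)" by (rule reach_trans)
    qed
  next
    fix v assume v: "v \<in> {..<n}" "v \<notin> vset W"
    then have "v < length L" "fst (L ! v)" using L_props F_props(1) vset_W by (auto simp: vset_def)
    then obtain j where j: "j < length L" "R ! j" "sub_vec (seen_vec bl (L ! v)) (seen_vec bl (L ! j))"
      using reps_props[of bl L] unfolding R_def by metis
    have "j \<in> vset W" using j length_MR L_props(1) vset_W by (auto simp: vset_def)
    moreover have "(\<exists>x\<in>b. E v x) \<longrightarrow> (\<exists>x\<in>b. E j x)" if b: "b \<in> vset ` set bl" for b
    proof -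
      obtain i where i: "i < length bl" "b = vset (bl ! i)" using b by (metis imageE in_set_conv_nth)
      have "meets (A ! v) (bl ! i) \<longrightarrow> meets (A ! j) (bl ! i)"
        using j i L_props v by (auto simp: sub_vec_iff vset_def subset_iff)
      then show ?thesis using i j L_props v vset_row[of v] vset_row[of j] by (auto simp: meets_iff)
    qed
    ultimately show "\<exists>w\<in>vset W. \<forall>b\<in>vset ` set bl. (\<exists>x\<in>b. E v x) \<longrightarrow> (\<exists>x\<in>b. E w x)" by blast
  qed simp
  then obtain T1 where T1: "cvc (vset W) E T1" "card T1 \<le> card T + card (vset M)" by blast
  \<comment> \<open>Back from vertices of the whole graph to row numbers of the submatrix.\<close>
  define T' where "T' = {i. i < card (vset W) \<and> idxs W ! i \<in> T1}"
  have sub: "T' \<subseteq> {..<card (vset W)}" by (auto simp: T'_def)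
  have "T1 \<subseteq> vset W" using T1 by (simp add: cvc_def)
  then have im: "(!) (idxs W) ` T' = T1"
    using bij_betw_imp_surj_on[OF bij_idxs[of W]] by (fastforce simp: T'_def)
  have card: "card T' = card T1"
    unfolding im[symmetric]
    by (rule card_image[symmetric]) (rule inj_on_subset[OF bij_betw_imp_inj_on[OF bij_idxs] sub])
  have "mat_cvc (submat W A) T'"
    using submat_cvc[OF A length_W sub] im T1 by simp
  moreover have "(length D - 1) * card T' \<le> length D * card T"
  proof -
    have "finite T" using TV finite_subset unfolding cvc_def by blast
    then have "card (vset B) \<le> card T" using BT card_mono by blast
    then have "(length D - 1) * card (vset M) \<le> card T" using bl_count by linarith
    moreover have "(length D - 1) * card T' \<le> (length D - 1) * card T + (length D - 1) * card (vset M)"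
      using T1(2) card by (metis add_mult_distrib2 mult_le_mono2)
    moreover have "(length D - 1) * card T + card T = length D * card T"
      using D by (metis One_nat_def Suc_1 Suc_leD add.commute le_add_diff_inverse mult_Suc plus_1_eq_Suc)
    ultimately show ?thesis by linarith
  qed
  ultimately show ?thesis by blast
qed

end

end

end

end

section \<open>The contracted graph\<close>

lemma contract_props:
  assumes A: "adj_mat A" and S: "length S = length A"
  defines "m \<equiv> map Not S" and "C \<equiv> contract A S"
  shows "length C = card (vset m) + 1" and "adj_mat C"
    and "\<not> C ! 0 ! 0"
    and "\<And>i j. i < card (vset m) \<Longrightarrow> j < card (vset m) \<Longrightarrow>
      C ! Suc i ! Suc j = A ! (idxs m ! i) ! (idxs m ! j)"
    and "\<And>i. i < card (vset m) \<Longrightarrow> C ! 0 ! Suc i \<longleftrightarrow> meets (A ! (idxs m ! i)) S"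
    and "\<And>i. i < card (vset m) \<Longrightarrow> C ! Suc i ! 0 \<longleftrightarrow> meets (A ! (idxs m ! i)) S"
proof -
  let ?p = "card (vset m)"
  have m: "length m = length A" using S by (simp add: m_def)
  have idx: "idxs m ! i < length A" if "i < ?p" for i
    using that m by (metis length_idxs nth_mem set_idxs vset_less)
  define z where "z = compress m (map (\<lambda>r. meets r S) A)"
  have C: "C = (False # z) # map (\<lambda>p. fst p # snd p) (zip z (submat m A))"
    by (simp add: C_def contract_def m_def z_def Let_def)
  have z: "length z = ?p" "\<And>i. i < ?p \<Longrightarrow> z ! i = meets (A ! (idxs m ! i)) S"
    using m idx by (auto simp: z_def compress_conv length_idxs)
  note sm = submat_props[OF A m]
  show len: "length C = ?p + 1" using z sm by (simp add: C)
  show 0: "\<not> C ! 0 ! 0" by (simp add: C)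
  show 1: "C ! Suc i ! Suc j = A ! (idxs m ! i) ! (idxs m ! j)" if "i < ?p" "j < ?p" for i j
    using that z sm by (simp add: C)
  show 2: "C ! 0 ! Suc i \<longleftrightarrow> meets (A ! (idxs m ! i)) S" if "i < ?p" for i using that z by (simp add: C)
  show 3: "C ! Suc i ! 0 \<longleftrightarrow> meets (A ! (idxs m ! i)) S" if "i < ?p" for i
    using that z sm by (simp add: C)
  have smrow: "length (submat m A ! k) = ?p" if "k < ?p" for k
    using sm(1,2) that unfolding adj_mat_def by simp
  have row: "length (C ! i) = ?p + 1" if "i < ?p + 1" for i
  proof (cases i)
    case (Suc k)
    then show ?thesis using that z(1) sm(1) smrow[of k] by (simp add: C)
  qed (simp add: C z(1))
  show "adj_mat C"
    unfolding adj_mat_def len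
  proof (intro conjI allI impI)
    fix i j assume i: "i < ?p + 1"
    show "length (C ! i) = ?p + 1" using row[OF i] .
    show "\<not> C ! i ! i"
    proof (cases i)
      case (Suc k)
      then have "k < ?p" using i by simp
      then show ?thesis using 1[of k k] A idx[of k] Suc by (simp add: adj_mat_def)
    qed (use 0 in simp)
    assume j: "j < ?p + 1" and Cij: "C ! i ! j"
    consider "i = 0" "j = 0" | k where "i = 0" "j = Suc k" "k < ?p" | k where "i = Suc k" "j = 0" "k < ?p"
      | k l where "i = Suc k" "j = Suc l" "k < ?p" "l < ?p"
      using i j by (cases i; cases j) auto
    then show "C ! j ! i"
    proof cases
      case 4
      then show ?thesis using Cij 1[of k l] 1[of l k] A idx[of k] idx[of l] by (simp add: adj_mat_def)
    qed (use Cij 0 2 3 in auto)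
  qed
qed

context adj_matrix
begin

context
  fixes S :: "bool list" assumes S: "length S = n"
begin

definition "m \<equiv> map Not S"
text \<open>The successor leaves index 0 to the contracted vertex.\<close>

definition "pos v \<equiv> Suc (inv_into {..<card (vset m)} ((!) (idxs m)) v)"

lemma vset_m: "vset m = {..<n} - vset S"
  using S by (auto simp: m_def vset_def)

lemma pos_idxs: "i < card (vset m) \<Longrightarrow> pos (idxs m ! i) = Suc i"
  by (simp add: pos_def bij_betw_imp_inj_on[OF bij_idxs])

lemma idxs_ex: "v \<in> {..<n} - vset S \<Longrightarrow> \<exists>i<card (vset m). v = idxs m ! i"
  by (metis in_set_conv_nth length_idxs set_idxs vset_m)

lemma pos_image: "pos ` ({..<n} - vset S) = Suc ` {..<card (vset m)}"
proof -
  have "(!) (idxs m) ` {..<card (vset m)} = {..<n} - vset S"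
    using bij_betw_imp_surj_on[OF bij_idxs[of m]] vset_m by simp
  then have "pos ` ({..<n} - vset S) = (\<lambda>i. pos (idxs m ! i)) ` {..<card (vset m)}"
    by (metis image_image)
  also have "\<dots> = Suc ` {..<card (vset m)}" by (rule image_cong) (auto simp: pos_idxs)
  finally show ?thesis .
qed

lemma contraction: "contraction {..<n} (vset S) E (mat_adj (contract A S)) 0 pos"
proof
  note C = contract_props[OF A S, folded m_def]
  have idx: "idxs m ! i < n" if "i < card (vset m)" for i
    using that vset_m by (metis DiffD1 length_idxs lessThan_iff nth_mem set_idxs)
  have meets: "meets (A ! v) S \<longleftrightarrow> (\<exists>s\<in>vset S. E v s)" if "v < n" for v
    using vset_row[OF that] by (auto simp: meets_iff)
  show "finite {..<n}" by simp
  show "vset S \<subseteq> {..<n}" using vset_less[of _ S] S by auto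
  show "symp E" by (rule symp_E)
  show "inj_on pos ({..<n} - vset S)"
    by (rule inj_onI) (metis Suc_inject idxs_ex pos_idxs)
  show "0 \<notin> pos ` ({..<n} - vset S)" unfolding pos_image by simp
  show "mat_adj (contract A S) (pos u) (pos v) \<longleftrightarrow> E u v"
    if u: "u \<in> {..<n} - vset S" and v: "v \<in> {..<n} - vset S" for u v
  proof -
    obtain i j where "i < card (vset m)" "u = idxs m ! i" "j < card (vset m)" "v = idxs m ! j"
      using idxs_ex[OF u] idxs_ex[OF v] by blast
    then show ?thesis using C idx by (simp add: pos_idxs mat_adj_def)
  qed
  show "mat_adj (contract A S) 0 (pos v) \<longleftrightarrow> (\<exists>s\<in>vset S. E v s)"
    "mat_adj (contract A S) (pos v) 0 \<longleftrightarrow> (\<exists>s\<in>vset S. E v s)"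
    if v: "v \<in> {..<n} - vset S" for v
  proof -
    obtain i where "i < card (vset m)" "v = idxs m ! i" using idxs_ex[OF v] by blast
    then show "mat_adj (contract A S) 0 (pos v) \<longleftrightarrow> (\<exists>s\<in>vset S. E v s)"
      "mat_adj (contract A S) (pos v) 0 \<longleftrightarrow> (\<exists>s\<in>vset S. E v s)"
      using C idx meets by (simp_all add: pos_idxs mat_adj_def)
  qed
  show "\<not> mat_adj (contract A S) 0 0" using C by (simp add: mat_adj_def)
qed

lemma contract_verts: "{..<length (contract A S)} = insert 0 (pos ` ({..<n} - vset S))"
  unfolding pos_image using contract_props(1)[OF A S] by (simp add: m_def lessThan_Suc_eq_insert_0)

lemma contract_complete:
  "mat_cvc A T \<Longrightarrow> \<exists>T'. mat_cvc (contract A S) T' \<and> card T' \<le> card T"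
  using contraction.contracted_cvc[OF contraction] unfolding mat_cvc_def contract_verts .

text \<open>The expanded cover has at most |Y| + |S| vertices and |S| + 1 components, each paid for
  by at most one connector. The solution \<open>T\<close> guarantees that connectors exist.\<close>

lemma approx_cover_props:
  assumes S2: "2 \<le> card (vset S)" and Y: "length Y = length (contract A S)"
  shows "length (approx_cover A S Y) = n"
    and "mat_cvc A T \<Longrightarrow> mat_cvc (contract A S) (vset Y) \<Longrightarrow>
      mat_cvc A (vset (approx_cover A S Y)) \<and>
      card (vset (approx_cover A S Y)) \<le> card (vset Y) + 2 * card (vset S) + 1"
proof -
  define X where "X = nonisolated A (vor S (expand m (tl Y)))"
  have ac: "approx_cover A S Y = connect A X"
    using S2 by (simp add: approx_cover_def X_def m_def card_vset)
  have len0: "length (vor S (expand m (tl Y))) = n" using S by (simp add: m_def)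
  have lenX: "length X = n" unfolding X_def by (rule nonisolated_props(1)[OF len0])
  then show "length (approx_cover A S Y) = n" unfolding ac by (rule length_connect)
  have lenY: "length (tl Y) = card (vset m)" using Y contract_props(1)[OF A S] by (simp add: m_def)
  have "vset (expand m (tl Y)) = {v \<in> {..<n} - vset S. pos v \<in> vset Y}"
  proof -
    \<comment> \<open>Bit 0 of \<open>Y\<close> belongs to the contracted vertex, so the tail is
      shifted by one.\<close>
    have mem: "Suc i \<in> vset Y \<longleftrightarrow> i \<in> vset (tl Y)" for i
      using Y contract_props(1)[OF A S] by (cases Y) auto
    have "i \<in> vset (tl Y) \<Longrightarrow> i < card (vset m)" for i using vset_less lenY by metis
    moreover have "idxs m ! i \<in> {..<n} - vset S" if "i < card (vset m)" for i
      using that vset_m by (metis length_idxs nth_mem set_idxs)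
    ultimately show ?thesis
      unfolding vset_expand[OF lenY] using mem pos_idxs idxs_ex by (auto simp: image_iff) metis+
  qed
  then have vX: "vset X = {x \<in> vset S \<union> {v \<in> {..<n} - vset S. pos v \<in> vset Y}. \<exists>v\<in>{..<n}. E x v}"
    unfolding X_def nonisolated_props(2)[OF len0] using S by (simp add: vset_vor m_def)
  assume T: "mat_cvc A T" and Yc: "mat_cvc (contract A S) (vset Y)"
  have Ycvc: "cvc (insert 0 (pos ` ({..<n} - vset S))) (mat_adj (contract A S)) (vset Y)"
    using Yc unfolding mat_cvc_def contract_verts .
  note con = contraction.expanded_vertex_cover[OF contraction Ycvc, folded vX]
    contraction.card_expanded[OF contraction Ycvc, folded vX]
    contraction.card_closed_blobs[OF contraction Ycvc, folded vX]
  have cover: "u \<in> vset X \<or> v \<in> vset X" if "E u v" for u v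
    using con(1)[of u v] that E_less by auto
  have nonisol: "\<exists>v. E x v" if "x \<in> vset X" for x using that vX by blast
  note cp = comps_props[OF lenX]
  have "length (comps A X) = card (vset ` set (comps A X))"
    using partial_partition_distinct[OF cp(1)] by (metis distinct_card length_map set_map)
  also have "\<dots> \<le> card (vset S) + 1"
  proof (rule con(3))
    show "b \<subseteq> vset X" if "b \<in> vset ` set (comps A X)" for b using that cp(2) by blast
    show "b \<noteq> {}" if "b \<in> vset ` set (comps A X)" for b using that cp(1) by (auto simp: partial_partition_def)
    show "b = b'" if "b \<in> vset ` set (comps A X)" "b' \<in> vset ` set (comps A X)" "b \<inter> b' \<noteq> {}" for b b'
      using that partial_partition_disjoint[OF cp(1)] by blast
    show "y \<in> b" if "b \<in> vset ` set (comps A X)" "x \<in> b" "y \<in> vset X" "E x y" for b x y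
      using that cp(3) by blast
  qed
  finally show "mat_cvc A (vset (approx_cover A S Y)) \<and>
      card (vset (approx_cover A S Y)) \<le> card (vset Y) + 2 * card (vset S) + 1"
    using connect_props[OF lenX cover nonisol T] con(2) unfolding ac by auto
qed

end

end

section \<open>Graphs and their matrices\<close>

definition vec_of :: "nat \<Rightarrow> nat set \<Rightarrow> bool list" where
  "vec_of n X = map (\<lambda>i. i \<in> X) [0..<n]"

definition mat_of :: "graph \<Rightarrow> bool list list" where
  "mat_of G = map (\<lambda>i. vec_of (card (verts G)) {j. {i, j} \<in> edges G}) [0..<card (verts G)]"

definition graph_of :: "bool list list \<Rightarrow> graph" where
  "graph_of A = \<lparr>verts = {..<length A}, edges = {{i, j} |i j. mat_adj A i j}\<rparr>"

text \<open>The encodings of the problems are instances of \<open>encode\<close>, so the closure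
  rules speak directly about programs on instances.\<close>

lemma enc_vset_encode: "enc_vset G X = encode (vec_of (card (verts G)) X)"
  by (simp add: enc_vset_def vec_of_def encode_list_def encode_bool_def comp_def)

lemma enc_graph_encode: "enc_graph G = encode (mat_of G)"
  by (simp add: enc_graph_def mat_of_def enc_vset_encode encode_list_def comp_def)

lemma length_vec_of [simp]: "length (vec_of n X) = n"
  by (simp add: vec_of_def)

lemma length_mat_of [simp]: "length (mat_of G) = card (verts G)"
  by (simp add: mat_of_def)

lemma vset_vec_of: "X \<subseteq> {..<n} \<Longrightarrow> vset (vec_of n X) = X"
  by (auto simp: vset_def vec_of_def)

lemma vec_of_vset: "length v = n \<Longrightarrow> vec_of n (vset v) = v"
  by (auto simp: vset_def vec_of_def list_eq_iff_nth_eq)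

text \<open>Holds although \<open>encode\<close> may identify list elements, and is enough to read
  off the number of vertices from an encoded kernel.\<close>

lemma encode_eq_length: "encode xs = encode ys \<Longrightarrow> length xs = length ys"
proof (induction xs arbitrary: ys)
  case Nil
  then show ?case by (cases ys) auto
next
  case (Cons x xs)
  then show ?case by (cases ys) auto
qed

lemma numbered_edge:
  assumes "numbered_graph G" "{i, j} \<in> edges G"
  shows "i < card (verts G)" "j < card (verts G)" "i \<noteq> j"
proof -
  have "\<forall>e\<in>edges G. e \<subseteq> verts G \<and> card e = 2"
    using assms(1) unfolding numbered_graph_def simple_graph_def by simp
  then have "{i, j} \<subseteq> verts G" "card {i, j} = 2" using assms(2) by auto
  moreover have verts: "\<And>x. x \<in> verts G \<Longrightarrow> x < card (verts G)"
    using assms(1) unfolding numbered_graph_def by blast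
  ultimately show "i < card (verts G)" "j < card (verts G)" "i \<noteq> j"
    using verts by (auto simp: card_insert_if split: if_splits)
qed

lemma mat_adj_mat_of:
  assumes "numbered_graph G"
  shows "mat_adj (mat_of G) = (\<lambda>i j. {i, j} \<in> edges G)"
  using numbered_edge[OF assms] by (auto simp: fun_eq_iff mat_adj_def mat_of_def vec_of_def)

lemma adj_mat_mat_of:
  assumes "numbered_graph G"
  shows "adj_mat (mat_of G)"
proof -
  have "{i} \<notin> edges G" for i using numbered_edge(3)[OF assms, of i i] by auto
  then show ?thesis by (auto simp: adj_mat_def mat_of_def vec_of_def insert_commute)
qed

lemma graph_of_edge:
  assumes "adj_mat A" shows "{i, j} \<in> edges (graph_of A) \<longleftrightarrow> mat_adj A i j"
  using adj_matrix.E_sym[of A] assms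
  by (auto simp: graph_of_def doubleton_eq_iff adj_matrix_def)

lemma numbered_graph_of:
  assumes A: "adj_mat A" shows "numbered_graph (graph_of A)"
proof -
  have "card e = 2 \<and> e \<subseteq> {..<length A}" if "e \<in> edges (graph_of A)" for e
    using that A by (auto simp: graph_of_def mat_adj_def adj_mat_def card_insert_if)
  then show ?thesis by (auto simp: numbered_graph_def simple_graph_def graph_of_def)
qed

lemma mat_of_graph_of:
  assumes A: "adj_mat A" shows "mat_of (graph_of A) = A"
proof (rule nth_equalityI)
  have card: "card (verts (graph_of A)) = length A" by (simp add: graph_of_def)
  then show "length (mat_of (graph_of A)) = length A" by simp
  fix i assume "i < length (mat_of (graph_of A))"
  then have i: "i < length A" using card by simp
  show "mat_of (graph_of A) ! i = A ! i"
  proof (rule nth_equalityI)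
    show "length (mat_of (graph_of A) ! i) = length (A ! i)"
      using i A card by (simp add: mat_of_def adj_mat_def)
    fix j assume "j < length (mat_of (graph_of A) ! i)"
    then have j: "j < length A" using i card by (simp add: mat_of_def)
    then show "mat_of (graph_of A) ! i ! j = A ! i ! j"
      using i card graph_of_edge[OF A, of i j] by (simp add: mat_of_def vec_of_def mat_adj_def)
  qed
qed

lemma verts_numbered: "numbered_graph G \<Longrightarrow> verts G = {..<card (verts G)}"
  by (simp add: numbered_graph_def)

lemma connected_vertex_cover_iff:
  assumes G: "numbered_graph G"
  shows "connected_vertex_cover G X \<longleftrightarrow> mat_cvc (mat_of G) X"
proof -
  let ?E = "\<lambda>i j. {i, j} \<in> edges G"
  have edges: "\<exists>u v. e = {u, v} \<and> u \<in> verts G \<and> v \<in> verts G" if "e \<in> edges G" for e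
    using G that unfolding numbered_graph_def simple_graph_def by (metis card_2_iff insert_subset)
  have 1: "(\<forall>e\<in>edges G. e \<inter> X \<noteq> {}) \<longleftrightarrow> (\<forall>u\<in>verts G. \<forall>v\<in>verts G. ?E u v \<longrightarrow> u \<in> X \<or> v \<in> X)"
  proof
    assume *: "\<forall>e\<in>edges G. e \<inter> X \<noteq> {}"
    show "\<forall>u\<in>verts G. \<forall>v\<in>verts G. ?E u v \<longrightarrow> u \<in> X \<or> v \<in> X" using * by fastforce
  next
    assume *: "\<forall>u\<in>verts G. \<forall>v\<in>verts G. ?E u v \<longrightarrow> u \<in> X \<or> v \<in> X"
    show "\<forall>e\<in>edges G. e \<inter> X \<noteq> {}"
    proof
      fix e assume e: "e \<in> edges G"
      then obtain u v where "e = {u, v}" "u \<in> verts G" "v \<in> verts G" using edges by blast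
      then show "e \<inter> X \<noteq> {}" using * e by blast
    qed
  qed
  have 2: "connected_graph (induced G X) \<longleftrightarrow> (\<forall>u\<in>X. \<forall>v\<in>X. (u, v) \<in> reach ?E X)" if "X \<subseteq> verts G"
  proof -
    have rel: "{(x, y). {x, y} \<in> edges (induced G X)} = {(x, y). x \<in> X \<and> y \<in> X \<and> ?E x y}"
      by (auto simp: induced_def)
    have "verts (induced G X) = X" using that by (auto simp: induced_def)
    then show ?thesis unfolding connected_graph_def reach_def rel by simp
  qed
  show ?thesis
    unfolding connected_vertex_cover_def vertex_cover_def mat_cvc_def cvc_def mat_adj_mat_of[OF G]
      length_mat_of verts_numbered[OF G, symmetric] 1
    by (cases "X \<subseteq> verts G") (simp_all only: 2 simp_thms)
qed

section \<open>Ratios\<close>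

definition cvc_opt :: "graph \<Rightarrow> ennreal" where
  "cvc_opt G = (INF s\<in>Pow (verts G). cvc_cost G s)"

text \<open>Both problems have the same candidates and costs on a graph, so one ratio serves
  both.\<close>

definition cvc_ratio :: "graph \<Rightarrow> nat set \<Rightarrow> ennreal" where
  "cvc_ratio G s = (if cvc_cost G s = cvc_opt G then 1 else cvc_cost G s / cvc_opt G)"

lemma ratio_CVC_on: "ratio (CVC_on \<H>) G s = cvc_ratio G s"
  by (simp add: ratio_def CVC_on_def opt_def cvc_ratio_def cvc_opt_def)

lemma ratio_CVC_deletion: "ratio (CVC_deletion \<G>) (G, S) s = cvc_ratio G s"
  by (simp add: ratio_def CVC_deletion_def opt_def cvc_ratio_def cvc_opt_def)

lemma cvc_opt_le: "s \<subseteq> verts G \<Longrightarrow> cvc_opt G \<le> cvc_cost G s"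
  unfolding cvc_opt_def by (rule INF_lower) simp

lemma cvc_ratio_ge_1:
  assumes "s \<subseteq> verts G" shows "1 \<le> cvc_ratio G s"
proof (cases "cvc_cost G s = cvc_opt G")
  case False
  then have lt: "cvc_opt G < cvc_cost G s" using cvc_opt_le[OF assms] by simp
  show ?thesis
  proof (cases "cvc_opt G = 0")
    case True
    then show ?thesis using lt False by (simp add: cvc_ratio_def ennreal_divide_zero)
  next
    case ne: False
    have "cvc_opt G \<noteq> top" using lt by auto
    then have "1 = cvc_opt G / cvc_opt G" using ne by (simp add: ennreal_divide_self top.not_eq_extremum)
    also have "\<dots> \<le> cvc_cost G s / cvc_opt G" using lt by (intro divide_right_mono_ennreal) simp
    finally show ?thesis using False by (simp add: cvc_ratio_def)
  qed
qed (simp add: cvc_ratio_def)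

lemma cvc_ratio_infeasible:
  assumes "\<And>T. \<not> connected_vertex_cover G T" shows "cvc_ratio G s = 1"
proof -
  have "cvc_cost G s = \<infinity>" for s using assms by (simp add: cvc_cost_def)
  then have "cvc_opt G = \<infinity>" by (simp add: cvc_opt_def)
  then show ?thesis using \<open>cvc_cost G s = \<infinity>\<close> by (simp add: cvc_ratio_def)
qed

text \<open>A set that attains the optimum replaces the infimum in the extended reals by a natural
  number.\<close>

definition min_cvc :: "graph \<Rightarrow> nat set \<Rightarrow> bool" where
  "min_cvc G T \<longleftrightarrow> connected_vertex_cover G T \<and>
     (\<forall>T'. connected_vertex_cover G T' \<longrightarrow> card T \<le> card T')"

lemma min_cvc_exists:
  assumes "connected_vertex_cover G T0" shows "\<exists>T. min_cvc G T"
  using ex_has_least_nat[of "connected_vertex_cover G" T0 card, OF assms] unfolding min_cvc_def by blast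

lemma cvc_opt_min:
  assumes "min_cvc G T" shows "cvc_opt G = of_nat (card T)"
proof (rule antisym)
  have "T \<subseteq> verts G" using assms by (simp add: min_cvc_def connected_vertex_cover_def vertex_cover_def)
  then show "cvc_opt G \<le> of_nat (card T)"
    using cvc_opt_le[of T G] assms by (simp add: cvc_cost_def min_cvc_def)
  show "of_nat (card T) \<le> cvc_opt G"
    unfolding cvc_opt_def
    by (rule INF_greatest) (use assms in \<open>auto simp: cvc_cost_def min_cvc_def\<close>)
qed

lemma ennreal_of_nat_divide:
  "0 < b \<Longrightarrow> of_nat a / of_nat b = ennreal (real a / real b)"
  by (simp add: ennreal_of_nat_eq_real_of_nat divide_ennreal)

lemma cvc_ratio_eq:
  assumes "min_cvc G T" "connected_vertex_cover G s" "0 < card T"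
  shows "cvc_ratio G s = ennreal (real (card s) / real (card T))"
  using assms cvc_opt_min[OF assms(1)] ennreal_of_nat_divide[of "card T" "card s"]
  by (auto simp: cvc_ratio_def cvc_cost_def)

lemma cvc_ratio_leI:
  assumes T: "min_cvc G T" and s: "connected_vertex_cover G s" and "1 \<le> \<beta>"
    and le: "real (card s) \<le> \<beta> * real (card T)"
  shows "cvc_ratio G s \<le> ennreal \<beta>"
proof (cases "card T = 0")
  case True
  then have "cvc_cost G s = cvc_opt G" using le s cvc_opt_min[OF T] by (simp add: cvc_cost_def)
  then show ?thesis using \<open>1 \<le> \<beta>\<close> by (simp add: cvc_ratio_def)
next
  case False
  then have "real (card s) / real (card T) \<le> \<beta>" using le by (simp add: divide_le_eq)
  then show ?thesis using cvc_ratio_eq[OF T s] False by (simp add: ennreal_leI)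
qed

text \<open>Against a finite optimum, an infeasible set has ratio infinity, and so has one of
  positive cost if the optimum is 0; a finite ratio excludes both.\<close>

lemma cvc_ratio_leD:
  assumes T: "min_cvc G T" and le: "cvc_ratio G s \<le> ennreal \<beta>" and "1 \<le> \<beta>"
  shows "connected_vertex_cover G s \<and> real (card s) \<le> \<beta> * real (card T)"
proof -
  have s: "connected_vertex_cover G s"
  proof (rule ccontr)
    assume "\<not> connected_vertex_cover G s"
    then have "cvc_ratio G s = top"
      using cvc_opt_min[OF T] by (simp add: cvc_ratio_def cvc_cost_def ennreal_top_divide)
    then show False using le by (metis ennreal_neq_top top.extremum_uniqueI)
  qed
  show ?thesis
  proof (cases "card T = 0")
    case True
    have "card s = 0"
    proof (rule ccontr)
      assume "card s \<noteq> 0"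
      then have "cvc_ratio G s = top"
        using True s cvc_opt_min[OF T] by (simp add: cvc_ratio_def cvc_cost_def ennreal_divide_zero)
      then show False using le by (metis ennreal_neq_top top.extremum_uniqueI)
    qed
    then show ?thesis using s True by simp
  next
    case False
    then have "ennreal (real (card s) / real (card T)) \<le> ennreal \<beta>" using cvc_ratio_eq[OF T s] le by simp
    then have "real (card s) / real (card T) \<le> \<beta>" using \<open>1 \<le> \<beta>\<close> by (subst (asm) ennreal_le_iff) auto
    then show ?thesis using s False by (simp add: divide_le_eq)
  qed
qed

text \<open>With r the ratio of \<open>s'\<close>, the chain is |s| \<le> |s'| \<le> r |T'| \<le> r
  \<alpha> |T|. An infinite ratio leaves nothing to show, and a finite one makes \<open>s'\<close>
  feasible.\<close>

lemma cvc_ratio_transfer: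
  assumes T: "min_cvc G T" and s: "connected_vertex_cover G s"
    and T': "min_cvc G' T'" and s': "connected_vertex_cover G' s' \<Longrightarrow> card s \<le> card s'"
    and sub: "s' \<subseteq> verts G'" and "1 \<le> \<alpha>" and le: "real (card T') \<le> \<alpha> * real (card T)"
  shows "cvc_ratio G s \<le> ennreal \<alpha> * cvc_ratio G' s'"
proof (cases "cvc_ratio G' s' = top")
  case True
  then show ?thesis using \<open>1 \<le> \<alpha>\<close> by (simp add: ennreal_mult_top)
next
  case False
  then obtain r where r: "cvc_ratio G' s' = ennreal r" "0 \<le> r" by (cases "cvc_ratio G' s'") auto
  have r1: "1 \<le> r" using cvc_ratio_ge_1[OF sub] r by (simp add: ennreal_le_iff flip: ennreal_1)
  have *: "connected_vertex_cover G' s'" "real (card s') \<le> r * real (card T')"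
    using cvc_ratio_leD[OF T' _ r1, of s'] r by auto
  have "real (card s) \<le> r * real (card T')" using s'[OF *(1)] *(2) by linarith
  also have "\<dots> \<le> r * (\<alpha> * real (card T))" using le r(2) by (rule mult_left_mono)
  finally have "real (card s) \<le> (\<alpha> * r) * real (card T)" by (simp add: ac_simps)
  moreover have "1 \<le> \<alpha> * r" using \<open>1 \<le> \<alpha>\<close> r1 by (metis mult_le_one mult_mono' mult_1 order_trans zero_le_one)
  ultimately have "cvc_ratio G s \<le> ennreal (\<alpha> * r)" using cvc_ratio_leI[OF T s] by blast
  then show ?thesis using r \<open>1 \<le> \<alpha>\<close> by (simp add: ennreal_mult)
qed

section \<open>The size of the kernel\<close>

text \<open>Weighting the j-th term by x ^ j with x = 1/k costs a factor of at most k ^ q and allows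
  completion to (1 + x) ^ N by the binomial theorem, which is at most e ^ (N / k) \<le> e ^ d. So
  \<open>d\<close> contributes only a constant to the power \<open>d\<close>.\<close>

lemma sum_choose_le:
  fixes k N d :: nat
  assumes k: "1 \<le> k" and N: "N \<le> d * k" and q: "q \<le> d"
  shows "real (\<Sum>j\<le>q. N choose j) \<le> real k ^ d * 4 ^ d"
proof -
  let ?x = "1 / real k"
  have x: "0 < ?x" "?x \<le> 1" using k by auto
  have "(\<Sum>j\<le>q. real (N choose j)) * ?x ^ q \<le> (\<Sum>j\<le>q. real (N choose j) * ?x ^ j)"
    unfolding sum_distrib_right
    by (intro sum_mono mult_left_mono power_decreasing) (use x in auto)
  \<comment> \<open>The detour over the maximum allows \<open>q\<close> to exceed \<open>N\<close>;
    terms beyond \<open>N\<close> vanish.\<close>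
  also have "\<dots> \<le> (\<Sum>j\<le>max q N. real (N choose j) * ?x ^ j)"
    by (rule sum_mono2) (use x in auto)
  also have "\<dots> = (\<Sum>j\<le>N. real (N choose j) * ?x ^ j)"
    by (rule sum.mono_neutral_right) (auto simp: binomial_eq_0)
  also have "\<dots> = (?x + 1) ^ N"
    using binomial_ring[of ?x 1 N] by (simp add: ac_simps)
  also have "\<dots> \<le> exp ?x ^ N"
    using exp_ge_add_one_self[of ?x] x by (intro power_mono) (auto simp: add.commute)
  also have "\<dots> = exp (real N * ?x)" by (rule exp_of_nat_mult[symmetric])
  also have "\<dots> \<le> exp (real d)"
  proof -
    have "real N \<le> real d * real k" using N by (metis of_nat_le_iff of_nat_mult)
    then show ?thesis using k by (simp add: divide_le_eq)
  qed
  also have "\<dots> = exp 1 ^ d" using exp_of_nat_mult[of d 1] by simp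
  also have "\<dots> \<le> 4 ^ d" using exp_le by (intro power_mono) auto
  finally have "real (\<Sum>j\<le>q. N choose j) * ?x ^ q \<le> 4 ^ d" by simp
  then have "real (\<Sum>j\<le>q. N choose j) \<le> real k ^ q * 4 ^ d"
    using k by (simp add: power_divide divide_le_eq mult.commute)
  also have "\<dots> \<le> real k ^ d * 4 ^ d"
    using k q by (intro mult_right_mono power_increasing) auto
  finally show ?thesis .
qed

text \<open>As k \<ge> 2, constants are paid for by powers of \<open>k\<close>: 4 \<le> k ^ 2 and d
  \<le> 2 ^ d \<le> k ^ d. The polynomial part is at most k ^ (6 d), the binomial sum at most k ^ (3
  d), and adding the two costs one more factor \<open>k\<close>.\<close>

lemma kernel_size_arith:
  fixes k N d :: nat
  assumes k: "2 \<le> k" and N: "N \<le> d * k" and d: "1 \<le> d"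
    and w: "w \<le> N + N * (N + 1) + N + (\<Sum>j\<le>d - 1. N choose j)"
  shows "w \<le> k ^ (7 * d)"
proof -
  have pow: "a \<le> b \<Longrightarrow> k ^ a \<le> k ^ b" for a b using k by (intro power_increasing) auto
  have "2 ^ d \<le> k ^ d" using k by (intro power_mono) auto
  then have "d \<le> k ^ d" using less_exp[of d] by linarith
  then have "N \<le> k ^ d * k" using N by (meson le_trans mult_le_mono1)
  then have Nk: "N \<le> k ^ (2 * d)" using pow[of "d + 1" "2 * d"] d by (simp add: mult.commute)
  have NN: "N * N \<le> k ^ (4 * d)" using mult_le_mono[OF Nk Nk] by (simp flip: power_add)
  have four: "4 \<le> k ^ (2 * d)"
  proof -
    have "2 ^ 2 \<le> k ^ 2" using k by (intro power_mono) auto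
    then show ?thesis using pow[of 2 "2 * d"] d by simp
  qed
  have "N + N * (N + 1) + N = N * N + 3 * N" by (simp add: algebra_simps)
  also have "\<dots> \<le> 4 * k ^ (4 * d)" using NN Nk pow[of "2 * d" "4 * d"] by linarith
  also have "\<dots> \<le> k ^ (2 * d) * k ^ (4 * d)" using four by simp
  finally have 1: "N + N * (N + 1) + N \<le> k ^ (6 * d)" by (simp flip: power_add)
  have "(4::real) ^ d = (2 ^ 2) ^ d" by simp
  also have "\<dots> \<le> (real k ^ 2) ^ d" using k by (intro power_mono) auto
  finally have "real (\<Sum>j\<le>d - 1. N choose j) \<le> real k ^ d * (real k ^ 2) ^ d"
    using sum_choose_le[of k N d "d - 1"] k N by (smt (verit) diff_le_self le_numeral_extra(4) mult_left_mono of_nat_0_le_iff one_le_numeral order_trans zero_le_power)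
  also have "\<dots> = real (k ^ (3 * d))" by (simp flip: power_mult power_add)
  finally have "(\<Sum>j\<le>d - 1. N choose j) \<le> k ^ (3 * d)" by (simp only: of_nat_le_iff)
  then have "w \<le> k ^ (6 * d) + k ^ (6 * d)" using w 1 pow[of "3 * d" "6 * d"] by linarith
  also have "\<dots> \<le> k * k ^ (6 * d)" using k by (simp flip: mult_2)
  also have "\<dots> \<le> k ^ (7 * d)" using pow[of "6 * d + 1" "7 * d"] d by simp
  finally show ?thesis .
qed

section \<open>Running times\<close>

definition scheme_run :: "prog \<Rightarrow> nat \<Rightarrow> nat \<Rightarrow> bool list list \<Rightarrow> bool list \<Rightarrow> bool" where
  "scheme_run P a c B Y \<longleftrightarrow>
     runs_within P (encode B) (encode Y) (a * enc_size B ^ c) \<and> length Y = length B"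

text \<open>The factor 7 leaves room for the input of the lifting algorithm: besides the instance, whose
  size is \<open>N\<close>, it contains a candidate with at most as many vertices.\<close>

definition computes_with ::
    "prog \<Rightarrow> prog \<Rightarrow> nat \<Rightarrow> nat \<Rightarrow> ('i::encodable \<Rightarrow> bool list list) \<Rightarrow>
      ('i \<Rightarrow> bool list \<Rightarrow> 'o::encodable) \<Rightarrow> (nat \<Rightarrow> nat) \<Rightarrow> bool" where
  "computes_with p P a c g f t \<longleftrightarrow> (\<forall>x Y N. scheme_run P a c (g x) Y \<longrightarrow> enc_size x \<le> 7 * N \<longrightarrow>
     runs_within p (encode x) (encode (f x Y)) (t N))"

text \<open>\<open>K\<close> is chosen before \<open>P\<close>, \<open>D\<close>, \<open>a\<close>
  and \<open>c\<close>. The threshold \<open>D\<close> is only a constant input and affects the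
  factor \<open>a'\<close>, so the degree depends on the scheme through \<open>c\<close> alone; this
  is the source of time efficiency.\<close>

lemma scheme_program:
  fixes g :: "'i::encodable \<Rightarrow> bool list list" and h :: "bool list \<times> ('i \<times> bool list) \<Rightarrow> 'o::encodable"
  assumes "polyt g" "polyt h"
  shows "\<exists>pg ph K. \<forall>P D a c. \<exists>a'.
    computes_with (Seq (Pair (const_prog (encode D)) (Pair Id (Seq pg P))) ph) P a c g
      (\<lambda>x Y. h (D, (x, Y))) (\<lambda>N. a' * N ^ (K * c + K))"
proof -
  obtain pg tg where pg: "poly_bounded tg" "\<And>x. runs_within pg (encode x) (encode (g x)) (tg x)"
    using assms(1) unfolding polyt_def by blast
  obtain ph th where ph: "poly_bounded th" "\<And>x. runs_within ph (encode x) (encode (h x)) (th x)"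
    using assms(2) unfolding polyt_def by blast
  obtain ag cg where g: "\<And>x. tg x \<le> ag * enc_size x ^ cg" using pg unfolding poly_bounded_def by blast
  obtain bg eg where gs: "\<And>x. enc_size (g x) \<le> bg * enc_size x ^ eg"
    using polyt_size[OF assms(1)] unfolding poly_bounded_def by blast
  obtain ah ch where h: "\<And>x. th x \<le> ah * enc_size x ^ ch" using ph unfolding poly_bounded_def by blast
  \<comment> \<open>\<open>q\<close> dominates the degrees of the time of \<open>g\<close>, of its
    output size, and of the input itself, which accounts for the 1.\<close>
  define q where "q = cg + eg + 1"
  define K where "K = q * (1 + ch)"
  have "\<exists>a'. computes_with (Seq (Pair (const_prog (encode D)) (Pair Id (Seq pg P))) ph) P a c g
      (\<lambda>x Y. h (D, (x, Y))) (\<lambda>N. a' * N ^ (K * c + K))" for P D a c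
  proof -
    define sD where "sD = enc_size D"
    define r where "r = sD + 4 * bg + 4"
    define b where "b = sD + 5 + ag + a * bg ^ c + ah * r ^ ch"
    define a' where "a' = b * (7 ^ q) ^ (1 + c + ch)"
    show ?thesis
      unfolding computes_with_def
    proof (rule exI[of _ a'], intro allI impI)
      fix x N and Y :: "bool list"
      assume "scheme_run P a c (g x) Y" and N: "enc_size x \<le> 7 * N"
      then have P: "runs_within P (encode (g x)) (encode Y) (a * enc_size (g x) ^ c)"
        and Y: "length Y = length (g x)" by (simp_all add: scheme_run_def)
      \<comment> \<open>Everything is measured in this number: computing \<open>g\<close> costs a
        multiple of \<open>M\<close>, the scheme of \<open>M ^ c\<close>, and \<open>h\<close> of
        \<open>M ^ ch\<close>; the exponent \<open>1 + c + ch\<close> covers all three.\<close>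
      define M where "M = (7 * N) ^ q"
      have N1: "1 \<le> N" using N enc_size_pos[of x] by linarith
      have le_M: "enc_size x ^ e \<le> M" if "e \<le> q" for e
      proof -
        have "enc_size x ^ e \<le> (7 * N) ^ e" using N by (rule power_mono) simp
        also have "\<dots> \<le> M" unfolding M_def using that N1 by (intro power_increasing) auto
        finally show ?thesis .
      qed
      have M1: "1 \<le> M" using N1 by (simp add: M_def)
      have xM: "enc_size x \<le> M" using le_M[of 1] by (simp add: q_def)
      have tg: "tg x \<le> ag * M"
      proof -
        have "enc_size x ^ cg \<le> M" by (rule le_M) (simp add: q_def)
        then show ?thesis using g[of x] by (meson le_trans mult_le_mono2)
      qed
      have gM: "enc_size (g x) \<le> bg * M"
      proof -
        have "enc_size x ^ eg \<le> M" by (rule le_M) (simp add: q_def)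
        then show ?thesis using gs[of x] by (meson le_trans mult_le_mono2)
      qed
      have tP: "a * enc_size (g x) ^ c \<le> a * bg ^ c * M ^ c"
        using power_mono[OF gM, of c] by (simp add: power_mult_distrib)
      have "enc_size Y \<le> 1 + 4 * (bg * M)"
        using enc_size_bool_list[of Y] Y length_le_enc_size[of "g x"] gM by linarith
      moreover have "sD + 3 \<le> (sD + 3) * M" using M1 by simp
      moreover have "r * M = (sD + 3) * M + 4 * (bg * M) + M" by (simp add: r_def algebra_simps)
      ultimately have z: "enc_size (D, (x, Y)) \<le> r * M"
        using xM unfolding sD_def enc_size_simps by linarith
      have th: "th (D, (x, Y)) \<le> ah * r ^ ch * M ^ ch"
      proof -
        have "enc_size (D, (x, Y)) ^ ch \<le> (r * M) ^ ch" using z by (rule power_mono) simp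
        then have "ah * enc_size (D, (x, Y)) ^ ch \<le> ah * (r * M) ^ ch" by (rule mult_le_mono2)
        with h[of "(D, (x, Y))"] have "th (D, (x, Y)) \<le> ah * (r * M) ^ ch" by (rule le_trans)
        then show ?thesis by (simp only: power_mult_distrib mult.assoc)
      qed
      let ?e = "1 + c + ch"
      have pw: "M ^ e \<le> M ^ ?e" if "e \<le> ?e" for e using that M1 by (intro power_increasing) auto
      have "sD + 5 \<le> (sD + 5) * M ^ ?e" using M1 by simp
      moreover have "ag * M \<le> ag * M ^ ?e" using pw[of 1] by (intro mult_le_mono2) simp
      moreover have "a * bg ^ c * M ^ c \<le> a * bg ^ c * M ^ ?e" using pw[of c] by (intro mult_le_mono2) simp
      moreover have "ah * r ^ ch * M ^ ch \<le> ah * r ^ ch * M ^ ?e" using pw[of ch] by (intro mult_le_mono2) simp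
      moreover have "b * M ^ ?e = (sD + 5) * M ^ ?e + ag * M ^ ?e + a * bg ^ c * M ^ ?e + ah * r ^ ch * M ^ ?e"
        by (simp add: b_def algebra_simps)
      ultimately have total: "sD + 5 + tg x + a * enc_size (g x) ^ c + th (D, (x, Y)) \<le> b * M ^ ?e"
        using tg tP th by linarith
      have "M ^ ?e = (7 ^ q) ^ ?e * N ^ (q * ?e)"
        by (simp only: M_def power_mult_distrib power_mult)
      also have "\<dots> \<le> (7 ^ q) ^ ?e * N ^ (K * c + K)"
      proof (intro mult_le_mono2 power_increasing)
        have "q * ?e = q * c + K" by (simp add: K_def algebra_simps)
        also have "\<dots> \<le> K * c + K" by (simp add: K_def)
        finally show "q * ?e \<le> K * c + K" .
      qed (rule N1)
      finally have "b * M ^ ?e \<le> a' * N ^ (K * c + K)"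
        by (simp add: a'_def mult.assoc)
      moreover have "runs_within (Seq (Pair (const_prog (encode D)) (Pair Id (Seq pg P))) ph) (encode x)
          (encode (h (D, (x, Y))))
          ((tree_size (encode D) + (1 + (tg x + a * enc_size (g x) ^ c + 1) + 1) + 1) + th (D, (x, Y)) + 1)"
        using runs_within_Seq[OF runs_within_Pair[OF runs_const_prog runs_within_Pair[OF runs_within_atomic(1)
              runs_within_Seq[OF pg(2) P]]], of ph "encode D" "encode (h (D, (x, Y)))" "th (D, (x, Y))"]
          ph(2)[of "(D, (x, Y))"] by simp
      ultimately show "runs_within (Seq (Pair (const_prog (encode D)) (Pair Id (Seq pg P))) ph) (encode x)
          (encode (h (D, (x, Y)))) (a' * N ^ (K * c + K))"
        using total by (elim runs_within_mono) (simp add: sD_def enc_size_def)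
    qed
  qed
  then show ?thesis by blast
qed

section \<open>Reducing and lifting an instance\<close>

locale cvc_instance =
  fixes \<G> :: "graph set" and G :: graph and S :: "nat set"
  assumes cls: "graph_class \<G>" and her: "hereditary \<G>"
    and I: "(G, S) \<in> instances (CVC_deletion \<G>)"
begin

definition "A \<equiv> mat_of G"
definition "Sv \<equiv> vec_of (card (verts G)) S"
text \<open>With at most one modulator vertex, \<open>G\<close> already lies in the class of the
  scheme, and using it directly avoids the additive error of the expansion.\<close>

definition "H \<equiv> (if card S \<le> 1 then G else graph_of (contract A Sv))"

lemma G: "numbered_graph G" and S_sub: "S \<subseteq> verts G" and del: "delete_verts G S \<in> \<G>"
  using I by (auto simp: CVC_deletion_def)

lemma len_A [simp]: "length A = card (verts G)" and len_Sv [simp]: "length Sv = card (verts G)"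
  by (simp_all add: A_def Sv_def)

lemma adj_A: "adj_mat A"
  unfolding A_def by (rule adj_mat_mat_of[OF G])

sublocale adj_matrix A
  by unfold_locales (rule adj_A)

lemma vset_Sv: "vset Sv = S"
  unfolding Sv_def by (rule vset_vec_of) (use S_sub verts_numbered[OF G] in blast)

lemma cvc_A: "mat_cvc A = connected_vertex_cover G"
  using connected_vertex_cover_iff[OF G] by (auto simp: A_def)

lemma enc_inst_G: "enc_inst (CVC_deletion \<G>) (G, S) = encode (A, Sv)"
  by (simp add: CVC_deletion_def enc_graph_encode enc_vset_encode A_def Sv_def)

lemma query_eq: "query A Sv = mat_of H"
  using contract_props(2)[OF adj_A, of Sv] mat_of_graph_of
  by (auto simp: query_def H_def card_vset[symmetric] vset_Sv A_def)

text \<open>Removing the contracted vertex 0 leaves a renumbered copy of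
  \<open>G - S\<close>.\<close>

lemma contract_in_class: "graph_of (contract A Sv) \<in> plus_one_vertex \<G>"
proof -
  let ?C = "contract A Sv"
  have adj_C: "adj_mat ?C" using contract_props(2)[OF adj_A, of Sv] by simp
  have num: "numbered_graph (graph_of ?C)" by (rule numbered_graph_of[OF adj_C])
  then have simple: "simple_graph (graph_of ?C)" by (simp add: numbered_graph_def)
  have len: "length Sv = length A" by simp
  have VG: "{..<length A} = verts G" using verts_numbered[OF G] by simp
  interpret contraction "verts G" S "mat_adj A" "mat_adj ?C" 0 "pos Sv"
    using contraction[OF len] unfolding VG vset_Sv .
  have VC: "verts (graph_of ?C) = insert 0 (pos Sv ` (verts G - S))"
    using contract_verts[OF len] unfolding VG vset_Sv by (simp add: graph_of_def)
  have vd: "verts (delete_verts (graph_of ?C) {0}) = pos Sv ` (verts G - S)"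
    unfolding delete_verts_def induced_def using VC z by auto
  have "graph_iso (delete_verts G S) (delete_verts (graph_of ?C) {0})"
    unfolding graph_iso_def
  proof (intro exI conjI ballI)
    have v0: "verts (delete_verts G S) = verts G - S" by (auto simp: delete_verts_def induced_def)
    show "bij_betw (pos Sv) (verts (delete_verts G S)) (verts (delete_verts (graph_of ?C) {0}))"
      unfolding vd v0 using inj by (simp add: bij_betw_def)
    fix u v assume uv: "u \<in> verts (delete_verts G S)" "v \<in> verts (delete_verts G S)"
    have "{u, v} \<in> edges (delete_verts G S) \<longleftrightarrow> {u, v} \<in> edges G"
      using uv by (auto simp: delete_verts_def induced_def)
    also have "\<dots> \<longleftrightarrow> mat_adj A u v" using mat_adj_mat_of[OF G] by (simp add: A_def)
    also have "\<dots> \<longleftrightarrow> mat_adj ?C (pos Sv u) (pos Sv v)" using E'_inner uv v0 by simp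
    also have "\<dots> \<longleftrightarrow> {pos Sv u, pos Sv v} \<in> edges (graph_of ?C)" using graph_of_edge[OF adj_C] by simp
    also have "\<dots> \<longleftrightarrow> {pos Sv u, pos Sv v} \<in> edges (delete_verts (graph_of ?C) {0})"
    proof -
      have "{pos Sv u, pos Sv v} \<subseteq> verts (graph_of ?C) - {0}" using uv v0 VC z by auto
      then show ?thesis by (auto simp: delete_verts_def induced_def)
    qed
    finally show "{u, v} \<in> edges (delete_verts G S) \<longleftrightarrow>
        {pos Sv u, pos Sv v} \<in> edges (delete_verts (graph_of ?C) {0})" .
  qed
  moreover have "simple_graph (delete_verts (graph_of ?C) {0})"
    using simple by (auto simp: simple_graph_def delete_verts_def induced_def)
  ultimately have "delete_verts (graph_of ?C) {0} \<in> \<G>"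
    using cls del unfolding graph_class_def by blast
  then show ?thesis
    using simple VC unfolding plus_one_vertex_def by (intro CollectI conjI exI[of _ "{0}"]) auto
qed

lemma H_instance: "H \<in> instances (CVC_on (plus_one_vertex \<G>))" "numbered_graph H"
proof -
  have "G \<in> plus_one_vertex \<G>" if "card S \<le> 1"
    using that G S_sub del unfolding plus_one_vertex_def numbered_graph_def by blast
  moreover have "numbered_graph (graph_of (contract A Sv))"
    using contract_props(2)[OF adj_A, of Sv] by (simp add: numbered_graph_of)
  ultimately show "numbered_graph H" "H \<in> instances (CVC_on (plus_one_vertex \<G>))"
    using G contract_in_class by (auto simp: H_def CVC_on_def)
qed

section \<open>The cover obtained from the answer of the scheme\<close>

context
  fixes Ys :: "nat set" and \<delta> :: real
  assumes Ys: "Ys \<subseteq> verts H" and \<delta>: "0 < \<delta>" and Ys_ratio: "cvc_ratio H Ys \<le> ennreal (1 + \<delta>)"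
begin

definition "Y \<equiv> vec_of (card (verts H)) Ys"
definition "X \<equiv> approx_cover A Sv Y"

lemma vset_Y: "vset Y = Ys"
  unfolding Y_def by (rule vset_vec_of) (use Ys verts_numbered[OF H_instance(2)] in blast)

lemma len_Y: "length Y = length (query A Sv)"
  by (simp add: Y_def query_eq)

lemma len_X: "length X = card (verts G)"
proof (cases "card S \<le> 1")
  case True
  then show ?thesis by (simp add: X_def approx_cover_def card_vset[symmetric] vset_Sv Y_def H_def)
next
  case False
  then have "length Y = length (contract A Sv)"
    using len_Y by (simp add: query_def card_vset[symmetric] vset_Sv)
  then show ?thesis
    using approx_cover_props(1)[of Sv Y] False by (simp add: X_def vset_Sv)
qed

lemma cover_bound:
  assumes T: "min_cvc G T"
  shows "connected_vertex_cover G (vset X) \<and>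
    real (card (vset X)) \<le> (1 + \<delta>) * real (card T) + 5 * real (card S - 1)"
proof (cases "card S \<le> 1")
  case True
  then have "X = Y" "H = G"
    by (simp_all add: X_def approx_cover_def card_vset[symmetric] vset_Sv H_def)
  then show ?thesis using cvc_ratio_leD[OF T, of Ys "1 + \<delta>"] Ys_ratio \<delta> True by (simp add: vset_Y)
next
  case False
  have len: "length Sv = length A" by simp
  have adj_C: "adj_mat (contract A Sv)" using contract_props(2)[OF adj_A len] .
  have H: "H = graph_of (contract A Sv)" "mat_of H = contract A Sv"
    using False mat_of_graph_of[OF adj_C] by (simp_all add: H_def)
  have cvc_H: "connected_vertex_cover H = mat_cvc (contract A Sv)"
    using connected_vertex_cover_iff[OF H_instance(2)] H by auto
  have TA: "mat_cvc A T" using T cvc_A by (simp add: min_cvc_def)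
  obtain T1 where T1: "connected_vertex_cover H T1" "card T1 \<le> card T"
    using contract_complete[OF len TA] cvc_H by auto
  obtain T2 where T2: "min_cvc H T2" using min_cvc_exists[OF T1(1)] by blast
  then have "card T2 \<le> card T" using T1 unfolding min_cvc_def by fastforce
  moreover have Y: "connected_vertex_cover H Ys" "real (card Ys) \<le> (1 + \<delta>) * real (card T2)"
    using cvc_ratio_leD[OF T2 Ys_ratio] \<delta> by auto
  ultimately have "real (card Ys) \<le> (1 + \<delta>) * real (card T)"
    using \<delta> by (smt (verit, best) mult_left_mono of_nat_le_iff)
  moreover have "mat_cvc A (vset X) \<and> card (vset X) \<le> card Ys + 2 * card S + 1"
    using approx_cover_props(2)[OF len _ _ TA, of Y] False len_Y Y(1) cvc_H
    by (simp add: X_def vset_Sv vset_Y query_def card_vset[symmetric])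
  \<comment> \<open>Equality holds at |S| = 2, which explains the 5; this form vanishes for |S|
    \<le> 1, so both cases share one bound.\<close>
  moreover have "2 * real (card S) + 1 \<le> 5 * real (card S - 1)" using False by (simp add: of_nat_diff)
  ultimately show ?thesis using cvc_A by auto
qed

section \<open>The reduced instance\<close>

context
  fixes D :: "bool list" assumes D: "2 \<le> length D"
begin

definition "red \<equiv> reduce D A Sv Y"
definition "G' \<equiv> graph_of (fst red)"

lemma large_iff: "is_large D Sv X \<longleftrightarrow> length D * (card S - 1) \<le> card (vset X)"
proof -
  have "length (concat (map (\<lambda>_. D) xs)) = length D * length xs" for xs :: "bool list"
    by (induction xs) auto
  then show ?thesis by (simp add: is_large_def card_vset[symmetric] vset_Sv)
qed

lemma red_eq: "red = (if is_large D Sv X then ([], [])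
    else let B = submat (kernel_mask D A X) A in (B, map (\<lambda>_. True) B))"
  by (simp add: red_def reduce_def X_def Let_def)

lemma len_XA: "length X = length A"
  using len_X by simp

lemma len_W: "length (kernel_mask D A X) = length A"
  using length_W[OF len_XA D] unfolding W_def[OF len_XA D] .

lemma adj_red: "adj_mat (fst red)"
  using submat_props(2)[OF adj_A len_W] by (auto simp: red_eq Let_def) (simp add: adj_mat_def)

lemma snd_red: "snd red = map (\<lambda>_. True) (fst red)"
  by (simp add: red_eq Let_def)

lemma verts_G': "verts G' = {..<length (fst red)}"
  by (simp add: G'_def graph_of_def)

lemma mat_G': "mat_of G' = fst red" and numbered_G': "numbered_graph G'"
  by (simp_all add: G'_def mat_of_graph_of adj_red numbered_graph_of)

lemma G'_instance: "(G', verts G') \<in> instances (CVC_deletion \<G>)"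
proof -
  \<comment> \<open>The empty set has to be excluded as an edge: it would survive the deletion of
    all vertices.\<close>
  have "card e = 2" if "e \<in> edges G'" for e
    using numbered_G' that by (simp add: numbered_graph_def simple_graph_def)
  from this[of "{}"] have "{} \<notin> edges G'" by auto
  then have "delete_verts G' (verts G') = \<lparr>verts = {}, edges = {}\<rparr>"
    by (auto simp: delete_verts_def induced_def)
  moreover have "induced (delete_verts G S) {} = \<lparr>verts = {}, edges = {}\<rparr>"
  proof -
    have "simple_graph (delete_verts G S)" using cls del by (simp add: graph_class_def)
    then show ?thesis by (auto simp: induced_def simple_graph_def)
  qed
  moreover have "induced (delete_verts G S) {} \<in> \<G>"
    using her del unfolding hereditary_def by blast
  ultimately show ?thesis using numbered_G' by (simp add: CVC_deletion_def)
qed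

lemma enc_inst_G': "enc_inst (CVC_deletion \<G>) (G', verts G') = encode red"
proof -
  have "vec_of (card (verts G')) (verts G') = snd red"
    unfolding snd_red verts_G' by (rule nth_equalityI) (simp_all add: vec_of_def)
  then show ?thesis
    by (simp add: CVC_deletion_def enc_graph_encode enc_vset_encode mat_G' encode_pair[of red])
qed

text \<open>A failed size test gives |X| < d (k - 1), which also excludes k \<le> 1; this holds for
  instances without a solution as well.\<close>

lemma kernel_verts: "card (verts G') \<le> (if card S \<le> 1 then 0 else card S ^ (7 * length D))"
proof (cases "is_large D Sv X")
  case True
  then show ?thesis by (simp add: verts_G' red_eq)
next
  case False
  then have N: "card (vset X) < length D * (card S - 1)" using large_iff by simp
  then have k: "2 \<le> card S" by (cases "card S \<le> 1") auto
  have "card (verts G') = card (vset (kernel_mask D A X))"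
    using False submat_props(1)[OF adj_A len_W] by (simp add: verts_G' red_eq Let_def)
  also have "\<dots> \<le> card S ^ (7 * length D)"
  proof (rule kernel_size_arith[OF k])
    show "card (vset X) \<le> length D * card S"
      using N by (meson diff_le_self le_trans less_imp_le mult_le_mono2)
    show "1 \<le> length D" using D by simp
  qed (use card_kernel[OF len_XA D] W_def[OF len_XA D] in simp)
  finally show ?thesis using k by simp
qed

section \<open>The lifted solution\<close>

context
  fixes s' :: "nat set" assumes s': "s' \<subseteq> verts G'"
begin

definition "sv \<equiv> vec_of (card (verts G')) s'"
definition "out \<equiv> lift_sol D A Sv Y sv"

lemma vset_sv: "vset sv = s'"
  unfolding sv_def by (rule vset_vec_of) (use s' verts_G' in simp)

lemma out_eq: "out = (if is_large D Sv X \<or> \<not> card s' \<le> card (vset X) then X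
    else expand (kernel_mask D A X) sv)"
  by (simp add: out_def lift_sol_def X_def Let_def card_vset[symmetric] vset_sv)

lemma len_out: "length out = card (verts G)"
  using len_X len_W by (simp add: out_eq)

text \<open>For a large cover, 5 (k - 1) \<le> (\<eta>/4) |X| because 20 = 5 times 4. Hence (1 -
  \<eta>/4) |X| is at most (1 + \<eta>/4) times the optimum, and 1 + \<eta>/4 \<le> (1 + \<eta>) (1
  - \<eta>/4) as \<eta> \<le> 1. For a small one the kernel loses the factor d / (d - 1) \<le> 1 +
  \<eta>.\<close>

lemma lift_ratio:
  fixes \<alpha> \<eta> :: real
  assumes \<eta>: "0 < \<eta>" "\<eta> \<le> 1" "1 + \<eta> \<le> \<alpha>" and "\<delta> = \<eta> / 4" and d: "20 / \<eta> \<le> real (length D) - 1"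
  shows "cvc_ratio G (vset out) \<le> ennreal \<alpha> * cvc_ratio G' s'"
proof (cases "\<exists>T. connected_vertex_cover G T")
  case False
  then have "cvc_ratio G (vset out) = 1" using cvc_ratio_infeasible by blast
  also have "1 \<le> ennreal \<alpha> * cvc_ratio G' s'"
  proof -
    have "1 \<le> ennreal \<alpha>" using \<eta> by (simp flip: ennreal_1)
    then show ?thesis using cvc_ratio_ge_1[OF s'] mult_mono[of 1 "ennreal \<alpha>" 1 "cvc_ratio G' s'"] by simp
  qed
  finally show ?thesis .
next
  case True
  then obtain T where T: "min_cvc G T" using min_cvc_exists by blast
  note X_bound = cover_bound[OF T]
  let ?d = "real (length D)"
  have d20: "20 \<le> \<eta> * (?d - 1)" using d \<eta> by (simp add: divide_le_eq mult.commute)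
  show ?thesis
  proof (cases "is_large D Sv X")
    case True
    let ?x = "real (card (vset X))" and ?t = "real (card T)"
    have "?d * real (card S - 1) \<le> ?x"
      using True large_iff by (metis of_nat_le_iff of_nat_mult)
    moreover have "20 * real (card S - 1) \<le> \<eta> * ?d * real (card S - 1)"
      using d20 \<eta> by (intro mult_right_mono) (auto simp: algebra_simps)
    moreover have "\<eta> * (?d * real (card S - 1)) \<le> \<eta> * ?x"
      using calculation(1) \<eta> by (intro mult_left_mono) auto
    ultimately have "20 * real (card S - 1) \<le> \<eta> * ?x" by (simp add: mult.assoc)
    then have le: "?x * (1 - \<eta> / 4) \<le> (1 + \<eta> / 4) * ?t"
      using X_bound \<open>\<delta> = \<eta> / 4\<close> by (simp add: algebra_simps)
    have "(1 + \<eta> / 4) \<le> (1 + \<eta>) * (1 - \<eta> / 4)"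
    proof -
      have "\<eta> * \<eta> \<le> \<eta>" using \<eta> by (simp add: mult_left_le)
      then show ?thesis using \<eta> by (simp add: field_simps)
    qed
    then have "(1 + \<eta> / 4) * ?t \<le> (1 + \<eta>) * (1 - \<eta> / 4) * ?t" by (intro mult_right_mono) auto
    then have "?x * (1 - \<eta> / 4) \<le> ((1 + \<eta>) * ?t) * (1 - \<eta> / 4)"
      using le by (simp add: ac_simps)
    then have "?x \<le> (1 + \<eta>) * ?t" using \<eta> by (simp add: mult_le_cancel_right)
    also have "\<dots> \<le> \<alpha> * ?t" using \<eta> by (intro mult_right_mono) auto
    finally have "cvc_ratio G (vset X) \<le> ennreal \<alpha>"
      using cvc_ratio_leI[OF T] X_bound \<eta> by simp
    also have "ennreal \<alpha> \<le> ennreal \<alpha> * cvc_ratio G' s'"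
      using cvc_ratio_ge_1[OF s'] mult_left_mono[of 1 "cvc_ratio G' s'" "ennreal \<alpha>"] by simp
    finally show ?thesis using True by (simp add: out_eq)
  next
    case small: False
    have cover: "u \<in> vset X \<or> v \<in> vset X" if "mat_adj A u v" for u v
    proof -
      have "mat_cvc A (vset X)" using X_bound cvc_A by simp
      then show ?thesis using that E_less[OF that] unfolding mat_cvc_def cvc_def by blast
    qed
    have red: "fst red = submat (kernel_mask D A X) A" using small by (simp add: red_eq Let_def)
    have cvc_G': "connected_vertex_cover G' = mat_cvc (submat (kernel_mask D A X) A)"
      using connected_vertex_cover_iff[OF numbered_G'] by (auto simp: mat_G' red)
    \<comment> \<open>An optimal solution is no larger than the feasible set \<open>X\<close>, hence
      small enough for the completeness of the kernel.\<close>
    have T_le: "card T \<le> card (vset X)" using T X_bound unfolding min_cvc_def by blast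
    have "mat_cvc A T" using T cvc_A by (simp add: min_cvc_def)
    then have "\<exists>T1. mat_cvc (submat (W X D) A) T1 \<and> (length D - 1) * card T1 \<le> length D * card T"
      by (intro kernel_complete[OF len_XA D cover _ T_le])
    then obtain T1 where
      T1: "connected_vertex_cover G' T1" "(length D - 1) * card T1 \<le> length D * card T"
      unfolding W_def[OF len_XA D] cvc_G' by blast
    obtain T' where T': "min_cvc G' T'" using min_cvc_exists[OF T1(1)] by blast
    have T'_le: "real (card T') \<le> \<alpha> * real (card T)"
    proof -
      have "card T' \<le> card T1" using T' T1(1) unfolding min_cvc_def by blast
      then have "(length D - 1) * card T' \<le> length D * card T"
        using T1(2) by (meson le_trans mult_le_mono2)
      then have "real ((length D - 1) * card T') \<le> real (length D * card T)" by (simp only: of_nat_le_iff)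
      then have "(?d - 1) * real (card T') \<le> ?d * real (card T)" using D by (simp add: of_nat_diff)
      also have "\<dots> \<le> ((1 + \<eta>) * (?d - 1)) * real (card T)"
        using d20 by (intro mult_right_mono) (auto simp: algebra_simps)
      finally have "(?d - 1) * real (card T') \<le> (?d - 1) * ((1 + \<eta>) * real (card T))"
        by (simp add: ac_simps)
      then have "real (card T') \<le> (1 + \<eta>) * real (card T)" using D by simp
      also have "\<dots> \<le> \<alpha> * real (card T)" using \<eta> by (intro mult_right_mono) auto
      finally show ?thesis .
    qed
    show ?thesis
    \<comment> \<open>If \<open>s'\<close> is larger than \<open>X\<close>, then \<open>X\<close> is
      returned and is good enough, whether \<open>s'\<close> is feasible or not. An infeasible
      \<open>s'\<close> that is not larger has ratio infinity, because the kernel has a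
      solution.\<close>
    proof (cases "connected_vertex_cover G' s' \<or> \<not> card s' \<le> card (vset X)")
      case True
      have "connected_vertex_cover G (vset out) \<and> (card (vset out) \<le> card s')"
      proof (cases "card s' \<le> card (vset X)")
        case le: True
        then have "mat_cvc (submat (kernel_mask D A X) A) s'" using True cvc_G' by simp
        then have "mat_cvc A ((!) (idxs (W X D)) ` s') \<and> card ((!) (idxs (W X D)) ` s') = card s'"
          unfolding W_def[OF len_XA D, symmetric] by (intro kernel_sound[OF len_XA D cover _ le])
        then have *: "mat_cvc A ((!) (idxs (kernel_mask D A X)) ` s')"
          "card ((!) (idxs (kernel_mask D A X)) ` s') = card s'"
          unfolding W_def[OF len_XA D] by auto
        have "length sv = card (vset (kernel_mask D A X))"
          using submat_props(1)[OF adj_A len_W] by (simp add: sv_def verts_G' red)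
        then have "vset out = (!) (idxs (kernel_mask D A X)) ` s'"
          using small le by (simp add: out_eq vset_expand vset_sv)
        then show ?thesis using * cvc_A by simp
      next
        case False
        then show ?thesis using X_bound by (simp add: out_eq)
      qed
      then show ?thesis
        using cvc_ratio_transfer[OF T _ T' _ s' _ T'_le] \<eta> by auto
    next
      case False
      then have "cvc_cost G' s' = top" by (simp add: cvc_cost_def)
      then have "cvc_ratio G' s' = top"
        using cvc_opt_min[OF T'] by (simp add: cvc_ratio_def ennreal_top_divide)
      then show ?thesis using \<eta> by (simp add: ennreal_mult_top)
    qed
  qed
qed

end

text \<open>Keeps the candidate to be lifted within the size of the original instance, in which the
  lifting time is measured.\<close>

lemma kernel_verts_le: "card (verts G') \<le> card (verts G)"
proof (cases "is_large D Sv X")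
  case True
  then show ?thesis by (simp add: verts_G' red_eq)
next
  case False
  have "vset (kernel_mask D A X) \<subseteq> {..<card (verts G)}"
    using vset_less[of _ "kernel_mask D A X"] len_W by auto
  then have "card (vset (kernel_mask D A X)) \<le> card (verts G)"
    by (metis card_lessThan card_mono finite_lessThan)
  then show ?thesis
    using False submat_props(1)[OF adj_A len_W] by (simp add: verts_G' red_eq Let_def)
qed

lemma kernel_size:
  "inst_size (CVC_deletion \<G>) (G', verts G') + param (CVC_deletion \<G>) (G', verts G')
    \<le> 14 * (card S + 1) ^ (14 * length D)"
proof -
  let ?l = "card (verts G')" and ?m = "(card S + 1) ^ (7 * length D)"
  have l: "?l = length (fst red)" by (simp add: verts_G')
  have "card S ^ (7 * length D) \<le> ?m" by (rule power_mono) auto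
  then have lm: "?l \<le> ?m" using kernel_verts by (simp split: if_splits)
  have "enc_size (fst red) \<le> 1 + ?l * (1 + 4 * ?l + 1)"
    unfolding l
  proof (rule enc_size_list_le)
    fix r assume "r \<in> set (fst red)"
    then have "length r = length (fst red)" using adj_red by (auto simp: adj_mat_def in_set_conv_nth)
    then show "enc_size r \<le> 1 + 4 * length (fst red)" using enc_size_bool_list[of r] by simp
  qed
  moreover have "enc_size (snd red) \<le> 1 + 4 * ?l"
    using enc_size_bool_list[of "snd red"] by (simp add: snd_red l)
  moreover have "inst_size (CVC_deletion \<G>) (G', verts G') = enc_size (fst red) + enc_size (snd red) + 1"
    using enc_size_simps(1)[of "fst red" "snd red"] by (simp add: inst_size_def enc_inst_G' enc_size_def)
  moreover have "param (CVC_deletion \<G>) (G', verts G') = ?l" by (simp add: CVC_deletion_def)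
  ultimately have "inst_size (CVC_deletion \<G>) (G', verts G') + param (CVC_deletion \<G>) (G', verts G')
      \<le> 3 + 7 * ?l + 4 * (?l * ?l)" by (simp add: algebra_simps)
  \<comment> \<open>14 = 3 + 7 + 4. The adjacency matrix squares the number of vertices and so
    doubles the exponent.\<close>
  also have "\<dots> \<le> 14 * (?m * ?m)"
  proof -
    have "?l * ?l \<le> ?m * ?m" using lm by (intro mult_le_mono)
    moreover have "?m \<le> ?m * ?m" "1 \<le> ?m" by simp_all
    ultimately show ?thesis using lm by linarith
  qed
  also have "?m * ?m = (card S + 1) ^ (14 * length D)" by (simp flip: power_add)
  finally show ?thesis .
qed

end

end

end

text \<open>The estimate for a large cover needs an accuracy of at most 1. For \<alpha> = 1 +
  \<epsilon> with \<epsilon> < 1 this is \<epsilon>.\<close>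

definition slack :: "real \<Rightarrow> real" where
  "slack \<alpha> = min (\<alpha> - 1) 1"

definition threshold :: "real \<Rightarrow> bool list" where
  "threshold \<alpha> = replicate (nat \<lceil>20 / slack \<alpha>\<rceil> + 1) True"

lemma slack: "1 < \<alpha> \<Longrightarrow> 0 < slack \<alpha>" "slack \<alpha> \<le> 1" "1 + slack \<alpha> \<le> \<alpha>"
  by (auto simp: slack_def)

lemma length_threshold:
  assumes "1 < \<alpha>"
  shows "20 / slack \<alpha> \<le> real (length (threshold \<alpha>)) - 1" "2 \<le> length (threshold \<alpha>)"
    "real (length (threshold \<alpha>)) \<le> 22 / slack \<alpha>"
proof -
  have pos: "1 \<le> 1 / slack \<alpha>" using slack(1)[OF assms] slack(2)[of \<alpha>] by (simp add: le_divide_eq)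
  then have c: "20 / slack \<alpha> \<le> real (nat \<lceil>20 / slack \<alpha>\<rceil>)" "real (nat \<lceil>20 / slack \<alpha>\<rceil>) \<le> 20 / slack \<alpha> + 1"
    by linarith+
  show "20 / slack \<alpha> \<le> real (length (threshold \<alpha>)) - 1" using c by (simp add: threshold_def)
  \<comment> \<open>Rounding and the extra list entry add at most 2, which is at most 2 /
    slack.\<close>
  have "20 / slack \<alpha> = 20 * (1 / slack \<alpha>)" "22 / slack \<alpha> = 22 * (1 / slack \<alpha>)" by simp_all
  then have "1 \<le> real (nat \<lceil>20 / slack \<alpha>\<rceil>)" "real (nat \<lceil>20 / slack \<alpha>\<rceil>) + 1 \<le> 22 / slack \<alpha>"
    using c pos by linarith+
  then show "2 \<le> length (threshold \<alpha>)" "real (length (threshold \<alpha>)) \<le> 22 / slack \<alpha>"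
    unfolding threshold_def length_replicate by linarith+
qed

text \<open>Both programs pose the same query to the scheme and so work with the same
  \<open>Y\<close>. The kernel is therefore dropped from the input of the lifting program; this
  projection takes 5 steps and the sequencing 1.\<close>

lemma (in cvc_instance) reduce_and_lift:
  assumes scheme: "approx_scheme_within (CVC_on (plus_one_vertex \<G>)) P (\<lambda>\<epsilon> n. a \<epsilon> * n ^ c \<epsilon>)"
    and \<alpha>: "1 < \<alpha>"
    and pR: "computes_with pR (P (slack \<alpha> / 4)) (a (slack \<alpha> / 4)) (c (slack \<alpha> / 4)) (\<lambda>x. query (fst x) (snd x))
      (\<lambda>x Y. reduce (threshold \<alpha>) (fst x) (snd x) Y) tR"
    and pL: "computes_with pL (P (slack \<alpha> / 4)) (a (slack \<alpha> / 4)) (c (slack \<alpha> / 4))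
      (\<lambda>x. query (fst (fst x)) (snd (fst x)))
      (\<lambda>x Y. lift_sol (threshold \<alpha>) (fst (fst x)) (snd (fst x)) Y (snd x)) tL"
  shows "\<exists>I'\<in>instances (CVC_deletion \<G>).
    runs_within pR (enc_inst (CVC_deletion \<G>) (G, S)) (enc_inst (CVC_deletion \<G>) I')
      (tR (inst_size (CVC_deletion \<G>) (G, S))) \<and>
    card (verts (fst I')) \<le> (if card S \<le> 1 then 0 else card S ^ (7 * length (threshold \<alpha>))) \<and>
    inst_size (CVC_deletion \<G>) I' + param (CVC_deletion \<G>) I' \<le> 14 * (card S + 1) ^ (14 * length (threshold \<alpha>)) \<and>
    (\<forall>s'\<in>candidates (CVC_deletion \<G>) I'. \<exists>s\<in>candidates (CVC_deletion \<G>) (G, S).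
        runs_within (Seq (Pair Left (Seq Right Right)) pL)
          (Node (enc_inst (CVC_deletion \<G>) (G, S)) (Node (enc_inst (CVC_deletion \<G>) I') (enc_sol (CVC_deletion \<G>) I' s')))
          (enc_sol (CVC_deletion \<G>) (G, S) s) (tL (inst_size (CVC_deletion \<G>) (G, S)) + 6) \<and>
        ratio (CVC_deletion \<G>) (G, S) s \<le> ennreal \<alpha> * ratio (CVC_deletion \<G>) I' s')"
proof -
  let ?\<delta> = "slack \<alpha> / 4" and ?D = "threshold \<alpha>" and ?Q = "CVC_deletion \<G>"
  have \<delta>: "0 < ?\<delta>" using slack(1)[OF \<alpha>] by simp
  have D: "2 \<le> length ?D" by (rule length_threshold(2)[OF \<alpha>])
  obtain Ys where Ys: "Ys \<subseteq> verts H" "cvc_ratio H Ys \<le> ennreal (1 + ?\<delta>)"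
    "runs_within (P ?\<delta>) (encode (mat_of H)) (encode (vec_of (card (verts H)) Ys))
      (a ?\<delta> * enc_size (mat_of H) ^ c ?\<delta>)"
  proof -
    have "\<exists>s\<in>candidates (CVC_on (plus_one_vertex \<G>)) H.
      runs_within (P ?\<delta>) (enc_inst (CVC_on (plus_one_vertex \<G>)) H) (enc_sol (CVC_on (plus_one_vertex \<G>)) H s)
        (a ?\<delta> * inst_size (CVC_on (plus_one_vertex \<G>)) H ^ c ?\<delta>) \<and>
      ratio (CVC_on (plus_one_vertex \<G>)) H s \<le> ennreal (1 + ?\<delta>)"
      using scheme \<delta> H_instance(1) unfolding approx_scheme_within_def by blast
    then show ?thesis
      unfolding ratio_CVC_on
      using that by (auto simp: inst_size_def CVC_on_def enc_graph_encode enc_vset_encode enc_size_def)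
  qed
  note ctx = Ys(1) \<delta> Ys(2)
  let ?Y = "Y Ys" and ?G' = "G' Ys ?D" and ?red = "red Ys ?D"
  let ?I' = "(?G', verts ?G')"
  have n: "inst_size ?Q (G, S) = enc_size (A, Sv)"
    by (simp only: inst_size_def enc_inst_G enc_size_def)
  have Y_run: "scheme_run (P ?\<delta>) (a ?\<delta>) (c ?\<delta>) (query A Sv) ?Y"
    using Ys(3) len_Y[OF ctx] unfolding scheme_run_def query_eq Y_def[OF ctx] by blast
  have "runs_within pR (encode (A, Sv)) (encode (reduce ?D A Sv ?Y)) (tR (enc_size (A, Sv)))"
    using pR[unfolded computes_with_def, rule_format, of "(A, Sv)" ?Y "enc_size (A, Sv)"] Y_run by simp
  then have 1: "runs_within pR (enc_inst ?Q (G, S)) (enc_inst ?Q ?I') (tR (inst_size ?Q (G, S)))"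
    unfolding n enc_inst_G enc_inst_G'[OF ctx D] red_def[OF ctx D] .
  have 2: "\<exists>s\<in>candidates ?Q (G, S).
        runs_within (Seq (Pair Left (Seq Right Right)) pL)
          (Node (enc_inst ?Q (G, S)) (Node (enc_inst ?Q ?I') (enc_sol ?Q ?I' s')))
          (enc_sol ?Q (G, S) s) (tL (inst_size ?Q (G, S)) + 6) \<and>
        ratio ?Q (G, S) s \<le> ennreal \<alpha> * ratio ?Q ?I' s'"
    if "s' \<in> candidates ?Q ?I'" for s'
  proof -
    have s': "s' \<subseteq> verts ?G'" using that by (simp add: CVC_deletion_def)
    let ?sv = "sv Ys ?D s'" and ?out = "out Ys ?D s'"
    have sv: "enc_sol ?Q ?I' s' = encode ?sv"
      by (simp add: CVC_deletion_def enc_vset_encode sv_def[OF ctx D s'])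
    have "length ?sv \<le> enc_size A"
      using kernel_verts_le[OF ctx D] length_le_enc_size[of A] by (simp add: sv_def[OF ctx D s'])
    then have "enc_size ((A, Sv), ?sv) \<le> 7 * enc_size (A, Sv)"
      using enc_size_bool_list[of ?sv] by simp
    then have "runs_within pL (encode ((A, Sv), ?sv)) (encode ?out) (tL (enc_size (A, Sv)))"
      using pL[unfolded computes_with_def, rule_format, of "((A, Sv), ?sv)" ?Y "enc_size (A, Sv)"] Y_run by (simp add: out_def[OF ctx D s'])
    moreover have "runs_within (Pair Left (Seq Right Right))
        (Node (encode (A, Sv)) (Node (enc_inst ?Q ?I') (encode ?sv))) (encode ((A, Sv), ?sv)) (1 + 3 + 1)"
      using runs_within_Pair[OF runs_within_atomic(3)[of "Node (encode (A, Sv)) (Node (enc_inst ?Q ?I') (encode ?sv))"]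
          runs_within_Seq[OF runs_within_atomic(4) runs_within_atomic(4)]]
      by (simp add: eval_nat_numeral)
    ultimately have "runs_within (Seq (Pair Left (Seq Right Right)) pL)
          (Node (enc_inst ?Q (G, S)) (Node (enc_inst ?Q ?I') (enc_sol ?Q ?I' s')))
          (encode ?out) (tL (inst_size ?Q (G, S)) + 6)"
      unfolding n enc_inst_G sv by (intro runs_within_mono[OF runs_within_Seq]) auto
    moreover have "encode ?out = enc_sol ?Q (G, S) (vset ?out)"
      using vec_of_vset[OF len_out[OF ctx D s']] by (simp add: CVC_deletion_def enc_vset_encode)
    moreover have "vset ?out \<in> candidates ?Q (G, S)"
      using len_out[OF ctx D s'] vset_less[of _ ?out] verts_numbered[OF G] by (auto simp: CVC_deletion_def)
    moreover have "ratio ?Q (G, S) (vset ?out) \<le> ennreal \<alpha> * ratio ?Q ?I' s'"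
      unfolding ratio_CVC_deletion
      by (rule lift_ratio[OF ctx D s' slack(1)[OF \<alpha>] slack(2,3) refl length_threshold(1)[OF \<alpha>]])
    ultimately show ?thesis by metis
  qed
  show ?thesis
    using G'_instance[OF ctx D] 1 kernel_verts[OF ctx D] kernel_size[OF ctx D] 2 by (intro bexI[of _ ?I']) auto
qed

text \<open>The programs and \<open>K\<close> depend on \<open>P\<close> only, while the bounds
  \<open>a\<close> and \<open>c\<close> are quantified afterwards. Thus the same \<open>R\<close>
  and \<open>L\<close> can be timed by the bounds of a PTAS and by those of an efficient
  one.\<close>

lemma kernelization_scheme:
  assumes cls: "graph_class \<G>" and her: "hereditary \<G>"
  shows "\<exists>R L K. \<forall>a c. approx_scheme_within (CVC_on (plus_one_vertex \<G>)) P (\<lambda>\<epsilon> n. a \<epsilon> * n ^ c \<epsilon>) \<longrightarrow>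
    (\<exists>a'. PSAKS_within (CVC_deletion \<G>) R L (\<lambda>\<alpha> n. a' \<alpha> * n ^ (K * c (slack \<alpha> / 4) + K))) \<and>
    (\<forall>\<alpha>>1. kernel_vertices_le \<G> (R \<alpha>)
      (\<lambda>k. if k \<le> 1 then 0 else real (k ^ (7 * length (threshold \<alpha>)))))"
proof -
  let ?Q = "CVC_deletion \<G>"
  have qR: "polyt (\<lambda>x. query (fst x) (snd x))" by (intro polyt_intros)
  have qL: "polyt (\<lambda>x :: (bool list list \<times> bool list) \<times> bool list. query (fst (fst x)) (snd (fst x)))"
    by (intro polyt_intros)
  obtain gR hR KR where R_ex: "\<forall>P D a c. \<exists>a'.
      computes_with (Seq (Pair (const_prog (encode D)) (Pair Id (Seq gR P))) hR) P a c
        (\<lambda>x. query (fst x) (snd x)) (\<lambda>x Y. reduce D (fst x) (snd x) Y) (\<lambda>N. a' * N ^ (KR * c + KR))"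
    using scheme_program[OF qR polyt_reduce] unfolding fst_conv snd_conv by (elim exE)
  obtain gL hL KL where L_ex: "\<forall>P D a c. \<exists>a'.
      computes_with (Seq (Pair (const_prog (encode D)) (Pair Id (Seq gL P))) hL) P a c
        (\<lambda>x. query (fst (fst x)) (snd (fst x)))
        (\<lambda>x Y. lift_sol D (fst (fst x)) (snd (fst x)) Y (snd x)) (\<lambda>N. a' * N ^ (KL * c + KL))"
    using scheme_program[OF qL polyt_lift_sol] unfolding fst_conv snd_conv by (elim exE)
  define R where "R \<alpha> = Seq (Pair (const_prog (encode (threshold \<alpha>))) (Pair Id (Seq gR (P (slack \<alpha> / 4))))) hR" for \<alpha>
  define L0 where "L0 \<alpha> = Seq (Pair (const_prog (encode (threshold \<alpha>))) (Pair Id (Seq gL (P (slack \<alpha> / 4))))) hL" for \<alpha>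
  define L where "L \<alpha> = Seq (Pair Left (Seq Right Right)) (L0 \<alpha>)" for \<alpha>
  define K where "K = KR + KL"
  have main: "(\<exists>a'. PSAKS_within ?Q R L (\<lambda>\<alpha> n. a' \<alpha> * n ^ (K * c (slack \<alpha> / 4) + K))) \<and>
    (\<forall>\<alpha>>1. kernel_vertices_le \<G> (R \<alpha>) (\<lambda>k. if k \<le> 1 then 0 else real (k ^ (7 * length (threshold \<alpha>)))))"
    if scheme: "approx_scheme_within (CVC_on (plus_one_vertex \<G>)) P (\<lambda>\<epsilon> n. a \<epsilon> * n ^ c \<epsilon>)" for a c
  proof -
    have "\<forall>\<alpha>. \<exists>a'. computes_with (R \<alpha>) (P (slack \<alpha> / 4)) (a (slack \<alpha> / 4)) (c (slack \<alpha> / 4))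
        (\<lambda>x. query (fst x) (snd x)) (\<lambda>x Y. reduce (threshold \<alpha>) (fst x) (snd x) Y)
        (\<lambda>N. a' * N ^ (KR * c (slack \<alpha> / 4) + KR))"
      unfolding R_def by (rule allI, rule R_ex[THEN spec, THEN spec, THEN spec, THEN spec])
    from choice[OF this] obtain aR where
      aR: "\<forall>\<alpha>. computes_with (R \<alpha>) (P (slack \<alpha> / 4)) (a (slack \<alpha> / 4)) (c (slack \<alpha> / 4))
        (\<lambda>x. query (fst x) (snd x)) (\<lambda>x Y. reduce (threshold \<alpha>) (fst x) (snd x) Y)
        (\<lambda>N. aR \<alpha> * N ^ (KR * c (slack \<alpha> / 4) + KR))"
      by (elim exE)
    have "\<forall>\<alpha>. \<exists>a'. computes_with (L0 \<alpha>) (P (slack \<alpha> / 4)) (a (slack \<alpha> / 4)) (c (slack \<alpha> / 4))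
        (\<lambda>x. query (fst (fst x)) (snd (fst x)))
        (\<lambda>x Y. lift_sol (threshold \<alpha>) (fst (fst x)) (snd (fst x)) Y (snd x))
        (\<lambda>N. a' * N ^ (KL * c (slack \<alpha> / 4) + KL))"
      unfolding L0_def by (rule allI, rule L_ex[THEN spec, THEN spec, THEN spec, THEN spec])
    from choice[OF this] obtain aL where
      aL: "\<forall>\<alpha>. computes_with (L0 \<alpha>) (P (slack \<alpha> / 4)) (a (slack \<alpha> / 4)) (c (slack \<alpha> / 4))
        (\<lambda>x. query (fst (fst x)) (snd (fst x)))
        (\<lambda>x Y. lift_sol (threshold \<alpha>) (fst (fst x)) (snd (fst x)) Y (snd x))
        (\<lambda>N. aL \<alpha> * N ^ (KL * c (slack \<alpha> / 4) + KL))"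
      by (elim exE)
    define a' where "a' \<alpha> = aR \<alpha> + aL \<alpha> + 6" for \<alpha>
    note inst = cvc_instance.reduce_and_lift[OF cvc_instance.intro[OF cls her] scheme _ spec[OF aR] spec[OF aL]]
    have le: "aR \<alpha> * n ^ (KR * e + KR) \<le> a' \<alpha> * n ^ (K * e + K)"
      "aL \<alpha> * n ^ (KL * e + KL) + 6 \<le> a' \<alpha> * n ^ (K * e + K)" if "1 \<le> n" for \<alpha> n e
    proof -
      have "n ^ (KR * e + KR) \<le> n ^ (K * e + K)" "n ^ (KL * e + KL) \<le> n ^ (K * e + K)"
        using that by (auto intro!: power_increasing simp: K_def add_mult_distrib)
      then have "aR \<alpha> * n ^ (KR * e + KR) \<le> aR \<alpha> * n ^ (K * e + K)"
        "aL \<alpha> * n ^ (KL * e + KL) \<le> aL \<alpha> * n ^ (K * e + K)" by (auto intro: mult_le_mono2)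
      moreover have "6 \<le> 6 * n ^ (K * e + K)" using that by simp
      moreover have "a' \<alpha> * n ^ (K * e + K) = aR \<alpha> * n ^ (K * e + K) + aL \<alpha> * n ^ (K * e + K) + 6 * n ^ (K * e + K)"
        by (simp add: a'_def algebra_simps)
      ultimately show "aR \<alpha> * n ^ (KR * e + KR) \<le> a' \<alpha> * n ^ (K * e + K)"
        "aL \<alpha> * n ^ (KL * e + KL) + 6 \<le> a' \<alpha> * n ^ (K * e + K)" by linarith+
    qed
    have n1: "1 \<le> inst_size ?Q I" for I by (simp only: inst_size_def tree_size_pos)
    have "PSAKS_within ?Q R L (\<lambda>\<alpha> n. a' \<alpha> * n ^ (K * c (slack \<alpha> / 4) + K))"
      unfolding PSAKS_within_def
    proof (intro allI impI)
      fix \<alpha> :: real assume \<alpha>: "1 < \<alpha>"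
      have "approx_kernelization ?Q \<alpha> (R \<alpha>) (L \<alpha>) (\<lambda>n. a' \<alpha> * n ^ (K * c (slack \<alpha> / 4) + K))
          (\<lambda>k. 14 * (k + 1) ^ (14 * length (threshold \<alpha>)))"
        unfolding approx_kernelization_def
      proof
        fix I assume I: "I \<in> instances ?Q"
        obtain G S where GS: "I = (G, S)" by fastforce
        obtain I' where I': "I' \<in> instances ?Q"
          "runs_within (R \<alpha>) (enc_inst ?Q I) (enc_inst ?Q I')
             (aR \<alpha> * inst_size ?Q I ^ (KR * c (slack \<alpha> / 4) + KR))"
          "inst_size ?Q I' + param ?Q I' \<le> 14 * (card S + 1) ^ (14 * length (threshold \<alpha>))"
          "\<forall>s'\<in>candidates ?Q I'. \<exists>s\<in>candidates ?Q I.
             runs_within (L \<alpha>) (Node (enc_inst ?Q I) (Node (enc_inst ?Q I') (enc_sol ?Q I' s')))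
               (enc_sol ?Q I s) (aL \<alpha> * inst_size ?Q I ^ (KL * c (slack \<alpha> / 4) + KL) + 6) \<and>
             ratio ?Q I s \<le> ennreal \<alpha> * ratio ?Q I' s'"
          using inst[OF I[unfolded GS] \<alpha>] unfolding GS L_def by blast
        have "param ?Q I = card S" by (simp add: GS CVC_deletion_def)
        moreover have "runs_within (R \<alpha>) (enc_inst ?Q I) (enc_inst ?Q I')
            (a' \<alpha> * inst_size ?Q I ^ (K * c (slack \<alpha> / 4) + K))"
          by (rule runs_within_mono[OF I'(2) le(1)[OF n1]])
        moreover have "\<exists>s\<in>candidates ?Q I.
            runs_within (L \<alpha>) (Node (enc_inst ?Q I) (Node (enc_inst ?Q I') (enc_sol ?Q I' s')))
              (enc_sol ?Q I s) (a' \<alpha> * inst_size ?Q I ^ (K * c (slack \<alpha> / 4) + K)) \<and>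
            ratio ?Q I s \<le> ennreal \<alpha> * ratio ?Q I' s'" if s': "s' \<in> candidates ?Q I'" for s'
        proof -
          obtain s where "s \<in> candidates ?Q I" "ratio ?Q I s \<le> ennreal \<alpha> * ratio ?Q I' s'"
            and run: "runs_within (L \<alpha>) (Node (enc_inst ?Q I) (Node (enc_inst ?Q I') (enc_sol ?Q I' s')))
               (enc_sol ?Q I s) (aL \<alpha> * inst_size ?Q I ^ (KL * c (slack \<alpha> / 4) + KL) + 6)"
            using I'(4) s' by blast
          then show ?thesis
            using runs_within_mono[OF run le(2)[OF n1]] by blast
        qed
        ultimately show "\<exists>I'\<in>instances ?Q.
            runs_within (R \<alpha>) (enc_inst ?Q I) (enc_inst ?Q I')
              (a' \<alpha> * inst_size ?Q I ^ (K * c (slack \<alpha> / 4) + K)) \<and>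
            inst_size ?Q I' + param ?Q I' \<le> 14 * (param ?Q I + 1) ^ (14 * length (threshold \<alpha>)) \<and>
            (\<forall>s'\<in>candidates ?Q I'. \<exists>s\<in>candidates ?Q I.
              runs_within (L \<alpha>) (Node (enc_inst ?Q I) (Node (enc_inst ?Q I') (enc_sol ?Q I' s')))
                (enc_sol ?Q I s) (a' \<alpha> * inst_size ?Q I ^ (K * c (slack \<alpha> / 4) + K)) \<and>
              ratio ?Q I s \<le> ennreal \<alpha> * ratio ?Q I' s')"
          using I'(1,3) by (intro bexI[of _ I'] conjI ballI) simp_all
      qed
      then show "\<exists>b d. approx_kernelization ?Q \<alpha> (R \<alpha>) (L \<alpha>)
          (\<lambda>n. a' \<alpha> * n ^ (K * c (slack \<alpha> / 4) + K)) (\<lambda>k. b * (k + 1) ^ d)" by blast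
    qed
    moreover have "kernel_vertices_le \<G> (R \<alpha>) (\<lambda>k. if k \<le> 1 then 0 else real (k ^ (7 * length (threshold \<alpha>))))"
      if \<alpha>: "1 < \<alpha>" for \<alpha>
      unfolding kernel_vertices_le_def
    proof (intro allI impI)
      fix G S G' S' t
      assume I: "(G, S) \<in> instances ?Q" and run: "runs (R \<alpha>) (enc_inst ?Q (G, S)) (enc_inst ?Q (G', S')) t"
      obtain I' where I': "runs_within (R \<alpha>) (enc_inst ?Q (G, S)) (enc_inst ?Q I')
             (aR \<alpha> * inst_size ?Q (G, S) ^ (KR * c (slack \<alpha> / 4) + KR))"
          "card (verts (fst I')) \<le> (if card S \<le> 1 then 0 else card S ^ (7 * length (threshold \<alpha>)))"
        using inst[OF I \<alpha>] by blast
      obtain H U where HU: "I' = (H, U)" by fastforce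
      \<comment> \<open>The vertex bound concerns every instance that the output may encode.
        Determinism identifies the two encodings, which then have equally many vertices.\<close>
      have "enc_inst ?Q (H, U) = enc_inst ?Q (G', S')"
        using I'(1) run runs_deterministic unfolding runs_within_def HU by metis
      then have "encode (mat_of H) = encode (mat_of G')" by (simp add: CVC_deletion_def enc_graph_encode)
      then have "card (verts H) = card (verts G')" using encode_eq_length by fastforce
      then have "card (verts G') \<le> (if card S \<le> 1 then 0 else card S ^ (7 * length (threshold \<alpha>)))"
        using I'(2) HU by simp
      then show "real (card (verts G')) \<le> (if card S \<le> 1 then 0 else real (card S ^ (7 * length (threshold \<alpha>))))"
        by (simp split: if_splits)
    qed
    ultimately show ?thesis by blast
  qed
  then show ?thesis by blast
qed

lemma kernel_vertices_le_mono:
  assumes "kernel_vertices_le \<G> R h" "\<And>k. h k \<le> h' k"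
  shows "kernel_vertices_le \<G> R h'"
  unfolding kernel_vertices_le_def
proof (intro allI impI)
  fix G S G' S' t
  assume "(G, S) \<in> instances (CVC_deletion \<G>)" "(G', S') \<in> instances (CVC_deletion \<G>)"
    "runs R (enc_inst (CVC_deletion \<G>) (G, S)) (enc_inst (CVC_deletion \<G>) (G', S')) t"
  then have "real (card (verts G')) \<le> h (card S)"
    using assms(1) unfolding kernel_vertices_le_def by blast
  then show "real (card (verts G')) \<le> h' (card S)" using assms(2) by (rule order_trans)
qed

theorem theorem1:
  fixes \<G> :: "graph set" and P :: "real \<Rightarrow> prog"
  assumes "graph_class \<G>"
    and "hereditary \<G>"
    and "polytime_recognizable \<G>"
    and "is_PTAS (CVC_on (plus_one_vertex \<G>)) P"
  shows "\<exists>R L. is_PSAKS (CVC_deletion \<G>) R L \<and>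
    (\<exists>C::real. \<forall>\<epsilon>::real. 0 < \<epsilon> \<and> \<epsilon> < 1 \<longrightarrow>
       kernel_vertices_le \<G> (R (1 + \<epsilon>)) (\<lambda>k. real k powr (C / \<epsilon>))) \<and>
    (is_EPTAS (CVC_on (plus_one_vertex \<G>)) P \<longrightarrow>
       is_time_efficient_PSAKS (CVC_deletion \<G>) R L)"
proof -
  let ?Q = "CVC_deletion \<G>"
  obtain R L K where scheme: "\<forall>a c. approx_scheme_within (CVC_on (plus_one_vertex \<G>)) P (\<lambda>\<epsilon> n. a \<epsilon> * n ^ c \<epsilon>) \<longrightarrow>
    (\<exists>a'. PSAKS_within ?Q R L (\<lambda>\<alpha> n. a' \<alpha> * n ^ (K * c (slack \<alpha> / 4) + K))) \<and>
    (\<forall>\<alpha>>1. kernel_vertices_le \<G> (R \<alpha>)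
      (\<lambda>k. if k \<le> 1 then 0 else real (k ^ (7 * length (threshold \<alpha>)))))"
    using kernelization_scheme[OF assms(1,2), of P] by (elim exE)
  note main = scheme[THEN spec, THEN spec, THEN mp]
  obtain a c where ac: "approx_scheme_within (CVC_on (plus_one_vertex \<G>)) P (\<lambda>\<epsilon> n. a \<epsilon> * n ^ c \<epsilon>)"
    using assms(4) unfolding is_PTAS_def by blast
  have psaks: "is_PSAKS ?Q R L"
  proof -
    obtain a' where "PSAKS_within ?Q R L (\<lambda>\<alpha> n. a' \<alpha> * n ^ (K * c (slack \<alpha> / 4) + K))"
      using main[OF ac] by blast
    then show ?thesis
      unfolding is_PSAKS_def by (intro exI[of _ a'] exI[of _ "\<lambda>\<alpha>. K * c (slack \<alpha> / 4) + K"])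
  qed
  \<comment> \<open>154 = 7 times 22: the exponent is 7 d, and the threshold d is at most 22 /
    \<epsilon>.\<close>
  have small: "kernel_vertices_le \<G> (R (1 + \<epsilon>)) (\<lambda>k. real k powr (154 / \<epsilon>))"
    if \<epsilon>: "0 < \<epsilon>" "\<epsilon> < 1" for \<epsilon>
  proof -
    have "slack (1 + \<epsilon>) = \<epsilon>" using \<epsilon> by (simp add: slack_def)
    then have d: "real (7 * length (threshold (1 + \<epsilon>))) \<le> 154 / \<epsilon>"
      using length_threshold(3)[of "1 + \<epsilon>"] \<epsilon> by simp
    have *: "(if k \<le> 1 then 0 else real (k ^ (7 * length (threshold (1 + \<epsilon>))))) \<le> real k powr (154 / \<epsilon>)" for k
    proof (cases "k \<le> 1")
      case False
      then have "real (k ^ (7 * length (threshold (1 + \<epsilon>)))) = real k powr real (7 * length (threshold (1 + \<epsilon>)))"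
        by (subst powr_realpow) auto
      also have "\<dots> \<le> real k powr (154 / \<epsilon>)" using d False by (intro powr_mono) auto
      finally show ?thesis using False by simp
    qed simp
    have "kernel_vertices_le \<G> (R (1 + \<epsilon>))
        (\<lambda>k. if k \<le> 1 then 0 else real (k ^ (7 * length (threshold (1 + \<epsilon>)))))"
      using main[OF ac] \<epsilon> by simp
    then show ?thesis by (rule kernel_vertices_le_mono[OF _ *])
  qed
  have "is_time_efficient_PSAKS ?Q R L" if eptas: "is_EPTAS (CVC_on (plus_one_vertex \<G>)) P"
  proof -
    obtain f e where fe: "approx_scheme_within (CVC_on (plus_one_vertex \<G>)) P (\<lambda>\<epsilon> n. f \<epsilon> * n ^ e)"
      using eptas unfolding is_EPTAS_def by blast
    obtain a' where "PSAKS_within ?Q R L (\<lambda>\<alpha> n. a' \<alpha> * n ^ (K * e + K))"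
      using main[OF fe] by blast
    then show ?thesis unfolding is_time_efficient_PSAKS_def by blast
  qed
  then show ?thesis using psaks small by blast
qed

end
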